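(* Let $a,b,c,d,e,f$ be real with $a,d>0$, $4ac-b^2>0$, $4df-e^2>0$, and let $$\Omega_1:\ ax^2+bxy+cy^2\le 1,\qquad \Omega_2:\ dx^2+exy+fy^2\le 1 .$$ Then the covariance between the normalized lattice-point error functions $F_{\Omega_1}(t)$ and $F_{\Omega_2}(t)$ is $$\frac{16\pi}{\sqrt{4ac-b^2}\sqrt{4df-e^2}}\sum_{\substack{\nu>0:\\ r_1(\nu)\ne0,\ r_2(\nu)\neq0}}\frac{r_1(\nu)r_2(\nu)}{\nu^3},$$ where $r_1(\nu)$ is the number of integer solutions $(n_1,n_2)$ of $$4\pi\frac{\sqrt{cn_1^2-bn_1n_2+an_2^2}}{\sqrt{4ac-b^2}}=\nu$$ and $r_2(\nu)$ is the number of integer solutions $(m_1,m_2)$ of $$4\pi\frac{\sqrt{fm_1^2-em_1m_2+dm_2^2}}{\sqrt{4df-e^2}}=\nu .$$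
   Context: For a planar domain $\Omega$ and $R>0$: $N(R)=\#(\mathbb{Z}^2\cap R\Omega)$, $E(R)=N(R)-\mathrm{Area}(\Omega)R^2$, $F_\Omega(R)=E(R)/R^{1/2}$. The covariance of two such functions $F_1,F_2$ is $\lim_{T\to\infty}\frac1T\int_{1}^{T}F_1(t)F_2(t)\,dt$. *)

theory Defs
  imports "HOL-Analysis.Analysis"
begin

definition lattice_count :: "(real \<times> real) set \<Rightarrow> real \<Rightarrow> nat" where
  "lattice_count \<Omega> R =
     card {(m :: int, n :: int). (of_int m, of_int n) \<in> (\<lambda>p. R *\<^sub>R p) ` \<Omega>}"

definition lattice_error :: "(real \<times> real) set \<Rightarrow> real \<Rightarrow> real" where
  "lattice_error \<Omega> R = real (lattice_count \<Omega> R) - measure lebesgue \<Omega> * R\<^sup>2"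

definition normalized_error :: "(real \<times> real) set \<Rightarrow> real \<Rightarrow> real" where
  "normalized_error \<Omega> R = lattice_error \<Omega> R / R powr (1 / 2)"

text \<open>Integrability is part of the definition because the Bochner integral of a
  non-integrable function is 0 by convention.\<close>
definition has_covariance :: "(real \<Rightarrow> real) \<Rightarrow> (real \<Rightarrow> real) \<Rightarrow> real \<Rightarrow> bool" where
  "has_covariance F G C \<longleftrightarrow>
     (\<forall>T\<ge>1. set_integrable lborel {1..T} (\<lambda>t. F t * G t)) \<and>
     ((\<lambda>T. 1 / T * (LBINT t:{1..T}. F t * G t)) \<longlongrightarrow> C) at_top"

definition ellipse :: "real \<Rightarrow> real \<Rightarrow> real \<Rightarrow> (real \<times> real) set" where
  "ellipse a b c = {(x, y). a * x\<^sup>2 + b * x * y + c * y\<^sup>2 \<le> 1}"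

text \<open>The outer coefficients are swapped and the middle one negated: the form below is the
  adjugate of the one defining \<^term>\<open>ellipse a b c\<close>. For a positive definite form the set of
  solutions is finite, so \<^const>\<open>card\<close> is the true number of solutions.\<close>
definition freq_mult :: "real \<Rightarrow> real \<Rightarrow> real \<Rightarrow> real \<Rightarrow> nat" where
  "freq_mult a b c \<nu> =
     card {(n1 :: int, n2 :: int).
       4 * pi * (sqrt (c * (of_int n1)\<^sup>2 - b * of_int n1 * of_int n2 + a * (of_int n2)\<^sup>2)
         / sqrt (4 * a * c - b\<^sup>2)) = \<nu>}"

end

theory Submission
  imports Defs "HOL-Probability.Characteristic_Functions" "HOL-Real_Asymp.Real_Asymp"
begin

text \<open>Write \<open>g(s) = 2 J\<^sub>1(s) / s\<close>, so that the Fourier transform of the ellipse of size \<open>R\<close> at a lattice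
  point with dual frequency \<open>\<nu>\<close> is \<open>A R\<^sup>2 g(\<nu> R)\<close>, with \<open>A\<close> the area of the unit ellipse. Convolving the
  indicator of the ellipse of size \<open>R\<close> with that of the ellipse of size \<open>\<delta>\<close> and applying Poisson summation
  sandwiches the number of lattice points of size at most \<open>R\<close> between absolutely convergent sums
  \<open>A X\<^sup>2 \<Sum> g(\<nu> X) g(\<nu> \<delta>)\<close> with \<open>X = R \<plusminus> 2 \<delta>\<close>; the triangle inequality for the norm defined by the
  quadratic form is all that is needed. With \<open>\<delta>\<close> a power of \<open>R\<close> this gives the error bound \<open>O(R\<^bsup>3/4\<^esup>)\<close>, and
  applied to the dual form it bounds the number of dual frequencies in a thin annulus.

  With \<open>\<delta> = T\<^bsup>-3/4\<^esup> / 8\<close> and the asymptotics of \<open>g\<close>, the normalized error on \<open>[1, T]\<close> is a trigonometric sum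
  over the frequencies up to terms whose mean square tends to 0. A Gaussian weight reduces the mean square of
  the part with \<open>\<nu> > M\<close> to counting pairs of frequencies at distance at most \<open>T\<^bsup>-7/8\<^esup>\<close>, and the annulus bound
  makes this \<open>O(\<Sum>\<^bsub>\<nu> > M\<^esub> \<nu>\<^bsup>-9/4\<^esup>)\<close>. So the error is a mean-square limit of trigonometric
  polynomials, and its covariances are the limits of theirs.\<close>

section \<open>The normalised Bessel function\<close>

text \<open>In the plane \<open>g(\<nu> R)\<close> decays only like \<nu>^(-3/2), while absolute
  convergence over a lattice requires an exponent above 2; the second factor
  \<open>g(\<nu> \<delta>)\<close> supplies the missing decay. Two widths \<delta> are lost on each
  side: one to the averaging over small translates, one to the Fejer kernel, which stands in for the
  sum over lattice points. The dual frequencies of a real form may lie arbitrarily close together,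
  so no gap between them can be exploited; only their number in a short interval can. That number
  enters with weight \<nu>^(-3). A lattice count with error O(R^(3/4)) turns this into the summable
  \<nu>^(-9/4), whereas the elementary error O(R) would give \<nu>^(-2) and just fail. This is why a
  power saving has to be proved before any mean square is estimated. The smoothing width depends on
  T, but the approximating polynomials do not: in the part \<nu> <= M the smoothing factor tends to
  1, and the estimate of the rest does not depend on where the series is finally cut.\<close>

text \<open>This is the function \<open>g\<close> above: \<open>nbessel s = 2 J\<^sub>1(s) / s\<close>.\<close>
definition nbessel :: "real \<Rightarrow> real" where
  "nbessel s = 2 / pi * integral {-1..1} (\<lambda>u. sqrt (1 - u\<^sup>2) * cos (s * u))"

section \<open>Integrals of rational, Gaussian and Fresnel type\<close>

lemma quartic_denominator_factor:
  fixes x :: real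
  shows "x\<^sup>2 + sqrt 2 * x + 1 > 0" "x\<^sup>2 - sqrt 2 * x + 1 > 0"
    "(x\<^sup>2 + sqrt 2 * x + 1) * (x\<^sup>2 - sqrt 2 * x + 1) = 1 + x ^ 4"
proof -
  have "x\<^sup>2 + sqrt 2 * x + 1 = (x + sqrt 2 / 2)\<^sup>2 + 1/2"
    by (simp add: power2_sum power_divide algebra_simps)
  then show "x\<^sup>2 + sqrt 2 * x + 1 > 0" by (metis add_nonneg_pos half_gt_zero zero_le_power2 zero_less_one)
  have "x\<^sup>2 - sqrt 2 * x + 1 = (x - sqrt 2 / 2)\<^sup>2 + 1/2"
    by (simp add: power2_diff power_divide algebra_simps)
  then show "x\<^sup>2 - sqrt 2 * x + 1 > 0" by (metis add_nonneg_pos half_gt_zero zero_le_power2 zero_less_one)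
  show "(x\<^sup>2 + sqrt 2 * x + 1) * (x\<^sup>2 - sqrt 2 * x + 1) = 1 + x ^ 4"
    by (simp add: algebra_simps power2_eq_square eval_nat_numeral)
qed

text \<open>Partial fractions over the real factorisation of 1 + x^4. The logarithms in the
  antiderivative cancel at both ends of the line, so each integral is the total change of the two
  arctangents.\<close>

lemma has_bochner_integral_quartic_denominator:
  defines "I \<equiv> (\<lambda>k. LBINT x::real. x ^ k / (1 + x ^ 4))"
  shows "integrable lborel (\<lambda>x::real. x ^ 0 / (1 + x ^ 4))" "I 0 = pi / sqrt 2"
    "integrable lborel (\<lambda>x::real. x ^ 2 / (1 + x ^ 4))" "I 2 = pi / sqrt 2"
proof -
  \<comment> \<open>The parameter c treats both integrals at once: the derivative of
    \<open>F c\<close> is 1 / (1 + x^4) for c = -1 and x^2 / (1 + x^4) for c = 1. For c in [-1, 1]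
    the integrand is nonnegative, which yields integrability along with the value.\<close>
  define F :: "real \<Rightarrow> real \<Rightarrow> real" where "F = (\<lambda>c x. c / (4 * sqrt 2) * (ln (x\<^sup>2 - sqrt 2 * x + 1) - ln (x\<^sup>2 + sqrt 2 * x + 1))
     + 1 / (2 * sqrt 2) * (arctan (sqrt 2 * x + 1) + arctan (sqrt 2 * x - 1)))"
  have r: "sqrt 2 * sqrt 2 = (2::real)" by simp
  have pos: "1 + x ^ 4 > 0" for x :: real by (simp add: add_pos_nonneg)
  have at1: "1 + (sqrt 2 * x + 1)\<^sup>2 = 2 * (x\<^sup>2 + sqrt 2 * x + 1)" for x :: real
    by (simp add: power2_eq_square algebra_simps)
  have at2: "1 + (sqrt 2 * x - 1)\<^sup>2 = 2 * (x\<^sup>2 - sqrt 2 * x + 1)" for x :: real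
    by (simp add: power2_eq_square algebra_simps)
  have alg: "c / (4 * sqrt 2) * ((2*x - sqrt 2) / P - (2*x + sqrt 2) / Q) + 1 / (2 * sqrt 2) * (sqrt 2 / (2 * Q) + sqrt 2 / (2 * P))
     = ((1 - c) / 2 + (1 + c) / 2 * x\<^sup>2) / (P * Q)"
    if "P = x\<^sup>2 - sqrt 2 * x + 1" "Q = x\<^sup>2 + sqrt 2 * x + 1" "P > 0" "Q > 0" for c x P Q :: real
  proof -
    have e1: "(2*x - sqrt 2) / P - (2*x + sqrt 2) / Q = ((2*x - sqrt 2) * Q - (2*x + sqrt 2) * P) / (P * Q)"
      using that(3,4) by (simp add: field_simps)
    have e2: "(2*x - sqrt 2) * Q - (2*x + sqrt 2) * P = 2 * sqrt 2 * (x\<^sup>2 - 1)"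
      unfolding that(1,2) by (simp add: algebra_simps power2_eq_square)
    have e3: "sqrt 2 / (2 * Q) + sqrt 2 / (2 * P) = sqrt 2 / 2 * ((P + Q) / (P * Q))"
      using that(3,4) by (simp add: field_simps)
    have e4: "P + Q = 2 * x\<^sup>2 + 2" unfolding that(1,2) by simp
    show ?thesis unfolding e1 e2 e3 e4 using that(3,4) by (simp add: field_simps)
  qed
  have dln: "((\<lambda>x. ln (x\<^sup>2 - sqrt 2 * x + 1)) has_real_derivative (2*x - sqrt 2) / (x\<^sup>2 - sqrt 2 * x + 1)) (at x)"
    "((\<lambda>x. ln (x\<^sup>2 + sqrt 2 * x + 1)) has_real_derivative (2*x + sqrt 2) / (x\<^sup>2 + sqrt 2 * x + 1)) (at x)" for x :: real
    using quartic_denominator_factor(1,2)[of x] by (auto intro!: derivative_eq_intros)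
  have dat: "((\<lambda>x. arctan (sqrt 2 * x + 1)) has_real_derivative sqrt 2 / (1 + (sqrt 2 * x + 1)\<^sup>2)) (at x)"
    "((\<lambda>x. arctan (sqrt 2 * x - 1)) has_real_derivative sqrt 2 / (1 + (sqrt 2 * x - 1)\<^sup>2)) (at x)" for x :: real
    by (auto intro!: derivative_eq_intros simp: divide_inverse)
  have der: "(F c has_real_derivative ((1 - c) / 2 + (1 + c) / 2 * x\<^sup>2) / (1 + x ^ 4)) (at x)" for c x
  proof -
    have "(F c has_real_derivative c / (4 * sqrt 2) * ((2*x - sqrt 2) / (x\<^sup>2 - sqrt 2 * x + 1) - (2*x + sqrt 2) / (x\<^sup>2 + sqrt 2 * x + 1))
      + 1 / (2 * sqrt 2) * (sqrt 2 / (1 + (sqrt 2 * x + 1)\<^sup>2) + sqrt 2 / (1 + (sqrt 2 * x - 1)\<^sup>2))) (at x)"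
      unfolding F_def by (intro DERIV_add DERIV_cmult DERIV_diff dln dat)
    also have "c / (4 * sqrt 2) * ((2*x - sqrt 2) / (x\<^sup>2 - sqrt 2 * x + 1) - (2*x + sqrt 2) / (x\<^sup>2 + sqrt 2 * x + 1))
      + 1 / (2 * sqrt 2) * (sqrt 2 / (1 + (sqrt 2 * x + 1)\<^sup>2) + sqrt 2 / (1 + (sqrt 2 * x - 1)\<^sup>2))
      = ((1 - c) / 2 + (1 + c) / 2 * x\<^sup>2) / (1 + x ^ 4)"
      unfolding at1 at2 quartic_denominator_factor(3)[symmetric] 
      by (subst mult.commute[of "x\<^sup>2 + sqrt 2 * x + 1"]) (rule alg[OF refl refl quartic_denominator_factor(2,1)])
    finally show ?thesis .
  qed
  have lims: "(F c \<longlongrightarrow> pi / (2 * sqrt 2)) at_top" "(F c \<longlongrightarrow> - pi / (2 * sqrt 2)) at_bot" for c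
  proof -
    have "((\<lambda>x. c / (4 * r) * (ln (x\<^sup>2 - r * x + 1) - ln (x\<^sup>2 + r * x + 1)) + 1 / (2 * r) * (arctan (r * x + 1) + arctan (r * x - 1))) \<longlongrightarrow> pi / (2 * r)) at_top"
      "((\<lambda>x. c / (4 * r) * (ln (x\<^sup>2 - r * x + 1) - ln (x\<^sup>2 + r * x + 1)) + 1 / (2 * r) * (arctan (r * x + 1) + arctan (r * x - 1))) \<longlongrightarrow> - pi / (2 * r)) at_bot" if "r > 0" for r :: real
      using that by real_asymp+
    then show "(F c \<longlongrightarrow> pi / (2 * sqrt 2)) at_top" "(F c \<longlongrightarrow> - pi / (2 * sqrt 2)) at_bot"
      unfolding F_def by simp_all
  qed
  have main: "set_integrable lborel (einterval (-\<infinity>) \<infinity>) (\<lambda>x. ((1 - c) / 2 + (1 + c) / 2 * x\<^sup>2) / (1 + x ^ 4))"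
     "(LBINT x=-\<infinity>..\<infinity>. ((1 - c) / 2 + (1 + c) / 2 * x\<^sup>2) / (1 + x ^ 4)) = pi / (2 * sqrt 2) - (- pi / (2 * sqrt 2))"
    if "-1 \<le> c" "c \<le> 1" for c
  proof -
    have 1: "((F c \<circ> real_of_ereal) \<longlongrightarrow> - pi / (2 * sqrt 2)) (at_right (-\<infinity>))"
      using lims(2) by (simp add: ereal_tendsto_simps)
    have 2: "((F c \<circ> real_of_ereal) \<longlongrightarrow> pi / (2 * sqrt 2)) (at_left \<infinity>)"
      using lims(1) by (simp add: ereal_tendsto_simps)
    have 3: "isCont (\<lambda>x. ((1 - c) / 2 + (1 + c) / 2 * x\<^sup>2) / (1 + x ^ 4)) x" for x
      using pos[of x] by (intro continuous_intros) auto
    have 4: "0 \<le> ((1 - c) / 2 + (1 + c) / 2 * x\<^sup>2) / (1 + x ^ 4)" for x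
    proof -
      have "0 \<le> (1 - c) / 2" "0 \<le> (1 + c) / 2" using that by auto
      then have "0 \<le> (1 - c) / 2 + (1 + c) / 2 * x\<^sup>2"
        by (rule add_nonneg_nonneg[OF _ mult_nonneg_nonneg[OF _ zero_le_power2]])
      then show ?thesis using pos[of x] by (rule divide_nonneg_pos)
    qed
    note FTC = interval_integral_FTC_nonneg[where F = "F c" and a = "-\<infinity>" and b = \<infinity> and A = "- pi / (2 * sqrt 2)" and B = "pi / (2 * sqrt 2)"
       and f = "\<lambda>x. ((1 - c) / 2 + (1 + c) / 2 * x\<^sup>2) / (1 + x ^ 4)"]
    show "set_integrable lborel (einterval (-\<infinity>) \<infinity>) (\<lambda>x. ((1 - c) / 2 + (1 + c) / 2 * x\<^sup>2) / (1 + x ^ 4))"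
     "(LBINT x=-\<infinity>..\<infinity>. ((1 - c) / 2 + (1 + c) / 2 * x\<^sup>2) / (1 + x ^ 4)) = pi / (2 * sqrt 2) - (- pi / (2 * sqrt 2))"
      by (rule FTC; use der 1 2 3 4 in auto)+
  qed
  have ei: "einterval (-\<infinity>) \<infinity> = (UNIV :: real set)" by (auto simp: einterval_iff)
  have v: "pi / (2 * sqrt 2) - (- pi / (2 * sqrt 2)) = pi / sqrt 2" by (simp add: field_simps)
  show "integrable lborel (\<lambda>x::real. x ^ 0 / (1 + x ^ 4))" "I 0 = pi / sqrt 2"
    using main[of "-1"] v by (simp_all add: ei set_integrable_def I_def interval_lebesgue_integral_def set_lebesgue_integral_def)
  show "integrable lborel (\<lambda>x::real. x ^ 2 / (1 + x ^ 4))" "I 2 = pi / sqrt 2"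
    using main[of "1"] v by (simp_all add: ei set_integrable_def I_def interval_lebesgue_integral_def set_lebesgue_integral_def)
qed

text \<open>Substitution of x / sqrt s for x. The two values agree, which is why the Fresnel-type
  integral below comes out as a multiple of sin s - cos s.\<close>

lemma has_bochner_integral_quartic_scaled:
  fixes s :: real
  assumes s: "s > 0"
  shows "has_bochner_integral lborel (\<lambda>x. x\<^sup>2 / (x ^ 4 + s\<^sup>2)) (pi / sqrt (2 * s))"
    "has_bochner_integral lborel (\<lambda>x. s / (x ^ 4 + s\<^sup>2)) (pi / sqrt (2 * s))"
proof -
  note Q = has_bochner_integral_quartic_denominator
  have r: "sqrt s ^ 4 = s\<^sup>2" using s by (simp add: power4_eq_xxxx power2_eq_square) 
  have nz: "1 / sqrt s \<noteq> 0" using s by simp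
  have pos: "1 + x ^ 4 > 0" for x :: real by (simp add: add_pos_nonneg)
  have e: "1 + (0 + 1 / sqrt s * x) ^ 4 = (x ^ 4 + s\<^sup>2) / s\<^sup>2" for x
    using s by (simp add: power_mult_distrib power_divide r field_simps)
  have pos2: "x ^ 4 + s\<^sup>2 > 0" for x using s by (simp add: add_nonneg_pos)
  have k: "has_bochner_integral lborel (\<lambda>x. (0 + 1 / sqrt s * x) ^ k / (1 + (0 + 1 / sqrt s * x) ^ 4)) (pi / sqrt 2 /\<^sub>R \<bar>1 / sqrt s\<bar>)" if "k = 0 \<or> k = 2" for k
    using that Q by (subst lborel_has_bochner_integral_real_affine_iff[OF nz, symmetric]) (auto simp: has_bochner_integral_iff)
  have v: "pi / sqrt 2 /\<^sub>R \<bar>1 / sqrt s\<bar> = s * (pi / sqrt (2 * s))"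
    using s by (simp add: real_sqrt_mult field_simps real_sqrt_mult_self)
  have "has_bochner_integral lborel (\<lambda>x. (1/s) * ((0 + 1 / sqrt s * x) ^ 2 / (1 + (0 + 1 / sqrt s * x) ^ 4))) ((1/s) * (s * (pi / sqrt (2 * s))))"
    using k[of 2] unfolding v by (intro has_bochner_integral_mult_right) auto
  moreover have "(1/s) * ((0 + 1 / sqrt s * x) ^ 2 / (1 + (0 + 1 / sqrt s * x) ^ 4)) = x\<^sup>2 / (x ^ 4 + s\<^sup>2)" for x
    unfolding e using s pos2[of x] by (simp add: power_mult_distrib power_divide power2_eq_square)
  ultimately show "has_bochner_integral lborel (\<lambda>x. x\<^sup>2 / (x ^ 4 + s\<^sup>2)) (pi / sqrt (2 * s))" using s by simp
  have "has_bochner_integral lborel (\<lambda>x. (1/s) * ((0 + 1 / sqrt s * x) ^ 0 / (1 + (0 + 1 / sqrt s * x) ^ 4))) ((1/s) * (s * (pi / sqrt (2 * s))))"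
    using k[of 0] unfolding v by (intro has_bochner_integral_mult_right) auto
  moreover have "(1/s) * ((0 + 1 / sqrt s * x) ^ 0 / (1 + (0 + 1 / sqrt s * x) ^ 4)) = s / (x ^ 4 + s\<^sup>2)" for x
    unfolding e using s pos2[of x] by (simp add: power2_eq_square)
  ultimately show "has_bochner_integral lborel (\<lambda>x. s / (x ^ 4 + s\<^sup>2)) (pi / sqrt (2 * s))" using s by simp
qed

lemma has_bochner_integral_gaussian:
  fixes v :: real assumes v: "v > 0"
  shows "has_bochner_integral lborel (\<lambda>x. exp (- v * x\<^sup>2)) (sqrt pi / sqrt v)"
proof -
  define \<sigma> where "\<sigma> = sqrt (1 / (2 * v))"
  have \<sigma>: "\<sigma> > 0" "\<sigma>\<^sup>2 = 1 / (2 * v)" using v by (auto simp: \<sigma>_def)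
  have "has_bochner_integral lborel (\<lambda>x. sqrt pi / sqrt v * normal_density 0 \<sigma> x) (sqrt pi / sqrt v * 1)"
    using \<sigma> by (intro has_bochner_integral_mult_right) (auto simp: has_bochner_integral_iff)
  moreover have "sqrt pi / sqrt v * normal_density 0 \<sigma> x = exp (- v * x\<^sup>2)" for x
    using v by (simp add: normal_density_def \<sigma> real_sqrt_divide)
  ultimately show ?thesis by simp
qed

text \<open>Used with a = x^2 as the inner integral after an exchange of integrations. The endpoint
  v = 1 contributes the term with exp (- a), the endpoint v = 0 the two others.\<close>

lemma integral_exp_sin:
  fixes a s :: real assumes s: "s > 0"
  shows "((\<lambda>v. exp (- v * a) * sin (s * (1 - v))) has_integral
     (s * exp (- a) + a * sin s - s * cos s) / (a\<^sup>2 + s\<^sup>2)) {0..1}"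
proof -
  define K where "K = 1 / (a\<^sup>2 + s\<^sup>2)"
  define F where "F = (\<lambda>v. K * (exp (- v * a) * (s * cos (s * (1 - v)) - a * sin (s * (1 - v)))))"
  have pos: "a\<^sup>2 + s\<^sup>2 > 0" using s by (simp add: add_nonneg_pos)
  have "((\<lambda>v. exp (- v * a) * sin (s * (1 - v))) has_integral (F 1 - F 0)) {0..1}"
  proof (rule fundamental_theorem_of_calculus)
    fix v :: real
    have "(F has_real_derivative K * ((-a) * exp (- v * a) * (s * cos (s * (1 - v)) - a * sin (s * (1 - v)))
       + exp (- v * a) * (s * s * sin (s * (1 - v)) + a * s * cos (s * (1 - v))))) (at v)"
      unfolding F_def by (auto intro!: derivative_eq_intros simp: algebra_simps)
    also have "K * ((-a) * exp (- v * a) * (s * cos (s * (1 - v)) - a * sin (s * (1 - v)))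
       + exp (- v * a) * (s * s * sin (s * (1 - v)) + a * s * cos (s * (1 - v))))
       = exp (- v * a) * sin (s * (1 - v)) * ((a\<^sup>2 + s\<^sup>2) * K)"
      by (simp add: algebra_simps power2_eq_square)
    also have "(a\<^sup>2 + s\<^sup>2) * K = 1" unfolding K_def inverse_eq_divide[symmetric] using pos by (intro right_inverse) linarith
    finally show "(F has_vector_derivative exp (- v * a) * sin (s * (1 - v))) (at v within {0..1})"
      by (simp add: has_real_derivative_iff_has_vector_derivative[symmetric] has_field_derivative_at_within)
  qed simp
  also have "F 1 - F 0 = K * (s * exp (- a) + a * sin s - s * cos s)"
    by (simp add: F_def algebra_simps)
  also have "\<dots> = (s * exp (- a) + a * sin s - s * cos s) / (a\<^sup>2 + s\<^sup>2)"
    by (simp add: K_def)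
  finally show ?thesis .
qed

lemma set_integrable_inverse_sqrt:
  "set_integrable lborel {0<..<1::real} (\<lambda>v. 1 / sqrt v)"
proof -
  have "set_integrable lborel (einterval 0 1) (\<lambda>v. 1 / sqrt v)"
  proof (rule interval_integral_FTC_nonneg(1)[where F = "\<lambda>v. 2 * sqrt v" and A = 0 and B = 2])
    show "DERIV (\<lambda>v. 2 * sqrt v) x :> 1 / sqrt x" if "0 < ereal x" for x
      using that by (auto intro!: derivative_eq_intros simp: field_simps)
    show "isCont (\<lambda>v. 1 / sqrt v) x" if "0 < ereal x" for x
      using that by (intro continuous_intros) auto
    have "((\<lambda>v. 2 * sqrt v) \<longlongrightarrow> 2 * sqrt 0) (at_right 0)" by (intro tendsto_intros)
    then show "(((\<lambda>v. 2 * sqrt v) \<circ> real_of_ereal) \<longlongrightarrow> 0) (at_right 0)"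
      by (simp add: zero_ereal_def ereal_tendsto_simps)
    have "((\<lambda>v. 2 * sqrt v) \<longlongrightarrow> 2 * sqrt 1) (at_left 1)" by (intro tendsto_intros)
    then show "(((\<lambda>v. 2 * sqrt v) \<circ> real_of_ereal) \<longlongrightarrow> 2) (at_left 1)"
      by (simp add: one_ereal_def ereal_tendsto_simps)
  qed auto
  then show ?thesis by (simp add: zero_ereal_def one_ereal_def)
qed

lemma set_lebesgue_integral_eq_HK_open:
  fixes f :: "real \<Rightarrow> real"
  assumes "set_integrable lborel {a<..<b} f"
  shows "f integrable_on {a..b}" "(LBINT v:{a<..<b}. f v) = integral {a..b} f"
  using set_borel_integral_eq_integral[OF assms]
  by (simp_all add: integrable_on_Icc_iff_Ioo integral_open_interval_real)

text \<open>Since sqrt (pi / v) is the integral of exp (- v x^2) over x, Fubini leaves an elementary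
  integral in v. Its sin s and cos s terms integrate over x to the main term exactly; the remaining
  term, with exp (- x^2), is the error.\<close>

lemma integral_sin_over_sqrt:
  fixes s :: real assumes s: "s > 0"
  shows "(\<lambda>v. sin (s * (1 - v)) / sqrt v) integrable_on {0..1}"
    "\<bar>integral {0..1} (\<lambda>v. sin (s * (1 - v)) / sqrt v) - sqrt (pi / (2 * s)) * (sin s - cos s)\<bar> \<le> 1 / s"
proof -
  define f :: "real \<Rightarrow> real \<Rightarrow> real" where "f = (\<lambda>v x. indicator {0<..<1} v * (exp (- v * x\<^sup>2) * sin (s * (1 - v))))"
  have [measurable]: "case_prod f \<in> borel_measurable (lborel \<Otimes>\<^sub>M lborel)"
    unfolding f_def by measurable
  have gauss: "has_bochner_integral lborel (\<lambda>x. f v x) (indicator {0<..<1} v * sin (s * (1 - v)) * (sqrt pi / sqrt v))" for v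
  proof (cases "v \<in> {0<..<1}")
    case True
    then have "has_bochner_integral lborel (\<lambda>x. sin (s * (1 - v)) * exp (- v * x\<^sup>2)) (sin (s * (1 - v)) * (sqrt pi / sqrt v))"
      by (intro has_bochner_integral_mult_right has_bochner_integral_gaussian) auto
    with True show ?thesis by (simp add: f_def mult.commute)
  qed (auto simp: f_def)
  have gauss_abs: "(LBINT x. norm (f v x)) = indicator {0<..<1} v * \<bar>sin (s * (1 - v))\<bar> * (sqrt pi / sqrt v)" for v
  proof -
    have "(LBINT x. norm (f v x)) = (LBINT x. (indicator {0<..<1} v * \<bar>sin (s * (1 - v))\<bar>) * exp (- v * x\<^sup>2))"
      by (simp add: f_def abs_mult mult_ac)
    also have "\<dots> = indicator {0<..<1} v * \<bar>sin (s * (1 - v))\<bar> * (sqrt pi / sqrt v)"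
      using has_bochner_integral_gaussian[of v, THEN has_bochner_integral_integral_eq]
      by (cases "v \<in> {0<..<1}") auto
    finally show ?thesis .
  qed
  have sq: "integrable lborel (\<lambda>v. indicator {0<..<1} v * (1 / sqrt v))"
    using set_integrable_inverse_sqrt by (simp add: set_integrable_def)
  have int1: "integrable lborel (\<lambda>v. indicator {0<..<1} v * \<bar>sin (s * (1 - v))\<bar> * (sqrt pi / sqrt v))"
    by (rule Bochner_Integration.integrable_bound[OF integrable_mult_right[OF sq, of "sqrt pi"]])
       (auto simp: indicator_def abs_mult divide_right_mono mult_left_le_one_le intro!: AE_I2)
  have int: "integrable (lborel \<Otimes>\<^sub>M lborel) (case_prod f)"
    by (rule lborel_pair.Fubini_integrable) 
       (use gauss gauss_abs int1 in \<open>auto simp: has_bochner_integral_iff\<close>)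
  note swap = lborel_pair.Fubini_integral[OF int]
  have int2: "set_integrable lborel {0<..<1} (\<lambda>v. sin (s * (1 - v)) / sqrt v)"
    unfolding set_integrable_def real_scaleR_def
    by (rule Bochner_Integration.integrable_bound[OF sq])
       (auto simp: indicator_def divide_right_mono intro!: AE_I2)
  note I = set_lebesgue_integral_eq_HK_open[OF int2]
  show "(\<lambda>v. sin (s * (1 - v)) / sqrt v) integrable_on {0..1}" by (rule I)
  \<comment> \<open>The contribution of the endpoint v = 1. Bounding the denominator below by s^2
    leaves a Gaussian integral, so J is at most sqrt pi / s; the final division by sqrt pi turns
    this into 1 / s.\<close>
  define J where "J = (LBINT x. s * exp (- 1 * x\<^sup>2) / (x ^ 4 + s\<^sup>2))"
  have pos2: "x ^ 4 + s\<^sup>2 > 0" for x :: real using s by (simp add: add_nonneg_pos)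
  have bd: "s * exp (- 1 * x\<^sup>2) / (x ^ 4 + s\<^sup>2) \<le> (1 / s) * exp (- 1 * x\<^sup>2)" for x :: real
  proof -
    have "s * exp (- 1 * x\<^sup>2) / (x ^ 4 + s\<^sup>2) \<le> s * exp (- 1 * x\<^sup>2) / s\<^sup>2"
      using s pos2[of x] by (intro divide_left_mono) auto
    then show ?thesis using s by (simp add: power2_eq_square)
  qed
  have g1: "has_bochner_integral lborel (\<lambda>x. (1 / s) * exp (- 1 * x\<^sup>2)) ((1 / s) * (sqrt pi / sqrt 1))"
    by (intro has_bochner_integral_mult_right has_bochner_integral_gaussian) auto
  have intJ: "integrable lborel (\<lambda>x. s * exp (- 1 * x\<^sup>2) / (x ^ 4 + s\<^sup>2))"
    by (rule Bochner_Integration.integrable_bound[OF integrable.intros[OF g1]]) (use s bd pos2 in \<open>auto simp: abs_mult abs_of_pos intro!: AE_I2\<close>)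
  have J: "0 \<le> J" "J \<le> (1 / s) * (sqrt pi / sqrt 1)"
  proof -
    show "0 \<le> J" unfolding J_def using s pos2 by (intro Bochner_Integration.integral_nonneg) (auto simp: less_imp_le)
    have "J \<le> (LBINT x. (1 / s) * exp (- 1 * x\<^sup>2))"
      unfolding J_def using bd by (intro integral_mono intJ integrable.intros[OF g1])
    also have "\<dots> = (1 / s) * (sqrt pi / sqrt 1)" by (rule has_bochner_integral_integral_eq[OF g1])
    finally show "J \<le> (1 / s) * (sqrt pi / sqrt 1)" .
  qed
  have inner: "(LBINT v. f v x) = s * exp (- 1 * x\<^sup>2) / (x ^ 4 + s\<^sup>2) + sin s * (x\<^sup>2 / (x ^ 4 + s\<^sup>2)) - cos s * (s / (x ^ 4 + s\<^sup>2))" for x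
  proof -
    have "set_integrable lborel {0..1} (\<lambda>v. exp (- v * x\<^sup>2) * sin (s * (1 - v)))"
      by (intro borel_integrable_atLeastAtMost' continuous_intros)
    then have si: "set_integrable lborel {0<..<1} (\<lambda>v. exp (- v * x\<^sup>2) * sin (s * (1 - v)))"
      by (rule set_integrable_subset) auto
    have "(LBINT v. f v x) = (LBINT v:{0<..<1}. exp (- v * x\<^sup>2) * sin (s * (1 - v)))"
      by (simp add: f_def set_lebesgue_integral_def)
    also have "\<dots> = (s * exp (- x\<^sup>2) + x\<^sup>2 * sin s - s * cos s) / ((x\<^sup>2)\<^sup>2 + s\<^sup>2)"
      unfolding set_lebesgue_integral_eq_HK_open(2)[OF si] by (rule integral_unique[OF integral_exp_sin[OF s]])
    finally show ?thesis by (simp add: add_divide_distrib diff_divide_distrib mult_ac flip: power_mult)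
  qed
  note q = has_bochner_integral_quartic_scaled[OF s]
  have "has_bochner_integral lborel (\<lambda>x. LBINT v. f v x) (J + sin s * (pi / sqrt (2 * s)) - cos s * (pi / sqrt (2 * s)))"
    unfolding inner using intJ q
    by (intro has_bochner_integral_add has_bochner_integral_diff has_bochner_integral_mult_right)
       (auto simp: J_def has_bochner_integral_iff)
  then have R: "(LBINT x. LBINT v. f v x) = J + sin s * (pi / sqrt (2 * s)) - cos s * (pi / sqrt (2 * s))"
    by (rule has_bochner_integral_integral_eq)
  define I where "I = integral {0..1} (\<lambda>v. sin (s * (1 - v)) / sqrt v)"
  have "(LBINT v. LBINT x. f v x) = (LBINT v. sqrt pi * (indicator {0<..<1} v *\<^sub>R (sin (s * (1 - v)) / sqrt v)))"
    using gauss[THEN has_bochner_integral_integral_eq] by (simp add: mult_ac)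
  also have "\<dots> = sqrt pi * I"
    using I(2) unfolding I_def set_lebesgue_integral_def integral_mult_right_zero by (rule arg_cong)
  finally have e: "sqrt pi * I = J + pi / sqrt (2 * s) * (sin s - cos s)"
    using swap R by (simp add: algebra_simps add_divide_distrib diff_divide_distrib)
  have "pi / sqrt (2 * s) = sqrt pi * sqrt (pi / (2 * s))"
    using s by (simp add: real_sqrt_divide field_simps)
  with e have "sqrt pi * I = J + sqrt pi * sqrt (pi / (2 * s)) * (sin s - cos s)" by simp
  then have "sqrt pi * (I - sqrt (pi / (2 * s)) * (sin s - cos s)) = J" by (simp add: right_diff_distrib)
  then have "I - sqrt (pi / (2 * s)) * (sin s - cos s) = J / sqrt pi"
    by (metis nonzero_mult_div_cancel_left pi_neq_zero real_sqrt_eq_zero_cancel_iff)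
  moreover have "J / sqrt pi \<le> 1 / s" "0 \<le> J / sqrt pi"
    using J s by (auto simp: field_simps)
  ultimately show "\<bar>integral {0..1} (\<lambda>v. sin (s * (1 - v)) / sqrt v) - sqrt (pi / (2 * s)) * (sin s - cos s)\<bar> \<le> 1 / s"
    unfolding I_def[symmetric] by simp
qed

text \<open>The second mean value theorem moves the amplitude out of the integral. Its vanishing at
  0 removes one of the two terms, and in the other the sine integral is at most 2 / s whatever the
  intermediate point.\<close>

lemma integral_sin_amplitude_bound:
  fixes s :: real and g :: "real \<Rightarrow> real"
  assumes s: "s > 0" and g: "\<And>x y. 0 \<le> x \<Longrightarrow> x \<le> y \<Longrightarrow> y \<le> 1 \<Longrightarrow> g y \<le> g x" and "g 0 = 0"
  shows "(\<lambda>v. g v * sin (s * (1 - v))) integrable_on {0..1}"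
    "\<bar>integral {0..1} (\<lambda>v. g v * sin (s * (1 - v)))\<bar> \<le> 2 * \<bar>g 1\<bar> / s"
proof -
  have i: "((\<lambda>v. sin (s * (1 - v))) has_integral (cos (s * (1 - 1)) / s - cos (s * (1 - c)) / s)) {c..1}" if "c \<le> 1" for c
    using that s by (intro fundamental_theorem_of_calculus[where f = "\<lambda>v. cos (s * (1 - v)) / s"])
       (auto simp: has_real_derivative_iff_has_vector_derivative[symmetric] intro!: derivative_eq_intros)
  have "(\<lambda>v. sin (s * (1 - v))) integrable_on {0..1}" using i[of 0] by (auto simp: integrable_on_def)
  \<comment> \<open>The mean value theorem is stated for nondecreasing amplitudes, hence the
    sign.\<close>
  then obtain c where c: "c \<in> {0..1}" "((\<lambda>v. - g v * sin (s * (1 - v))) has_integral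
      (- g 0 * integral {0..c} (\<lambda>v. sin (s * (1 - v))) + (- g 1) * integral {c..1} (\<lambda>v. sin (s * (1 - v))))) {0..1}"
    by (rule second_mean_value_theorem_full[where g = "\<lambda>v. - g v"]) (use g in auto)
  have "((\<lambda>v. g v * sin (s * (1 - v))) has_integral (g 1 * integral {c..1} (\<lambda>v. sin (s * (1 - v))))) {0..1}"
    using has_integral_neg[OF c(2)] \<open>g 0 = 0\<close> by simp
  then have h: "((\<lambda>v. g v * sin (s * (1 - v))) has_integral (g 1 * ((1 - cos (s * (1 - c))) / s))) {0..1}"
    using c(1) i[of c, THEN integral_unique] by (simp add: diff_divide_distrib)
  then show "(\<lambda>v. g v * sin (s * (1 - v))) integrable_on {0..1}" by blast
  have "\<bar>1 - cos (s * (1 - c))\<bar> \<le> 2" using cos_ge_minus_one[of "s * (1 - c)"] cos_le_one[of "s * (1 - c)"] by linarith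
  then have "\<bar>g 1\<bar> * \<bar>1 - cos (s * (1 - c))\<bar> \<le> \<bar>g 1\<bar> * 2" by (intro mult_left_mono) auto
  then have "\<bar>g 1 * ((1 - cos (s * (1 - c))) / s)\<bar> \<le> 2 * \<bar>g 1\<bar> / s"
    using s by (simp add: abs_mult divide_right_mono mult.commute)
  then show "\<bar>integral {0..1} (\<lambda>v. g v * sin (s * (1 - v)))\<bar> \<le> 2 * \<bar>g 1\<bar> / s"
    using integral_unique[OF h] by simp
qed

text \<open>Integration by parts without boundary terms: the square root vanishes at v = 0 and the
  sine at v = 1. The gain is the factor 1 / s.\<close>

lemma integral_semicircle_cos:
  fixes s :: real assumes s: "s > 0"
  shows "integral {0..1} (\<lambda>v. sqrt (2 * v - v\<^sup>2) * cos (s * (1 - v)))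
       = 1 / s * integral {0..1} (\<lambda>v. (1 - v) / sqrt (2 * v - v\<^sup>2) * sin (s * (1 - v)))"
proof -
  define F where "F = (\<lambda>v. 1 / s * (sqrt (2 * v - v\<^sup>2) * sin (s * (1 - v))))"
  have "((\<lambda>v. 1 / s * ((1 - v) / sqrt (2 * v - v\<^sup>2) * sin (s * (1 - v))) - sqrt (2 * v - v\<^sup>2) * cos (s * (1 - v))) has_integral (F 1 - F 0)) {0..1}"
  proof (rule fundamental_theorem_of_calculus_interior)
    show "continuous_on {0..1} F" unfolding F_def by (intro continuous_intros)
    fix v :: real assume v: "v \<in> {0<..<1}"
    have "2 * v - v\<^sup>2 = v * (2 - v)" by (simp add: algebra_simps power2_eq_square)
    then have p: "2 * v - v\<^sup>2 > 0" using v by simp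
    have d1: "((\<lambda>v. sqrt (2 * v - v\<^sup>2)) has_real_derivative (1 - v) / sqrt (2 * v - v\<^sup>2)) (at v)"
      using p by (auto intro!: derivative_eq_intros simp: field_simps)
    have d2: "((\<lambda>v. sin (s * (1 - v))) has_real_derivative - s * cos (s * (1 - v))) (at v)"
      by (auto intro!: derivative_eq_intros)
    have "(F has_real_derivative 1 / s * ((1 - v) / sqrt (2 * v - v\<^sup>2) * sin (s * (1 - v)) + (- s * cos (s * (1 - v))) * sqrt (2 * v - v\<^sup>2))) (at v)"
      unfolding F_def by (intro DERIV_cmult DERIV_mult d1 d2)
    also have "1 / s * ((1 - v) / sqrt (2 * v - v\<^sup>2) * sin (s * (1 - v)) + (- s * cos (s * (1 - v))) * sqrt (2 * v - v\<^sup>2))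
      = 1 / s * ((1 - v) / sqrt (2 * v - v\<^sup>2) * sin (s * (1 - v))) - sqrt (2 * v - v\<^sup>2) * cos (s * (1 - v))"
      using s by (simp add: right_diff_distrib distrib_left)
    finally show "(F has_vector_derivative 1 / s * ((1 - v) / sqrt (2 * v - v\<^sup>2) * sin (s * (1 - v))) - sqrt (2 * v - v\<^sup>2) * cos (s * (1 - v))) (at v)"
      by (simp add: has_real_derivative_iff_has_vector_derivative)
  qed simp
  moreover have "F 1 - F 0 = 0" by (simp add: F_def)
  ultimately have 1: "((\<lambda>v. 1 / s * ((1 - v) / sqrt (2 * v - v\<^sup>2) * sin (s * (1 - v))) - sqrt (2 * v - v\<^sup>2) * cos (s * (1 - v))) has_integral 0) {0..1}" by simp
  have "(\<lambda>v. sqrt (2 * v - v\<^sup>2) * cos (s * (1 - v))) integrable_on {0..1}"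
    by (intro integrable_continuous_interval continuous_intros)
  from has_integral_add[OF 1 integrable_integral[OF this]]
  have "((\<lambda>v. 1 / s * ((1 - v) / sqrt (2 * v - v\<^sup>2) * sin (s * (1 - v)))) has_integral
    integral {0..1} (\<lambda>v. sqrt (2 * v - v\<^sup>2) * cos (s * (1 - v)))) {0..1}" by simp
  from integral_unique[OF this] show ?thesis
    unfolding Henstock_Kurzweil_Integration.integral_mult_right by (rule sym)
qed

lemma integral_reflect_unit:
  fixes f :: "real \<Rightarrow> real"
  assumes "f integrable_on {0..1}"
  shows "integral {0..1} (\<lambda>v. f (1 - v)) = integral {0..1} f"
proof -
  have e: "(\<lambda>x::real. - x + 1) ` {0..1} = {0..1}"
    by (auto simp: image_iff intro!: bexI[of _ "1 - _"])
  have "((\<lambda>v. f (1 - v)) has_integral integral {0..1} f) {0..1}"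
    using has_integral_affinity[of f "integral {0..1} f" 0 1 "-1" 1] assms e by (simp add: has_integral_integral)
  then show ?thesis by (rule integral_unique)
qed

text \<open>The integrand is even, and u = 1 - v then puts the end of the semicircle at v = 0, where
  its square-root behaviour determines the leading asymptotics.\<close>

lemma nbessel_eq_half_range:
  "nbessel s = 4 / pi * integral {0..1} (\<lambda>v. sqrt (2 * v - v\<^sup>2) * cos (s * (1 - v)))"
proof -
  define f where "f = (\<lambda>u. sqrt (1 - u\<^sup>2) * cos (s * u))"
  have i: "f integrable_on {x..y}" for x y
    unfolding f_def by (intro integrable_continuous_interval continuous_intros)
  have "integral {-1..1} f = integral {-1..0} f + integral {0..1} f"
    by (rule Henstock_Kurzweil_Integration.integral_combine[symmetric]) (use i in auto)
  moreover have "integral {-1..0} f = integral {0..1} f"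
    using Henstock_Kurzweil_Integration.integral_reflect_real[of 1 0 f] by (simp add: f_def)
  moreover have "integral {0..1} (\<lambda>v. f (1 - v)) = integral {0..1} f" by (rule integral_reflect_unit[OF i])
  moreover have "f (1 - v) = sqrt (2 * v - v\<^sup>2) * cos (s * (1 - v))" for v
    by (simp add: f_def power2_eq_square algebra_simps)
  ultimately show ?thesis unfolding nbessel_def f_def[symmetric] by simp
qed

section \<open>Size and asymptotics of the normalised Bessel function\<close>

lemma integral_semicircle: "((\<lambda>u. sqrt (1 - u\<^sup>2)) has_integral (pi / 2)) {-1..1}"
proof -
  define F where "F = (\<lambda>u. (u * sqrt (1 - u\<^sup>2) + arcsin u) / 2)"
  have "((\<lambda>u. sqrt (1 - u\<^sup>2)) has_integral (F 1 - F (-1))) {-1..1}"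
  proof (rule fundamental_theorem_of_calculus_interior)
    show "continuous_on {-1..1} F" unfolding F_def by (intro continuous_intros) auto
    fix u :: real assume u: "u \<in> {-1<..<1}"
    have p: "1 - u\<^sup>2 > 0" using u abs_square_less_1[of u] by auto
    have d1: "((\<lambda>u. sqrt (1 - u\<^sup>2)) has_real_derivative - u / sqrt (1 - u\<^sup>2)) (at u)"
      using p by (auto intro!: derivative_eq_intros simp: field_simps)
    have "(F has_real_derivative (1 * sqrt (1 - u\<^sup>2) + (- u / sqrt (1 - u\<^sup>2)) * u + inverse (sqrt (1 - u\<^sup>2))) / 2) (at u)"
      unfolding F_def by (intro DERIV_cdivide DERIV_add DERIV_mult d1 DERIV_ident DERIV_arcsin) (use u in auto)
    also have "(1 * sqrt (1 - u\<^sup>2) + (- u / sqrt (1 - u\<^sup>2)) * u + inverse (sqrt (1 - u\<^sup>2))) / 2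
       = (sqrt (1 - u\<^sup>2) + (1 - u\<^sup>2) / sqrt (1 - u\<^sup>2)) / 2"
    proof -
      have "(1 * r + (- u / r) * u + inverse r) / 2 = (r + (1 - u\<^sup>2) / r) / 2" for r :: real
        by (simp add: diff_divide_distrib inverse_eq_divide power2_eq_square)
      then show ?thesis .
    qed
    also have "\<dots> = sqrt (1 - u\<^sup>2)" using p by (simp add: real_div_sqrt)
    finally show "(F has_vector_derivative sqrt (1 - u\<^sup>2)) (at u)"
      by (simp add: has_real_derivative_iff_has_vector_derivative)
  qed simp
  also have "F 1 - F (-1) = pi / 2" by (simp add: F_def arcsin_minus)
  finally show ?thesis .
qed

lemma nbessel_0 [simp]: "nbessel 0 = 1"
  using integral_unique[OF integral_semicircle] by (simp add: nbessel_def)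

lemma abs_nbessel_le_1: "\<bar>nbessel s\<bar> \<le> 1"
proof -
  have "\<bar>integral {-1..1} (\<lambda>u. sqrt (1 - u\<^sup>2) * cos (s * u))\<bar> \<le> integral {-1..1} (\<lambda>u. sqrt (1 - u\<^sup>2))"
    unfolding real_norm_def[symmetric]
  proof (rule integral_norm_bound_integral)
    show "norm (sqrt (1 - x\<^sup>2) * cos (s * x)) \<le> sqrt (1 - x\<^sup>2)" if "x \<in> {-1..1}" for x
      using that abs_square_le_1[of x] by (auto simp: abs_mult mult_left_le)
  qed (intro integrable_continuous_interval continuous_intros)+
  then show ?thesis using integral_unique[OF integral_semicircle] by (simp add: nbessel_def abs_mult field_simps)
qed

text \<open>As (2 / pi) sqrt (1 - u^2) is a probability density on [-1, 1], the number 1 -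
  \<open>nbessel s\<close> is the mean of 1 - cos (s u), which is at most (s u)^2 / 2. The opposite
  sign is excluded by \<open>abs_nbessel_le_1\<close>.\<close>

lemma nbessel_near_0: "\<bar>nbessel s - 1\<bar> \<le> s\<^sup>2 / 2"
proof -
  have i1: "((\<lambda>u. sqrt (1 - u\<^sup>2) * cos (s * u)) has_integral (pi / 2 * nbessel s)) {-1..1}"
    unfolding nbessel_def by (simp, intro integrable_integral integrable_continuous_interval continuous_intros)
  have i2: "((\<lambda>u. sqrt (1 - u\<^sup>2) * (s\<^sup>2 / 2)) has_integral (pi / 2 * (s\<^sup>2 / 2))) {-1..1}"
    by (rule has_integral_mult_left[OF integral_semicircle])
  have b: "sqrt (1 - x\<^sup>2) - sqrt (1 - x\<^sup>2) * cos (s * x) \<le> sqrt (1 - x\<^sup>2) * (s\<^sup>2 / 2)" if "x \<in> {-1..1}" for x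
  proof -
    have x: "x\<^sup>2 \<le> 1" using that abs_square_le_1[of x] by auto
    have "1 - cos (s * x) = 2 * (sin (s * x / 2))\<^sup>2" using cos_double_sin[of "s * x / 2"] by simp
    also have "\<dots> \<le> 2 * (s * x / 2)\<^sup>2"
      using abs_sin_x_le_abs_x[of "s * x / 2"] by (auto simp only: abs_le_square_iff intro!: mult_left_mono)
    also have "\<dots> = (s\<^sup>2 / 2) * x\<^sup>2" by (simp add: power2_eq_square)
    also have "\<dots> \<le> s\<^sup>2 / 2" using x by (simp add: mult_left_le)
    finally have "sqrt (1 - x\<^sup>2) * (1 - cos (s * x)) \<le> sqrt (1 - x\<^sup>2) * (s\<^sup>2 / 2)"
      using x by (intro mult_left_mono) auto
    then show ?thesis by (simp add: algebra_simps)
  qed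
  have "pi / 2 - pi / 2 * nbessel s \<le> pi / 2 * (s\<^sup>2 / 2)"
    by (rule has_integral_le[OF has_integral_diff[OF integral_semicircle i1] i2]) (use b in auto)
  then have "pi / 2 * (1 - nbessel s) \<le> pi / 2 * (s\<^sup>2 / 2)" by (simp add: algebra_simps)
  then have "1 - nbessel s \<le> s\<^sup>2 / 2" by (rule mult_left_le_imp_le) simp
  with abs_nbessel_le_1[of s] show ?thesis by linarith
qed

text \<open>After an integration by parts and the substitution \<open>u = 1 - v\<close> the amplitude differs from \<open>(2 v)\<^bsup>-1/2\<^esup>\<close> by a
  monotone function, which the second mean value theorem handles; the Fresnel-type integral that remains is
  evaluated by writing \<open>v\<^bsup>-1/2\<^esup>\<close> as a Gaussian integral.\<close>
lemma nbessel_asymptotic: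
  fixes s :: real assumes s: "s > 0"
  shows "\<bar>nbessel s - 2 * sqrt (2 / pi) * s powr (-3/2) * cos (s - 3 * pi / 4)\<bar> \<le> 4 / s\<^sup>2"
proof -
  define h where "h = (\<lambda>v::real. (1 - v) / sqrt (2 * v - v\<^sup>2) - 1 / sqrt (2 * v))"
  have pq: "2 * v - v\<^sup>2 > 0" if "0 < v" "v \<le> 1" for v :: real
  proof -
    have "2 * v - v\<^sup>2 = v * (2 - v)" by (simp add: algebra_simps power2_eq_square)
    with that show ?thesis by simp
  qed
  \<comment> \<open>Division by zero makes \<open>h 0\<close> equal to 0, which is also the limit of
    h at 0 from the right; monotonicity up to that endpoint is the separate case x = 0.\<close>
  have mono: "h y \<le> h x" if "0 \<le> x" "x \<le> y" "y \<le> 1" for x y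
  proof (cases "x = 0")
    case True
    show ?thesis
    proof (cases "y = 0")
      case False
      then have y: "0 < y" "y \<le> 1" using that True by auto
      have e: "sqrt (2 * y - y\<^sup>2) = sqrt y * sqrt (2 - y)"
        unfolding real_sqrt_mult[symmetric] by (simp add: algebra_simps power2_eq_square)
      have "1 - y \<le> sqrt (1 - y / 2)"
      proof (rule real_le_rsqrt)
        have "(1 - y)\<^sup>2 = 1 - y / 2 - y * (3 / 2 - y)" by (simp add: power2_eq_square algebra_simps)
        then show "(1 - y)\<^sup>2 \<le> 1 - y / 2" using y by simp
      qed
      also have "sqrt (1 - y / 2) = sqrt (2 - y) / sqrt 2" by (simp add: real_sqrt_divide[symmetric] diff_divide_distrib)
      finally have "(1 - y) / (sqrt y * sqrt (2 - y)) \<le> (sqrt (2 - y) / sqrt 2) / (sqrt y * sqrt (2 - y))"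
        using y by (intro divide_right_mono) auto
      also have "\<dots> = 1 / sqrt (2 * y)" using y by (simp add: real_sqrt_mult)
      finally have "h y \<le> 0" unfolding h_def e by simp
      then show ?thesis using True by (simp add: h_def)
    qed (use True in simp)
  next
    case False
    show ?thesis
    proof (rule DERIV_nonpos_imp_nonincreasing[OF that(2)])
      fix v assume v: "x \<le> v" "v \<le> y"
      then have v': "0 < v" "v \<le> 1" using False that by auto
      define r where "r = sqrt (2 * v - v\<^sup>2)"
      define q where "q = sqrt (2 * v)"
      have r: "r > 0" "r\<^sup>2 = 2 * v - v\<^sup>2" using pq[OF v'] by (auto simp: r_def)
      have q: "q > 0" "q\<^sup>2 = 2 * v" using v' by (auto simp: q_def)
      have rq: "r \<le> q" unfolding r_def q_def by simp
      have d0: "((\<lambda>v::real. 1 - v) has_real_derivative 0 - 1) (at v)"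
        by (intro DERIV_diff DERIV_const DERIV_ident)
      have d1: "((\<lambda>v. sqrt (2 * v - v\<^sup>2)) has_real_derivative (1 - v) / r) (at v)"
        using pq[OF v'] unfolding r_def by (auto intro!: derivative_eq_intros simp: field_simps)
      have d2: "((\<lambda>v. sqrt (2 * v)) has_real_derivative 1 / q) (at v)"
        using v' unfolding q_def by (auto intro!: derivative_eq_intros simp: field_simps)
      have "(h has_real_derivative ((0 - 1) * sqrt (2 * v - v\<^sup>2) - (1 - v) * ((1 - v) / r)) / (sqrt (2 * v - v\<^sup>2) * sqrt (2 * v - v\<^sup>2))
          - (0 * sqrt (2 * v) - 1 * (1 / q)) / (sqrt (2 * v) * sqrt (2 * v))) (at v)"
        unfolding h_def using r(1) q(1) unfolding r_def q_def
        by (intro DERIV_diff[OF DERIV_divide DERIV_divide] DERIV_const d0 d1[unfolded r_def] d2[unfolded q_def]) auto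
      also have "((0 - 1) * sqrt (2 * v - v\<^sup>2) - (1 - v) * ((1 - v) / r)) / (sqrt (2 * v - v\<^sup>2) * sqrt (2 * v - v\<^sup>2))
          - (0 * sqrt (2 * v) - 1 * (1 / q)) / (sqrt (2 * v) * sqrt (2 * v)) = 1 / q ^ 3 - (r\<^sup>2 + (1 - v)\<^sup>2) / r ^ 3"
        unfolding r_def[symmetric] q_def[symmetric]
      proof -
        have "((0 - 1) * r - (1 - v) * ((1 - v) / r)) / (r * r) = - (r\<^sup>2 + (1 - v)\<^sup>2) / r ^ 3"
          using r(1) by (simp add: field_simps power2_eq_square power3_eq_cube)
        moreover have "(0 * q - 1 * (1 / q)) / (q * q) = - (1 / q ^ 3)"
          using q(1) by (simp add: power3_eq_cube)
        ultimately show "((0 - 1) * r - (1 - v) * ((1 - v) / r)) / (r * r) - (0 * q - 1 * (1 / q)) / (q * q)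
          = 1 / q ^ 3 - (r\<^sup>2 + (1 - v)\<^sup>2) / r ^ 3"
          by (simp only: minus_divide_left)
      qed
      \<comment> \<open>The numerator collapses to 1, so the sign of the derivative is decided by r
        <= q alone.\<close>
      also have "r\<^sup>2 + (1 - v)\<^sup>2 = 1" unfolding r by (simp add: power2_eq_square algebra_simps)
      finally have "(h has_real_derivative 1 / q ^ 3 - 1 / r ^ 3) (at v)" .
      moreover have "1 / q ^ 3 \<le> 1 / r ^ 3" using r(1) rq by (intro divide_left_mono power_mono) auto
      ultimately show "\<exists>d. DERIV h v :> d \<and> d \<le> 0" by (intro exI conjI) auto
    qed
  qed
  have h0: "h 0 = 0" and h1: "h 1 = - 1 / sqrt 2" by (simp_all add: h_def)
  note A = integral_sin_amplitude_bound[where g = h, OF s mono h0]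
  note B = integral_sin_over_sqrt[OF s]
  define Y where "Y = integral {0..1} (\<lambda>v. (1 - v) / sqrt (2 * v - v\<^sup>2) * sin (s * (1 - v)))"
  define I where "I = integral {0..1} (\<lambda>v. sin (s * (1 - v)) / sqrt v)"
  define K where "K = integral {0..1} (\<lambda>v. h v * sin (s * (1 - v)))"
  have "((\<lambda>v. h v * sin (s * (1 - v)) + 1 / sqrt 2 * (sin (s * (1 - v)) / sqrt v)) has_integral (K + 1 / sqrt 2 * I)) {0..1}"
    unfolding K_def I_def using A(1) B(1) by (intro has_integral_add has_integral_mult_right integrable_integral)
  moreover have "h v * sin (s * (1 - v)) + 1 / sqrt 2 * (sin (s * (1 - v)) / sqrt v) = (1 - v) / sqrt (2 * v - v\<^sup>2) * sin (s * (1 - v))" for v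
    by (simp add: h_def real_sqrt_mult algebra_simps)
  ultimately have Y: "Y = K + 1 / sqrt 2 * I" unfolding Y_def by (simp add: integral_unique)
  have ns: "nbessel s = 4 / pi * (1 / s) * Y"
    unfolding nbessel_eq_half_range Y_def integral_semicircle_cos[OF s] by simp
  define M where "M = sqrt (pi / (2 * s)) * (sin s - cos s)"
  \<comment> \<open>The phase 3 pi / 4 comes from sin s - cos s = sqrt 2 cos (s - 3 pi / 4).\<close>
  have main: "4 / pi * (1 / s) * (1 / sqrt 2 * M) = 2 * sqrt (2 / pi) * s powr (-3/2) * cos (s - 3 * pi / 4)"
  proof -
    have p: "s powr (-3/2) = 1 / (s * sqrt s)"
      using s powr_add[of s 1 "1/2"] by (simp add: powr_minus_divide powr_half_sqrt)
    have "3 * pi / 4 = pi - pi / 4" by simp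
    then have "cos (3 * pi / 4) = - (sqrt 2 / 2)" "sin (3 * pi / 4) = sqrt 2 / 2"
      by (simp_all only: cos_pi_minus sin_pi_minus cos_45 sin_45)
    then have c: "cos (s - 3 * pi / 4) = sqrt 2 / 2 * (sin s - cos s)" by (simp add: cos_diff algebra_simps)
    have "4 / (q * q) * (1 / s) * (1 / sqrt 2 * (q / (sqrt 2 * sqrt s) * X)) = 2 * (sqrt 2 / q) * (1 / (s * sqrt s)) * (sqrt 2 / 2 * X)"
      if "q > 0" for q X :: real using that s by (simp add: field_simps)
    from this[of "sqrt pi" "sin s - cos s"] show ?thesis unfolding p c M_def
      by (simp add: real_sqrt_divide real_sqrt_mult)
  qed
  have "x * (K + y * I) - x * (y * M) = x * (K + y * (I - M))" for x y by (simp add: algebra_simps)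
  then have "nbessel s - 2 * sqrt (2 / pi) * s powr (-3/2) * cos (s - 3 * pi / 4) = 4 / pi * (1 / s) * (K + 1 / sqrt 2 * (I - M))"
    unfolding ns Y main[symmetric] .
  moreover have "\<bar>K + 1 / sqrt 2 * (I - M)\<bar> \<le> 3 / s"
  proof -
    have "\<bar>K\<bar> \<le> 2 * \<bar>h 1\<bar> / s" using A(2) by (simp add: K_def)
    also have "\<dots> \<le> 2 * 1 / s" using s unfolding h1 by (intro divide_right_mono mult_left_mono) auto
    finally have 1: "\<bar>K\<bar> \<le> 2 / s" by simp
    have "\<bar>1 / sqrt 2 * (I - M)\<bar> = 1 / sqrt 2 * \<bar>I - M\<bar>" by (simp add: abs_mult)
    also have "\<dots> \<le> 1 * \<bar>I - M\<bar>" by (intro mult_right_mono) auto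
    also have "\<dots> \<le> 1 / s" using B(2) by (simp add: I_def M_def)
    finally have 2: "\<bar>1 / sqrt 2 * (I - M)\<bar> \<le> 1 / s" .
    have "3 / s = 2 / s + 1 / s" by simp
    then show ?thesis using 1 2 by linarith
  qed
  \<comment> \<open>The bound pi > 3 cancels the 3 of the previous estimate and leaves the constant
    4.\<close>
  then have "4 / pi * (1 / s) * \<bar>K + 1 / sqrt 2 * (I - M)\<bar> \<le> 4 / 3 * (1 / s) * (3 / s)"
    using s pi_gt3 by (intro mult_mono divide_left_mono) auto
  moreover have "\<bar>4 / pi * (1 / s) * x\<bar> = 4 / pi * (1 / s) * \<bar>x\<bar>" for x using s by (simp add: abs_mult)
  moreover have "4 / 3 * (1 / s) * (3 / s) = 4 / s\<^sup>2" by (simp add: power2_eq_square)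
  ultimately show ?thesis by metis
qed

text \<open>The constant 6 is 2 + 4: for s >= 1 the leading term is at most 2 s^(-3/2) and the
  remainder at most 4 s^(-3/2), while for s < 1 the trivial bound 1 is enough. The free \<theta>
  lets later estimates spend only part of the decay, since each power of \<nu> gained from
  \<open>nbessel (\<nu> * \<delta>)\<close> costs the same power of 1 / \<delta>.\<close>

lemma nbessel_decay:
  fixes s \<theta> :: real assumes s: "s > 0" and t: "0 \<le> \<theta>" "\<theta> \<le> 3/2"
  shows "\<bar>nbessel s\<bar> \<le> 6 * s powr (- \<theta>)"
proof (cases "s \<ge> 1")
  case True
  have "2 / pi \<le> 1" using pi_gt3 by simp
  then have k: "2 * sqrt (2 / pi) \<le> 2" by simp
  have "\<bar>2 * sqrt (2 / pi) * s powr (-3/2) * cos (s - 3 * pi / 4)\<bar> \<le> 2 * s powr (-3/2) * 1"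
    unfolding abs_mult using k by (intro mult_mono) auto
  moreover have "4 / s\<^sup>2 \<le> 4 * s powr (-3/2)"
  proof -
    have "s powr (-2) \<le> s powr (-3/2)" using True by (intro powr_mono) auto
    then show ?thesis using s by (simp add: powr_minus_divide powr_numeral)
  qed
  moreover have "s powr (-3/2) \<le> s powr (- \<theta>)" using True t by (intro powr_mono) auto
  ultimately show ?thesis using nbessel_asymptotic[OF s] by linarith
next
  case False
  then have "s powr 0 \<le> s powr (- \<theta>)" using s t by (intro powr_mono') auto
  then show ?thesis using abs_nbessel_le_1[of s] s by simp
qed

section \<open>Fourier transform of an ellipse\<close>

lemma integrable_indicator_mult_bounded:
  fixes g :: "'a::euclidean_space \<Rightarrow> real"
  assumes A: "A \<in> sets borel" "bounded A" and g: "g \<in> borel_measurable borel" and B: "\<And>x. \<bar>g x\<bar> \<le> B"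
  shows "integrable lborel (\<lambda>x. indicator A x * g x)"
proof (rule Bochner_Integration.integrable_bound)
  have "emeasure lborel A < \<infinity>" using A by (intro emeasure_bounded_finite)
  then have "integrable lborel (\<lambda>x. indicator A x :: real)" using A by (simp add: integrable_indicator_iff)
  then show "integrable lborel (\<lambda>x. B * indicator A x)" by (rule integrable_mult_right)
  show "(\<lambda>x. indicator A x * g x) \<in> borel_measurable lborel" using A g by measurable
  show "AE x in lborel. norm (indicator A x * g x) \<le> norm (B * indicator A x)"
    using B by (intro AE_I2) (auto simp: indicator_def intro: order_trans[OF B])
qed

text \<open>The length of a chord: completing the square gives |2 \<alpha> x + \<beta>| <= sqrt
  \<Delta>. The truncation by \<open>max 0\<close> accounts for lines that miss the ellipse.\<close>

lemma measure_quadratic_le: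
  fixes \<alpha> \<beta> \<gamma> :: real assumes \<alpha>: "\<alpha> > 0"
  shows "measure lborel {x. \<alpha> * x\<^sup>2 + \<beta> * x + \<gamma> \<le> 0} = sqrt (max 0 (\<beta>\<^sup>2 - 4 * \<alpha> * \<gamma>)) / \<alpha>"
proof -
  define \<Delta> where "\<Delta> = \<beta>\<^sup>2 - 4 * \<alpha> * \<gamma>"
  have "4 * \<alpha> * (\<alpha> * x\<^sup>2 + \<beta> * x + \<gamma>) = (2 * \<alpha> * x + \<beta>)\<^sup>2 - \<Delta>" for x
    by (simp add: \<Delta>_def power2_eq_square algebra_simps)
  then have iff: "\<alpha> * x\<^sup>2 + \<beta> * x + \<gamma> \<le> 0 \<longleftrightarrow> (2 * \<alpha> * x + \<beta>)\<^sup>2 \<le> \<Delta>" for x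
    using \<alpha> by (metis diff_le_0_iff_le mult_le_0_iff not_le zero_less_mult_iff zero_less_numeral order.strict_iff_not)
  show ?thesis
  proof (cases "\<Delta> \<ge> 0")
    case True
    have "{x. \<alpha> * x\<^sup>2 + \<beta> * x + \<gamma> \<le> 0} = {(- \<beta> - sqrt \<Delta>) / (2 * \<alpha>)..(- \<beta> + sqrt \<Delta>) / (2 * \<alpha>)}"
    proof (intro set_eqI)
      fix x
      have "\<alpha> * x\<^sup>2 + \<beta> * x + \<gamma> \<le> 0 \<longleftrightarrow> \<bar>2 * \<alpha> * x + \<beta>\<bar> \<le> sqrt \<Delta>"
        unfolding iff using True by (metis real_sqrt_abs real_sqrt_le_iff)
      then show "x \<in> {x. \<alpha> * x\<^sup>2 + \<beta> * x + \<gamma> \<le> 0} \<longleftrightarrow> x \<in> {(- \<beta> - sqrt \<Delta>) / (2 * \<alpha>)..(- \<beta> + sqrt \<Delta>) / (2 * \<alpha>)}"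
        using \<alpha> by (auto simp: field_simps abs_le_iff)
    qed
    moreover have "(- \<beta> - sqrt \<Delta>) / (2 * \<alpha>) \<le> (- \<beta> + sqrt \<Delta>) / (2 * \<alpha>)"
      using \<alpha> True by (intro divide_right_mono) auto
    moreover have "(- \<beta> + sqrt \<Delta>) / (2 * \<alpha>) - (- \<beta> - sqrt \<Delta>) / (2 * \<alpha>) = sqrt \<Delta> / \<alpha>"
      by (simp add: diff_divide_distrib[symmetric])
    ultimately show ?thesis using True by (simp add: \<Delta>_def[symmetric])
  next
    case False
    then have "{x. \<alpha> * x\<^sup>2 + \<beta> * x + \<gamma> \<le> 0} = {}" unfolding iff by (auto simp: not_le intro: less_le_trans)
    with False show ?thesis by (simp add: \<Delta>_def[symmetric])
  qed
qed

text \<open>Serves the linear functionals that depend on the first coordinate only, to which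
  \<open>integral_E_linear_functional\<close> does not apply directly.\<close>

lemma lborel_integral_prod_swap:
  fixes f :: "real \<times> real \<Rightarrow> real"
  assumes f: "integrable lborel f"
  shows "(LBINT z. f z) = (LBINT z. f (snd z, fst z))"
proof -
  have f': "integrable (lborel \<Otimes>\<^sub>M lborel) f" using f by (simp add: lborel_prod)
  have g': "integrable (lborel \<Otimes>\<^sub>M lborel) (\<lambda>z. f (snd z, fst z))"
    using lborel_pair.integrable_product_swap[OF f'] by (simp add: case_prod_beta')
  have "(LBINT z. f z) = (LBINT y. LBINT x. f (x, y))"
    using lborel_pair.integral_snd[of "\<lambda>x y. f (x, y)"] f' by (simp add: lborel_prod)
  also have "\<dots> = (LBINT z. f (snd z, fst z))"
    using lborel_pair.integral_fst'[OF g'] by (simp add: lborel_prod)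
  finally show ?thesis .
qed

section \<open>Positive definite binary forms and their ellipses\<close>

locale pos_form =
  fixes a b c :: real
  assumes a_pos: "a > 0" and disc_pos: "4 * a * c - b\<^sup>2 > 0"
begin

definition D :: real where "D = 4 * a * c - b\<^sup>2"

definition Q :: "real \<times> real \<Rightarrow> real" where
  "Q z = a * (fst z)\<^sup>2 + b * fst z * snd z + c * (snd z)\<^sup>2"

definition Qadj :: "real \<times> real \<Rightarrow> real" where
  "Qadj z = c * (fst z)\<^sup>2 - b * fst z * snd z + a * (snd z)\<^sup>2"

definition E :: "real \<Rightarrow> (real \<times> real) set" where
  "E R = {z. Q z \<le> R\<^sup>2}"

lemma D_pos: "D > 0" using disc_pos by (simp add: D_def)

lemma c_pos: "c > 0"
proof -
  have "4 * a * c > 0" using disc_pos zero_le_power2[of b] by linarith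
  then show ?thesis using a_pos by (simp add: zero_less_mult_iff)
qed

lemma Q_square: "4 * a * Q z = (2 * a * fst z + b * snd z)\<^sup>2 + D * (snd z)\<^sup>2"
  "4 * c * Q z = (2 * c * snd z + b * fst z)\<^sup>2 + D * (fst z)\<^sup>2"
  by (simp_all add: Q_def D_def power2_eq_square algebra_simps)

lemma Q_nonneg: "Q z \<ge> 0"
proof -
  have "4 * a * Q z \<ge> 0" unfolding Q_square using D_pos by simp
  then show ?thesis using a_pos by (simp add: zero_le_mult_iff)
qed

lemma coordinate_bounds: "D * (fst z)\<^sup>2 \<le> 4 * c * Q z" "D * (snd z)\<^sup>2 \<le> 4 * a * Q z"
  unfolding Q_square by simp_all

lemma Q_eq_0_iff: "Q z = 0 \<longleftrightarrow> z = 0"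
proof
  assume "Q z = 0"
  then have "fst z = 0" "snd z = 0" using coordinate_bounds[of z] D_pos by (auto simp: mult_le_0_iff)
  then show "z = 0" by (simp add: prod_eq_iff)
qed (simp add: Q_def)

text \<open>Makes every result of the locale available for the adjugate form. This is the route from
  counting lattice points in an ellipse to counting dual frequencies, which are scaled square roots
  of values of \<open>Qadj\<close>.\<close>

lemma adj: "pos_form c (- b) a"
  using a_pos c_pos disc_pos by unfold_locales (auto simp: mult_ac)

lemma Qadj_conv: "Qadj = pos_form.Q c (- b) a"
  by (rule ext) (simp add: Qadj_def pos_form.Q_def[OF adj])

lemma Qadj_pos: "z \<noteq> 0 \<Longrightarrow> Qadj z > 0"
  using pos_form.Q_nonneg[OF adj] pos_form.Q_eq_0_iff[OF adj] unfolding Qadj_conv by (metis less_le)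

lemma Q_measurable [measurable]: "Q \<in> borel_measurable borel"
  unfolding Q_def[abs_def] borel_prod[symmetric] by measurable

lemma E_borel [measurable]: "E R \<in> sets borel"
  unfolding E_def by measurable

lemma bounded_E: "bounded (E R)"
proof -
  define L where "L = sqrt ((4 * c + 4 * a) * R\<^sup>2 / D)"
  have "z \<in> cbox (-L, -L) (L, L)" if "z \<in> E R" for z
  proof -
    have q: "Q z \<le> R\<^sup>2" using that by (simp add: E_def)
    have "D * (fst z)\<^sup>2 \<le> 4 * c * R\<^sup>2" using coordinate_bounds(1)[of z] mult_left_mono[OF q, of "4 * c"] c_pos by linarith
    moreover have "D * (snd z)\<^sup>2 \<le> 4 * a * R\<^sup>2" using coordinate_bounds(2)[of z] mult_left_mono[OF q, of "4 * a"] a_pos by linarith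
    moreover have "4 * c * R\<^sup>2 \<ge> 0" "4 * a * R\<^sup>2 \<ge> 0" using a_pos c_pos by auto
    ultimately have "D * (fst z)\<^sup>2 \<le> (4 * c + 4 * a) * R\<^sup>2" "D * (snd z)\<^sup>2 \<le> (4 * c + 4 * a) * R\<^sup>2"
      by (simp_all add: distrib_right)
    then have "(fst z)\<^sup>2 \<le> (4 * c + 4 * a) * R\<^sup>2 / D" "(snd z)\<^sup>2 \<le> (4 * c + 4 * a) * R\<^sup>2 / D"
      using D_pos by (simp_all add: field_simps)
    then have "\<bar>fst z\<bar> \<le> L" "\<bar>snd z\<bar> \<le> L"
      unfolding L_def by (metis real_sqrt_abs real_sqrt_le_iff)+
    then show ?thesis by (cases z) (auto simp: abs_le_iff)
  qed
  then show ?thesis by (meson bounded_cbox bounded_subset subsetI)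
qed

text \<open>Integrate first along the lines on which the linear functional is constant: they meet the ellipse in
  chords whose length is given by the discriminant of a quadratic polynomial.\<close>
lemma integral_E_linear_functional:
  fixes k :: "real \<Rightarrow> real"
  assumes p2: "p2 \<noteq> 0" and R: "R > 0" and k: "continuous_on UNIV k" "\<And>x. \<bar>k x\<bar> \<le> 1"
  shows "(LBINT z. indicator (E R) z * k (p1 * fst z + p2 * snd z))
     = 4 * R\<^sup>2 / sqrt D * (LBINT u. k (2 * R * sqrt (Qadj (p1, p2)) / sqrt D * u) * sqrt (max 0 (1 - u\<^sup>2)))"
proof -
  define q where "q = Qadj (p1, p2)"
  have q: "q > 0" using Qadj_pos[of "(p1, p2)"] p2 by (simp add: q_def zero_prod_def)
  have [measurable]: "k \<in> borel_measurable borel" using k(1) by (rule borel_measurable_continuous_onI)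
  define f where "f = (\<lambda>z. indicator (E R) z * k (p1 * fst z + p2 * snd z))"
  have fm: "(\<lambda>z::real \<times> real. k (p1 * fst z + p2 * snd z)) \<in> borel_measurable borel"
    unfolding borel_prod[symmetric] by measurable
  have intf: "integrable lborel f"
    unfolding f_def by (rule integrable_indicator_mult_bounded[OF E_borel bounded_E fm]) (rule k(2))
  \<comment> \<open>Inverse of the shear (x, y) to (x, p1 x + p2 y): in the new coordinates the
    functional is just the second coordinate w.\<close>
  define T :: "real \<times> real \<Rightarrow> real \<times> real" where "T = (\<lambda>z. (fst z, (snd z - p1 * fst z) / p2))"
  define G where "G = {z. T z \<in> E R}"
  have Tm: "T \<in> borel_measurable borel" unfolding T_def borel_prod[symmetric] by measurable
  have G_borel: "G \<in> sets borel" using measurable_sets[OF Tm E_borel, of R] by (simp add: G_def vimage_def)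
  have "bounded G"
  proof -
    have "G \<subseteq> (\<lambda>z. (fst z, p1 * fst z + p2 * snd z)) ` E R"
    proof
      fix z assume "z \<in> G"
      then have "T z \<in> E R" by (simp add: G_def)
      moreover have "z = (fst (T z), p1 * fst (T z) + p2 * snd (T z))" using p2 by (simp add: T_def)
      ultimately show "z \<in> (\<lambda>z. (fst z, p1 * fst z + p2 * snd z)) ` E R" by (rule rev_image_eqI)
    qed
    moreover have "bounded_linear (\<lambda>z::real\<times>real. (fst z, p1 * fst z + p2 * snd z))"
      by (intro bounded_linear_Pair bounded_linear_add bounded_linear_fst bounded_linear_snd bounded_linear_const_mult)
    ultimately show ?thesis by (meson bounded_E bounded_linear_image bounded_subset)
  qed
  define g where "g = (\<lambda>z::real\<times>real. indicator G z * k (snd z))"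
  have gm: "(\<lambda>z::real \<times> real. k (snd z)) \<in> borel_measurable borel"
    unfolding borel_prod[symmetric] by measurable
  have "integrable (lborel \<Otimes>\<^sub>M lborel) g"
    unfolding g_def lborel_prod by (rule integrable_indicator_mult_bounded[OF G_borel \<open>bounded G\<close> gm]) (rule k(2))
  then have intg: "integrable (lborel \<Otimes>\<^sub>M lborel) (\<lambda>(x, w). g (x, w))" by simp
  have "(LBINT z. f z) = (LBINT x. LBINT y. f (x, y))"
    using lborel_pair.integral_fst'[of f] intf by (simp add: lborel_prod)
  also have "\<dots> = (LBINT x. \<bar>1 / p2\<bar> * (LBINT w. g (x, w)))"
  proof (intro Bochner_Integration.integral_cong refl)
    fix x
    have "(LBINT y. f (x, y)) = \<bar>1 / p2\<bar> *\<^sub>R (LBINT w. f (x, - p1 * x / p2 + 1 / p2 * w))"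
      by (rule lborel_integral_real_affine) (use p2 in simp)
    also have "(\<lambda>w. f (x, - p1 * x / p2 + 1 / p2 * w)) = (\<lambda>w. g (x, w))"
      using p2 by (auto simp: f_def g_def G_def T_def indicator_def field_simps)
    finally show "(LBINT y. f (x, y)) = \<bar>1 / p2\<bar> * (LBINT w. g (x, w))" by simp
  qed
  also have "\<dots> = \<bar>1 / p2\<bar> * (LBINT x. LBINT w. g (x, w))" by simp
  also have "(LBINT x. LBINT w. g (x, w)) = (LBINT w. LBINT x. g (x, w))"
    by (rule lborel_pair.Fubini_integral[OF intg, symmetric])
  also have "(\<lambda>w. LBINT x. g (x, w)) = (\<lambda>w. k w * (\<bar>p2\<bar> * sqrt (max 0 (4 * q * R\<^sup>2 - D * w\<^sup>2)) / q))"
  proof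
    fix w
    define \<beta> where "\<beta> = (b * p2 - 2 * c * p1) * w / p2\<^sup>2"
    define \<gamma> where "\<gamma> = c * w\<^sup>2 / p2\<^sup>2 - R\<^sup>2"
    \<comment> \<open>For fixed w the ellipse condition is quadratic in x, with leading coefficient
      q / p2^2 and discriminant (4 q R^2 - D w^2) / p2^2.\<close>
    have QT: "Q (T (x, w)) - R\<^sup>2 = q / p2\<^sup>2 * x\<^sup>2 + \<beta> * x + \<gamma>" for x
      using p2 by (simp add: Q_def T_def q_def Qadj_def \<beta>_def \<gamma>_def field_simps power2_eq_square)
    have "Q (T (x, w)) \<le> R\<^sup>2 \<longleftrightarrow> q / p2\<^sup>2 * x\<^sup>2 + \<beta> * x + \<gamma> \<le> 0" for x
      unfolding QT[symmetric] by simp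
    then have "(\<lambda>x. g (x, w)) = (\<lambda>x. k w * indicator {x. q / p2\<^sup>2 * x\<^sup>2 + \<beta> * x + \<gamma> \<le> 0} x)"
      by (auto simp: g_def G_def E_def indicator_def)
    then have "(LBINT x. g (x, w)) = k w * measure lborel {x. q / p2\<^sup>2 * x\<^sup>2 + \<beta> * x + \<gamma> \<le> 0}" by simp
    also have "measure lborel {x. q / p2\<^sup>2 * x\<^sup>2 + \<beta> * x + \<gamma> \<le> 0} = sqrt (max 0 (\<beta>\<^sup>2 - 4 * (q / p2\<^sup>2) * \<gamma>)) / (q / p2\<^sup>2)"
      using q p2 by (intro measure_quadratic_le) auto
    also have "\<beta>\<^sup>2 - 4 * (q / p2\<^sup>2) * \<gamma> = (4 * q * R\<^sup>2 - D * w\<^sup>2) / p2\<^sup>2"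
      using p2 by (simp add: q_def Qadj_def \<beta>_def \<gamma>_def D_def field_simps power2_eq_square)
    also have "max 0 ((4 * q * R\<^sup>2 - D * w\<^sup>2) / p2\<^sup>2) = max 0 (4 * q * R\<^sup>2 - D * w\<^sup>2) / p2\<^sup>2"
      by (simp add: max_def divide_le_0_iff zero_le_divide_iff)
    also have "sqrt (max 0 (4 * q * R\<^sup>2 - D * w\<^sup>2) / p2\<^sup>2) / (q / p2\<^sup>2) = \<bar>p2\<bar> * sqrt (max 0 (4 * q * R\<^sup>2 - D * w\<^sup>2)) / q"
      using p2 q by (simp add: real_sqrt_divide field_simps power2_eq_square)
    finally show "(LBINT x. g (x, w)) = k w * (\<bar>p2\<bar> * sqrt (max 0 (4 * q * R\<^sup>2 - D * w\<^sup>2)) / q)" .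
  qed
  also have "\<bar>1 / p2\<bar> * (LBINT w. k w * (\<bar>p2\<bar> * sqrt (max 0 (4 * q * R\<^sup>2 - D * w\<^sup>2)) / q)) =
     (LBINT w. k w * sqrt (max 0 (4 * q * R\<^sup>2 - D * w\<^sup>2)) / q)"
    using p2 by (simp flip: integral_mult_right_zero)
  also have "\<dots> = (LBINT u. (4 * R\<^sup>2 / sqrt D) * (k (2 * R * sqrt q / sqrt D * u) * sqrt (max 0 (1 - u\<^sup>2))))"
  proof -
    \<comment> \<open>h is the maximum of the functional on \<open>E R\<close>; rescaling by it
      turns the chord lengths into multiples of the semicircle sqrt (1 - u^2).\<close>
    define h where "h = 2 * R * sqrt q / sqrt D"
    have h: "h > 0" using q R D_pos by (simp add: h_def)
    have h2: "D * h\<^sup>2 = 4 * q * R\<^sup>2" using q D_pos by (simp add: h_def power_divide power_mult_distrib)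
    have "(LBINT w. k w * sqrt (max 0 (4 * q * R\<^sup>2 - D * w\<^sup>2)) / q)
      = \<bar>h\<bar> *\<^sub>R (LBINT u. k (0 + h * u) * sqrt (max 0 (4 * q * R\<^sup>2 - D * (0 + h * u)\<^sup>2)) / q)"
      by (rule lborel_integral_real_affine) (use h in simp)
    also have "\<dots> = (LBINT u. (4 * R\<^sup>2 / sqrt D) * (k (h * u) * sqrt (max 0 (1 - u\<^sup>2))))"
      unfolding real_scaleR_def integral_mult_right_zero[symmetric]
    proof (intro Bochner_Integration.integral_cong refl)
      fix u
      have "4 * q * R\<^sup>2 - D * (0 + h * u)\<^sup>2 = 4 * q * R\<^sup>2 * (1 - u\<^sup>2)"
        using h2 by (simp add: power_mult_distrib algebra_simps)
      then have "max 0 (4 * q * R\<^sup>2 - D * (0 + h * u)\<^sup>2) = 4 * q * R\<^sup>2 * max 0 (1 - u\<^sup>2)"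
        using q R by (simp add: max_def mult_le_0_iff zero_le_mult_iff)
      then have s: "sqrt (max 0 (4 * q * R\<^sup>2 - D * (0 + h * u)\<^sup>2)) = 2 * sqrt q * R * sqrt (max 0 (1 - u\<^sup>2))"
        using q R by (simp add: real_sqrt_mult)
      have "\<bar>h\<bar> * (k (0 + h * u) * sqrt (max 0 (4 * q * R\<^sup>2 - D * (0 + h * u)\<^sup>2)) / q)
        = (h * (2 * sqrt q * R) / q) * (k (h * u) * sqrt (max 0 (1 - u\<^sup>2)))"
        unfolding s using h by simp
      also have "h * (2 * sqrt q * R) / q = 4 * R\<^sup>2 / sqrt D"
      proof -
        have "h * (2 * sqrt q * R) / q = 4 * R\<^sup>2 / sqrt D * ((sqrt q * sqrt q) / q)"
          by (simp add: h_def power2_eq_square)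
        then show ?thesis using q by simp
      qed
      finally show "\<bar>h\<bar> * (k (0 + h * u) * sqrt (max 0 (4 * q * R\<^sup>2 - D * (0 + h * u)\<^sup>2)) / q)
        = (4 * R\<^sup>2 / sqrt D) * (k (h * u) * sqrt (max 0 (1 - u\<^sup>2)))" .
    qed
    finally show ?thesis unfolding h_def .
  qed
  finally show ?thesis by (simp add: f_def q_def)
qed

end

lemma lborel_integral_semicircle_cos:
  "(LBINT u. cos (s * u) * sqrt (max 0 (1 - u\<^sup>2))) = pi / 2 * nbessel s"
proof -
  have si: "set_integrable lborel {-1..1} (\<lambda>u. sqrt (1 - u\<^sup>2) * cos (s * u))"
    by (intro borel_integrable_atLeastAtMost' continuous_intros)
  have "cos (s * u) * sqrt (max 0 (1 - u\<^sup>2)) = indicator {-1..1} u *\<^sub>R (sqrt (1 - u\<^sup>2) * cos (s * u))" for u :: real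
  proof (cases "u \<in> {-1..1}")
    case True
    then have "u\<^sup>2 \<le> 1" using abs_square_le_1[of u] by auto
    with True show ?thesis by (simp add: max_def)
  next
    case False
    then have "u\<^sup>2 > 1" using abs_square_le_1[of u] by auto
    with False show ?thesis by (simp add: max_def)
  qed
  then have "(LBINT u. cos (s * u) * sqrt (max 0 (1 - u\<^sup>2))) = (LBINT u:{-1..1}. sqrt (1 - u\<^sup>2) * cos (s * u))"
    by (simp only: set_lebesgue_integral_def)
  also have "\<dots> = integral {-1..1} (\<lambda>u. sqrt (1 - u\<^sup>2) * cos (s * u))"
    by (rule set_borel_integral_eq_integral(2)[OF si])
  finally show ?thesis by (simp add: nbessel_def)
qed

section \<open>Area and Fourier transform of the ellipse\<close>

context pos_form begin

definition A :: real where "A = 2 * pi / sqrt D"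

lemma A_pos: "A > 0" using D_pos by (simp add: A_def)

lemma measure_E: assumes R: "R > 0" shows "measure lborel (E R) = A * R\<^sup>2"
proof -
  have "measure lborel (E R) = (LBINT z. indicator (E R) z * (\<lambda>_. 1) (0 * fst z + 1 * snd z :: real))" by simp
  also have "\<dots> = 4 * R\<^sup>2 / sqrt D * (LBINT u. sqrt (max 0 (1 - u\<^sup>2)))"
    by (subst integral_E_linear_functional) (use R in auto)
  also have "(LBINT u. sqrt (max 0 (1 - u\<^sup>2))) = pi / 2"
    using lborel_integral_semicircle_cos[of 0] by simp
  finally show ?thesis by (simp add: A_def)
qed

text \<open>This is 2 pi times the support function of the unit ellipse, that is, the largest value
  of the phase 2 pi (p1 x + p2 y) on \<open>E 1\<close>.\<close>

definition freq :: "real \<times> real \<Rightarrow> real" where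
  "freq p = 4 * pi * (sqrt (Qadj p) / sqrt D)"

lemma fourier_E_aux: 
  assumes R: "R > 0" and "p2 \<noteq> 0"
  shows "(LBINT z. indicator (E R) z * cos (2 * pi * (p1 * fst z + p2 * snd z))) = A * R\<^sup>2 * nbessel (freq (p1, p2) * R)"
proof -
  have "(LBINT z. indicator (E R) z * cos (2 * pi * (p1 * fst z + p2 * snd z)))
    = 4 * R\<^sup>2 / sqrt D * (LBINT u. cos (2 * pi * (2 * R * sqrt (Qadj (p1, p2)) / sqrt D * u)) * sqrt (max 0 (1 - u\<^sup>2)))"
    by (rule integral_E_linear_functional[where k = "\<lambda>x. cos (2 * pi * x)"]) (use assms in \<open>auto intro!: continuous_intros\<close>)
  also have "(\<lambda>u. cos (2 * pi * (2 * R * sqrt (Qadj (p1, p2)) / sqrt D * u)) * sqrt (max 0 (1 - u\<^sup>2)))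
     = (\<lambda>u. cos ((freq (p1, p2) * R) * u) * sqrt (max 0 (1 - u\<^sup>2)))"
    by (simp add: freq_def mult_ac)
  finally show ?thesis unfolding lborel_integral_semicircle_cos by (simp add: A_def)
qed

lemma fourier_E:
  assumes R: "R > 0"
  shows "(LBINT z. indicator (E R) z * cos (2 * pi * (p1 * fst z + p2 * snd z))) = A * R\<^sup>2 * nbessel (freq (p1, p2) * R)"
proof -
  consider "p2 \<noteq> 0" | "p2 = 0" "p1 \<noteq> 0" | "p1 = 0" "p2 = 0" by blast
  then show ?thesis
  proof cases
    case 1 then show ?thesis by (rule fourier_E_aux[OF R])
  next
    case 2
    \<comment> \<open>Exchanging the coordinates turns p2 = 0, p1 \<noteq> 0 into the case already
      settled; area and frequency are unchanged by the exchange.\<close>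
    interpret sw: pos_form c b a using c_pos disc_pos by unfold_locales (auto simp: mult_ac)
    have m: "(\<lambda>z::real\<times>real. cos (2 * pi * (p1 * fst z + p2 * snd z))) \<in> borel_measurable borel"
      unfolding borel_prod[symmetric] by measurable
    have "integrable lborel (\<lambda>z. indicator (E R) z * cos (2 * pi * (p1 * fst z + p2 * snd z)))"
      by (rule integrable_indicator_mult_bounded[OF E_borel bounded_E m]) (rule abs_cos_le_one)
    from lborel_integral_prod_swap[OF this]
    have "(LBINT z. indicator (E R) z * cos (2 * pi * (p1 * fst z + p2 * snd z)))
      = (LBINT z. indicator (E R) (snd z, fst z) * cos (2 * pi * (p2 * fst z + p1 * snd z)))" by (simp add: add.commute)
    also have "(\<lambda>z. indicator (E R) (snd z, fst z)) = (indicator (sw.E R) :: real \<times> real \<Rightarrow> real)"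
      by (rule ext) (simp add: indicator_def E_def sw.E_def Q_def sw.Q_def algebra_simps)
    also have "(LBINT z. indicator (sw.E R) z * cos (2 * pi * (p2 * fst z + p1 * snd z))) = sw.A * R\<^sup>2 * nbessel (sw.freq (p2, p1) * R)"
      by (rule sw.fourier_E_aux[OF R]) (use 2 in simp)
    also have "sw.A = A" by (simp add: A_def sw.A_def D_def sw.D_def mult_ac)
    also have "sw.freq (p2, p1) = freq (p1, p2)"
      by (simp add: freq_def sw.freq_def D_def sw.D_def Qadj_def sw.Qadj_def algebra_simps)
    finally show ?thesis .
  next
    case 3
    then show ?thesis using measure_E[OF R] by (simp add: freq_def Qadj_def)
  qed
qed

end

section \<open>The Fejer kernel and a smoothed Poisson formula\<close>

text \<open>Normalised to period 1 and written with cosines, so that all Fourier analysis stays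
  real. For N > 0 the outermost coefficients, at |k| = N, vanish.\<close>

definition fejer :: "nat \<Rightarrow> real \<Rightarrow> real" where
  "fejer N x = (\<Sum>k\<in>{-int N..int N}. (1 - \<bar>of_int k\<bar> / real N) * cos (2 * pi * (of_int k * x)))"

lemma sum_symmetric_Suc:
  "(\<Sum>k\<in>{-int (Suc N)..int (Suc N)}. f k) = f (- int (Suc N)) + f (int (Suc N)) + (\<Sum>k\<in>{-int N..int N}. f k :: real)"
proof -
  have "{-int (Suc N)..int (Suc N)} = insert (- int (Suc N)) (insert (int (Suc N)) {-int N..int N})" by auto
  then show ?thesis by simp
qed

text \<open>Multiplication by sin (x / 2) makes the sum telescope; keeping that factor on the left
  avoids exceptional points where it vanishes.\<close>

lemma dirichlet_kernel_mult_sin: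
  "sin (x / 2) * (\<Sum>k\<in>{-int N..int N}. cos (of_int k * x)) = sin ((real N + 1 / 2) * x)"
proof (induction N)
  case (Suc N)
  have "sin ((real N + 1 + 1 / 2) * x) - sin ((real N + 1 / 2) * x) = 2 * sin (x / 2) * cos ((real N + 1) * x)"
  proof -
    have e: "(real N + 1 + 1 / 2) * x = (real N + 1) * x + x / 2" "(real N + 1 / 2) * x = (real N + 1) * x - x / 2"
      by (simp_all add: field_simps)
    show ?thesis unfolding e sin_add sin_diff by simp
  qed
  moreover have "cos (of_int (- int (Suc N)) * x) = cos ((real N + 1) * x)" "cos (of_int (int (Suc N)) * x) = cos ((real N + 1) * x)"
    using cos_minus[of "(real N + 1) * x"] by (simp_all add: algebra_simps)
  ultimately show ?case
    unfolding sum_symmetric_Suc distrib_left Suc.IH by (simp add: algebra_simps)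
qed simp

text \<open>Passing from N to N + 1 adds one Dirichlet kernel, and the squared sines obey sin(P)^2 +
  sin(S) sin(2 P + S) = sin(P + S)^2.\<close>

lemma fejer_sum_mult_sin_sq:
  "(sin (x / 2))\<^sup>2 * (\<Sum>k\<in>{-int N..int N}. (real N - \<bar>of_int k\<bar>) * cos (of_int k * x)) = (sin (real N * x / 2))\<^sup>2"
proof (induction N)
  case (Suc N)
  have "(\<Sum>k\<in>{-int (Suc N)..int (Suc N)}. (real (Suc N) - \<bar>of_int k\<bar>) * cos (of_int k * x))
    = (\<Sum>k\<in>{-int N..int N}. (real (Suc N) - \<bar>of_int k\<bar>) * cos (of_int k * x))"
    unfolding sum_symmetric_Suc by simp
  also have "\<dots> = (\<Sum>k\<in>{-int N..int N}. (real N - \<bar>of_int k\<bar>) * cos (of_int k * x)) + (\<Sum>k\<in>{-int N..int N}. cos (of_int k * x))"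
    by (simp add: sum.distrib[symmetric] algebra_simps)
  finally have "(sin (x / 2))\<^sup>2 * (\<Sum>k\<in>{-int (Suc N)..int (Suc N)}. (real (Suc N) - \<bar>of_int k\<bar>) * cos (of_int k * x))
    = (sin (real N * x / 2))\<^sup>2 + sin (x / 2) * (sin (x / 2) * (\<Sum>k\<in>{-int N..int N}. cos (of_int k * x)))"
    using Suc.IH by (simp add: distrib_left power2_eq_square mult.assoc)
  also have "\<dots> = (sin (real N * x / 2))\<^sup>2 + sin (x / 2) * sin ((real N + 1 / 2) * x)"
    unfolding dirichlet_kernel_mult_sin ..
  also have "\<dots> = (sin (real (Suc N) * x / 2))\<^sup>2"
  proof -
    define P where "P = real N * x / 2"
    define S where "S = x / 2"
    have e: "(real N + 1 / 2) * x = P + (P + S)" "real (Suc N) * x / 2 = P + S"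
      by (simp_all add: P_def S_def field_simps)
    have "(sin P)\<^sup>2 + sin S * sin (P + (P + S)) = (sin (P + S))\<^sup>2"
    proof -
      have "sin S * sin (P + (P + S)) = sin S * (sin P * cos (P + S) + cos P * sin (P + S))"
        by (simp only: sin_add[of P "P + S"])
      also have "\<dots> = (sin S * cos P) * sin (P + S) + sin P * sin S * cos (P + S)" by (simp add: algebra_simps)
      also have "sin S * cos P = sin (P + S) - sin P * cos S" by (simp add: sin_add)
      also have "(sin (P + S) - sin P * cos S) * sin (P + S) + sin P * sin S * cos (P + S) = (sin (P + S))\<^sup>2 - sin P * (sin (P + S) * cos S - cos (P + S) * sin S)"
        by (simp add: algebra_simps power2_eq_square)
      also have "sin (P + S) * cos S - cos (P + S) * sin S = sin P" using sin_diff[of "P + S" S] by simp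
      finally show ?thesis by (simp add: power2_eq_square)
    qed
    then show ?thesis unfolding e P_def[symmetric] S_def[symmetric] .
  qed
  finally show ?case .
qed simp

lemma fejer_mult_sin_sq:
  assumes "N > 0"
  shows "real N * (sin (pi * x))\<^sup>2 * fejer N x = (sin (pi * real N * x))\<^sup>2"
proof -
  have A: "real N * fejer N x = (\<Sum>k\<in>{-int N..int N}. (real N - \<bar>of_int k\<bar>) * cos (of_int k * (2 * pi * x)))"
    using assms unfolding fejer_def sum_distrib_left by (intro sum.cong) (auto simp: field_simps)
  have m: "real N * (sin (pi * x))\<^sup>2 * fejer N x = (sin (2 * pi * x / 2))\<^sup>2 * (real N * fejer N x)" by simp
  have h: "pi * real N * x = real N * (2 * pi * x) / 2" by simp
  show ?thesis unfolding m h A by (rule fejer_sum_mult_sin_sq)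
qed

text \<open>Away from the integers the kernel is a quotient of squares; at an integer every cosine
  is 1 and the coefficients are nonnegative.\<close>

lemma fejer_nonneg: "fejer N x \<ge> 0"
proof (cases "N = 0")
  case False
  show ?thesis
  proof (cases "sin (pi * x) = 0")
    case True
    then obtain i where "pi * x = of_int i * pi" by (auto simp: sin_zero_iff_int2)
    then have x: "x = of_int i" by simp
    have "cos (2 * pi * (of_int k * x)) = 1" for k
      using cos_int_2pin[of "k * i"] by (simp add: x mult_ac)
    moreover have "0 \<le> 1 - \<bar>of_int k\<bar> / real N" if "k \<in> {-int N..int N}" for k
    proof -
      have "\<bar>k\<bar> \<le> int N" using that by auto
      then have "\<bar>real_of_int k\<bar> \<le> real N" by (metis of_int_abs of_int_le_iff of_int_of_nat_eq)
      then show ?thesis using False by simp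
    qed
    ultimately show ?thesis unfolding fejer_def by (intro sum_nonneg) auto
  next
    case s: False
    have "(real N * (sin (pi * x))\<^sup>2) * fejer N x \<ge> 0" using fejer_mult_sin_sq[of N x] False by simp
    moreover have "real N * (sin (pi * x))\<^sup>2 > 0" using s False by simp
    ultimately show ?thesis by (simp add: zero_le_mult_iff)
  qed
qed (simp add: fejer_def)

lemma fejer_add_int: "fejer N (x + of_int m) = fejer N x"
proof -
  have "cos (2 * pi * (of_int k * (x + of_int m))) = cos (2 * pi * (of_int k * x))" for k
  proof -
    have e: "2 * pi * (of_int k * (x + of_int m)) = 2 * pi * (of_int k * x) + 2 * pi * of_int (k * m)"
      by (simp add: algebra_simps)
    show ?thesis unfolding e cos_add using cos_int_2pin[of "k * m"] sin_int_2pin[of "k * m"] by simp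
  qed
  then show ?thesis by (simp add: fejer_def)
qed

lemma continuous_on_fejer [continuous_intros]: "continuous_on S (fejer N)"
  unfolding fejer_def[abs_def] by (intro continuous_intros)

lemma fejer_measurable [measurable]: "fejer N \<in> borel_measurable borel"
  by (intro borel_measurable_continuous_onI continuous_intros)

lemma abs_fejer_le: "\<exists>B. \<forall>x. \<bar>fejer N x\<bar> \<le> B"
proof (intro exI allI)
  fix x
  show "\<bar>fejer N x\<bar> \<le> (\<Sum>k\<in>{-int N..int N}. \<bar>1 - \<bar>of_int k\<bar> / real N\<bar>)"
    unfolding fejer_def by (rule order_trans[OF sum_abs]) (auto intro!: sum_mono simp: abs_mult mult_left_le)
qed

lemma has_integral_fejer:
  assumes "N > 0" shows "(fejer N has_integral 1) {-1/2..1/2}"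
proof -
  have "((\<lambda>x. (1 - \<bar>of_int k\<bar> / real N) * cos (2 * pi * (of_int k * x))) has_integral (if k = 0 then 1 else 0)) {-1/2..1/2}" for k :: int
  proof (cases "k = 0")
    case True
    have "((\<lambda>x::real. 1::real) has_integral (1/2 - (-1/2))) {-1/2..1/2}"
      using has_integral_const_real[of "1::real" "-1/2" "1/2"] by simp
    then show ?thesis using True by simp
  next
    case False
    have "((\<lambda>x. cos (2 * pi * (of_int k * x))) has_integral
      (sin (2 * pi * (of_int k * (1/2))) / (2 * pi * of_int k) - sin (2 * pi * (of_int k * (-1/2))) / (2 * pi * of_int k))) {-1/2..1/2}"
      using False
      by (intro fundamental_theorem_of_calculus[where f = "\<lambda>x. sin (2 * pi * (of_int k * x)) / (2 * pi * of_int k)"])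
         (auto simp: has_real_derivative_iff_has_vector_derivative[symmetric] intro!: derivative_eq_intros)
    moreover have "sin (2 * pi * (of_int k * (1/2))) = 0" "sin (2 * pi * (of_int k * (-1/2))) = 0"
      using sin_npi_int[of k] by (simp_all add: mult.commute)
    ultimately have "((\<lambda>x. cos (2 * pi * (of_int k * x))) has_integral 0) {-1/2..1/2}" by simp
    from has_integral_mult_right[OF this, of "1 - \<bar>of_int k\<bar> / real N"] False show ?thesis by simp
  qed
  then have "(fejer N has_integral (\<Sum>k\<in>{-int N..int N}. if k = 0 then 1 else 0)) {-1/2..1/2}"
    unfolding fejer_def[abs_def] by (intro has_integral_sum) auto
  then show ?thesis by simp
qed

lemma integrable_indicator_fejer:
  assumes "S \<in> sets borel" "bounded S"
  shows "integrable lborel (\<lambda>x. indicator S x * fejer N x)"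
  using abs_fejer_le[of N] integrable_indicator_mult_bounded[OF assms fejer_measurable] by blast

lemma integral_fejer_cell: 
  assumes "N > 0"
  shows "(LBINT x. indicator {of_int m - 1/2..<of_int m + 1/2} x * fejer N x) = 1"
proof -
  have "(LBINT x. indicator {of_int m - 1/2..<of_int m + 1/2} x * fejer N x) =
    \<bar>1\<bar> *\<^sub>R (LBINT x. indicator {of_int m - 1/2..<of_int m + 1/2} (of_int m + 1 * x) * fejer N (of_int m + 1 * x))"
    by (rule lborel_integral_real_affine) simp
  also have "\<dots> = (LBINT x:{-1/2..<1/2}. fejer N x)"
    unfolding set_lebesgue_integral_def using fejer_add_int[of N _ m]
    by (auto intro!: Bochner_Integration.integral_cong simp: indicator_def add.commute)
  also have "\<dots> = (LBINT x:{-1/2..1/2}. fejer N x)"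
    unfolding set_lebesgue_integral_def
    by (intro integral_cong_AE) (auto intro!: AE_I[of _ _ "{1/2}"] simp: indicator_def)
  also have "\<dots> = integral {-1/2..1/2} (fejer N)"
    by (intro set_borel_integral_eq_integral borel_integrable_atLeastAtMost' continuous_intros)
  also have "\<dots> = 1" using has_integral_fejer[OF assms] by (rule integral_unique)
  finally show ?thesis .
qed

lemma integral_fejer_centre_shift:
  "(LBINT x. indicator {of_int m - \<tau>..of_int m + \<tau>} x * fejer N x) = (LBINT x. indicator {-\<tau>..\<tau>} x * fejer N x)"
proof -
  have "(LBINT x. indicator {of_int m - \<tau>..of_int m + \<tau>} x * fejer N x) =
    \<bar>1\<bar> *\<^sub>R (LBINT x. indicator {of_int m - \<tau>..of_int m + \<tau>} (of_int m + 1 * x) * fejer N (of_int m + 1 * x))"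
    by (rule lborel_integral_real_affine) simp
  also have "\<dots> = (LBINT x. indicator {-\<tau>..\<tau>} x * fejer N x)"
    using fejer_add_int[of N _ m]
    by (auto intro!: Bochner_Integration.integral_cong simp: indicator_def add.commute)
  finally show ?thesis .
qed

text \<open>On the rest of the period the closed form bounds the kernel by 1 / (N sin (pi
  \<tau>)^2), so the mass missing from the central interval is O(1 / N).\<close>

lemma integral_fejer_centre_tendsto:
  assumes \<tau>: "0 < \<tau>" "\<tau> < 1/2"
  shows "(\<lambda>N. LBINT x. indicator {-\<tau>..\<tau>} x * fejer N x) \<longlonglongrightarrow> 1"
proof (rule tendsto_sandwich)
  define C where "C = 1 / (sin (pi * \<tau>))\<^sup>2"
  have sp: "sin (pi * \<tau>) > 0" using \<tau> by (intro sin_gt_zero) (auto simp: mult_less_cancel_left1)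
  have up: "(LBINT x. indicator {-\<tau>..\<tau>} x * fejer N x) \<le> 1" if "N > 0" for N
  proof -
    have "(LBINT x. indicator {-\<tau>..\<tau>} x * fejer N x) \<le> (LBINT x. indicator {of_int 0 - 1/2..<of_int 0 + 1/2} x * fejer N x)"
      using \<tau> fejer_nonneg by (intro integral_mono integrable_indicator_fejer) (auto simp: indicator_def)
    then show ?thesis using integral_fejer_cell[OF that, of 0] by simp
  qed
  have lo: "1 - C / real N \<le> (LBINT x. indicator {-\<tau>..\<tau>} x * fejer N x)" if "N > 0" for N
  proof -
    have bd: "indicator {of_int 0 - 1/2..<of_int 0 + 1/2} x * fejer N x \<le> indicator {-\<tau>..\<tau>} x * fejer N x + C / real N * indicator {-1/2..1/2} x" for x
    proof (cases "x \<in> {-1/2..<1/2} \<and> x \<notin> {-\<tau>..\<tau>}")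
      case True
      then have x: "\<tau> \<le> \<bar>x\<bar>" "\<bar>x\<bar> \<le> 1/2" by auto
      have "0 \<le> pi * \<tau>" using \<tau> by simp
      then have "- (pi / 2) \<le> pi * \<tau>" using pi_ge_zero by linarith
      then have "sin (pi * \<tau>) \<le> sin (pi * \<bar>x\<bar>)"
        using x \<tau> by (intro sin_monotone_2pi_le) auto
      also have "\<dots> \<le> \<bar>sin (pi * x)\<bar>" by (cases "x \<ge> 0") auto
      finally have sle: "sin (pi * \<tau>) \<le> \<bar>sin (pi * x)\<bar>" .
      then have "(sin (pi * \<tau>))\<^sup>2 \<le> (sin (pi * x))\<^sup>2" using sp by (metis abs_le_square_iff abs_of_pos)
      then have "real N * (sin (pi * \<tau>))\<^sup>2 * fejer N x \<le> real N * (sin (pi * x))\<^sup>2 * fejer N x"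
        by (intro mult_right_mono mult_left_mono fejer_nonneg) auto
      also have "\<dots> \<le> 1" unfolding fejer_mult_sin_sq[OF that] by (simp add: abs_square_le_1)
      finally have "fejer N x \<le> C / real N" using sp that by (simp add: C_def field_simps)
      then show ?thesis using True by (auto simp: indicator_def)
    next
      case False
      have "0 \<le> C / real N * indicator {-1/2..1/2} x" by (simp add: C_def)
      then show ?thesis using False fejer_nonneg[of N x] by (auto simp: indicator_def split: if_splits)
    qed
    have i: "integrable lborel (\<lambda>x. C / real N * indicator {-1/2..1/2::real} x)"
      by (intro integrable_mult_right) (simp add: integrable_indicator_iff)
    have "1 = (LBINT x. indicator {of_int 0 - 1/2..<of_int 0 + 1/2} x * fejer N x)"
      using integral_fejer_cell[OF that, of 0] by simp
    also have "\<dots> \<le> (LBINT x. indicator {-\<tau>..\<tau>} x * fejer N x + C / real N * indicator {-1/2..1/2} x)"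
      by (intro integral_mono bd Bochner_Integration.integrable_add i integrable_indicator_fejer) auto
    also have "\<dots> = (LBINT x. indicator {-\<tau>..\<tau>} x * fejer N x) + C / real N"
      by (subst Bochner_Integration.integral_add) (auto intro!: integrable_indicator_fejer i)
    finally show ?thesis by simp
  qed
  show "\<forall>\<^sub>F N in sequentially. 1 - C / real N \<le> (LBINT x. indicator {-\<tau>..\<tau>} x * fejer N x)"
    using lo by (rule eventually_mono[OF eventually_gt_at_top[of 0]])
  show "\<forall>\<^sub>F N in sequentially. (LBINT x. indicator {-\<tau>..\<tau>} x * fejer N x) \<le> 1"
    using up by (rule eventually_mono[OF eventually_gt_at_top[of 0]])
  show "(\<lambda>N. 1 - C / real N) \<longlonglongrightarrow> 1" by real_asymp
qed simp

section \<open>The planar Fejer kernel and the integer cells\<close>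

definition emb :: "int \<times> int \<Rightarrow> real \<times> real" where
  "emb n = (of_int (fst n), of_int (snd n))"

definition fejer2 :: "nat \<Rightarrow> real \<times> real \<Rightarrow> real" where
  "fejer2 N z = fejer N (fst z) * fejer N (snd z)"

definition fejer_box :: "nat \<Rightarrow> (int \<times> int) set" where
  "fejer_box N = {-int N..int N} \<times> {-int N..int N}"

definition fejer_weight :: "nat \<Rightarrow> int \<times> int \<Rightarrow> real" where
  "fejer_weight N n = (1 - \<bar>of_int (fst n)\<bar> / real N) * (1 - \<bar>of_int (snd n)\<bar> / real N)"

text \<open>Expanding the cosine of a sum gives the product of the one-dimensional kernels minus a
  product of sine sums, and each sine sum vanishes by oddness.\<close>

lemma fejer2_expansion:
  "fejer2 N z = (\<Sum>n\<in>fejer_box N. fejer_weight N n * cos (2 * pi * (of_int (fst n) * fst z + of_int (snd n) * snd z)))"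
proof -
  define w where "w = (\<lambda>k::int. 1 - \<bar>of_int k\<bar> / real N)"
  have odd: "(\<Sum>k\<in>{-int N..int N}. w k * sin (2 * pi * (of_int k * x))) = 0" for x
  proof -
    have "(\<Sum>k\<in>{-int N..int N}. w k * sin (2 * pi * (of_int k * x))) = (\<Sum>k\<in>{-int N..int N}. w (-k) * sin (2 * pi * (of_int (-k) * x)))"
      by (rule sum.reindex_bij_witness[of _ uminus uminus]) auto
    also have "\<dots> = - (\<Sum>k\<in>{-int N..int N}. w k * sin (2 * pi * (of_int k * x)))"
      by (simp add: w_def sum_negf)
    finally show ?thesis by simp
  qed
  have "(\<Sum>n\<in>fejer_box N. fejer_weight N n * cos (2 * pi * (of_int (fst n) * fst z + of_int (snd n) * snd z)))
    = (\<Sum>k\<in>{-int N..int N}. \<Sum>l\<in>{-int N..int N}. (w k * cos (2 * pi * (of_int k * fst z))) * (w l * cos (2 * pi * (of_int l * snd z)))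
       - (w k * sin (2 * pi * (of_int k * fst z))) * (w l * sin (2 * pi * (of_int l * snd z))))"
    unfolding fejer_box_def sum.cartesian_product
    by (intro sum.cong) (auto simp: fejer_weight_def w_def distrib_left cos_add algebra_simps)
  also have "\<dots> = (\<Sum>k\<in>{-int N..int N}. w k * cos (2 * pi * (of_int k * fst z))) * (\<Sum>l\<in>{-int N..int N}. w l * cos (2 * pi * (of_int l * snd z)))
      - (\<Sum>k\<in>{-int N..int N}. w k * sin (2 * pi * (of_int k * fst z))) * (\<Sum>l\<in>{-int N..int N}. w l * sin (2 * pi * (of_int l * snd z)))"
    by (simp add: sum_subtractf sum_product)
  also have "\<dots> = fejer2 N z" unfolding odd by (simp add: fejer2_def fejer_def w_def)
  finally show ?thesis by simp
qed

lemma fejer2_nonneg: "fejer2 N z \<ge> 0"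
  by (simp add: fejer2_def fejer_nonneg)

lemma fejer2_measurable [measurable]: "fejer2 N \<in> borel_measurable borel"
  unfolding fejer2_def[abs_def] borel_prod[symmetric] by measurable

lemma abs_fejer2_le: "\<exists>B. \<forall>x. \<bar>fejer2 N x\<bar> \<le> B"
proof -
  obtain B where "\<bar>fejer N x\<bar> \<le> B" for x using abs_fejer_le[of N] by blast
  then have "\<bar>fejer2 N z\<bar> \<le> B * B" for z
    unfolding fejer2_def abs_mult by (intro mult_mono) (auto intro: order_trans[OF abs_ge_zero])
  then show ?thesis by blast
qed

lemma integrable_indicator_fejer2:
  assumes "S \<in> sets borel" "bounded S"
  shows "integrable lborel (\<lambda>z. indicator S z * fejer2 N z)"
  using abs_fejer2_le[of N] integrable_indicator_mult_bounded[OF assms fejer2_measurable] by blast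

lemma integral_times_fejer2:
  assumes "S \<in> sets borel" "bounded S" "T \<in> sets borel" "bounded T"
  shows "(LBINT z. indicator (S \<times> T) z * fejer2 N z) = (LBINT x. indicator S x * fejer N x) * (LBINT y. indicator T y * fejer N y)"
proof -
  have "integrable (lborel \<Otimes>\<^sub>M lborel) (\<lambda>z. indicator (S \<times> T) z * fejer2 N z)"
    using integrable_indicator_fejer2[of "S \<times> T" N] assms
    by (simp add: lborel_prod bounded_Times borel_Times)
  from lborel_pair.integral_fst'[OF this]
  have "(LBINT z. indicator (S \<times> T) z * fejer2 N z) = (LBINT x. LBINT y. indicator (S \<times> T) (x, y) * fejer2 N (x, y))"
    by (simp add: lborel_prod)
  also have "\<dots> = (LBINT x. LBINT y. (indicator S x * fejer N x) * (indicator T y * fejer N y))"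
    by (simp add: fejer2_def indicator_times mult_ac)
  also have "\<dots> = (LBINT x. indicator S x * fejer N x) * (LBINT y. indicator T y * fejer N y)" by simp
  finally show ?thesis .
qed

text \<open>Half-open, so that the cells partition the plane; for N > 0 the kernel has mass exactly
  1 on each of them.\<close>

definition lcell :: "int \<times> int \<Rightarrow> (real \<times> real) set" where
  "lcell n = {of_int (fst n) - 1/2..<of_int (fst n) + 1/2} \<times> {of_int (snd n) - 1/2..<of_int (snd n) + 1/2}"

definition lsquare :: "real \<Rightarrow> int \<times> int \<Rightarrow> (real \<times> real) set" where
  "lsquare \<tau> n = {of_int (fst n) - \<tau>..of_int (fst n) + \<tau>} \<times> {of_int (snd n) - \<tau>..of_int (snd n) + \<tau>}"

lemma lcell_exists: "\<exists>n. z \<in> lcell n"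
proof
  show "z \<in> lcell (\<lfloor>fst z + 1/2\<rfloor>, \<lfloor>snd z + 1/2\<rfloor>)"
    unfolding lcell_def by (cases z) (auto; linarith)
qed

lemma lcell_unique: assumes "z \<in> lcell n" "z \<in> lcell m" shows "n = m"
proof -
  have "\<lfloor>fst z + 1/2\<rfloor> = fst n" "\<lfloor>snd z + 1/2\<rfloor> = snd n" if "z \<in> lcell n" for n
    using that unfolding lcell_def by (cases z; intro floor_unique; auto)+
  with assms show ?thesis by (metis prod.collapse)
qed

lemma lsquare_subset_lcell: "\<tau> < 1/2 \<Longrightarrow> lsquare \<tau> n \<subseteq> lcell n"
  unfolding lsquare_def lcell_def by (intro Sigma_mono) auto

lemma lcell_lsquare_borel [measurable]: "lcell n \<in> sets borel" "lsquare \<tau> n \<in> sets borel"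
  unfolding lcell_def lsquare_def by (auto intro!: borel_Times)

lemma bounded_Ico_real: "bounded {x..<y::real}"
  by (rule bounded_subset[OF bounded_closed_interval[of x y]]) auto

lemma bounded_lcell: "bounded (lcell n)" "bounded (lsquare \<tau> n)"
  unfolding lcell_def lsquare_def by (intro bounded_Times bounded_Ico_real bounded_closed_interval)+

lemma integral_fejer2_lcell: "N > 0 \<Longrightarrow> (LBINT z. indicator (lcell n) z * fejer2 N z) = 1"
  unfolding lcell_def by (subst integral_times_fejer2) (auto simp: integral_fejer_cell bounded_Ico_real)

lemma integral_fejer2_lsquare: 
  "(LBINT z. indicator (lsquare \<tau> n) z * fejer2 N z) = (LBINT x. indicator {-\<tau>..\<tau>} x * fejer N x)\<^sup>2"
  unfolding lsquare_def by (subst integral_times_fejer2) (auto simp: integral_fejer_centre_shift power2_eq_square)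

section \<open>Lattice counts against Fejer integrals\<close>

context pos_form begin

definition L :: "real \<Rightarrow> (int \<times> int) set" where
  "L R = {n. emb n \<in> E R}"

lemma finite_lattice_bounded:
  assumes "bounded S" shows "finite {n. emb n \<in> S}"
proof -
  obtain B where B: "\<And>z. z \<in> S \<Longrightarrow> norm z \<le> B" using assms by (auto simp: bounded_iff)
  have "{n. emb n \<in> S} \<subseteq> {-\<lceil>B\<rceil>..\<lceil>B\<rceil>} \<times> {-\<lceil>B\<rceil>..\<lceil>B\<rceil>}"
  proof
    fix n assume "n \<in> {n. emb n \<in> S}"
    then have "norm (emb n) \<le> B" using B by simp
    then have "\<bar>real_of_int (fst n)\<bar> \<le> B" "\<bar>real_of_int (snd n)\<bar> \<le> B"
      using norm_fst_le[of "fst (emb n)" "snd (emb n)"] norm_snd_le[of "snd (emb n)" "fst (emb n)"] by (auto simp: emb_def)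
    then have "\<bar>fst n\<bar> \<le> \<lceil>B\<rceil>" "\<bar>snd n\<bar> \<le> \<lceil>B\<rceil>" by linarith+
    then show "n \<in> {-\<lceil>B\<rceil>..\<lceil>B\<rceil>} \<times> {-\<lceil>B\<rceil>..\<lceil>B\<rceil>}" by (cases n) auto
  qed
  then show ?thesis by (rule finite_subset) simp
qed

lemma finite_L: "finite (L R)"
  unfolding L_def by (rule finite_lattice_bounded[OF bounded_E])

text \<open>The triangle inequality for sqrt Q. Its Cauchy-Schwarz step is the identity expressing Q
  z Q w - P^2 as D / 4 times the squared determinant of z and w.\<close>

lemma E_add:
  assumes "z \<in> E R" "w \<in> E S" "R \<ge> 0" "S \<ge> 0" shows "z + w \<in> E (R + S)"
proof -
  define P where "P = a * fst z * fst w + b / 2 * (fst z * snd w + snd z * fst w) + c * snd z * snd w"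
  have Qs: "Q (z + w) = Q z + Q w + 2 * P" by (simp add: Q_def P_def power2_eq_square algebra_simps)
  have "Q z * Q w - P\<^sup>2 = D / 4 * (fst z * snd w - snd z * fst w)\<^sup>2"
    by (simp add: Q_def P_def D_def power2_eq_square field_simps)
  moreover have "0 \<le> D / 4 * (fst z * snd w - snd z * fst w)\<^sup>2" using D_pos by simp
  ultimately have "P\<^sup>2 \<le> Q z * Q w" by linarith
  also have "\<dots> \<le> R\<^sup>2 * S\<^sup>2" using assms Q_nonneg by (intro mult_mono) (auto simp: E_def)
  finally have "P\<^sup>2 \<le> (R * S)\<^sup>2" by (simp add: power_mult_distrib)
  then have "P \<le> R * S" by (rule power2_le_imp_le) (use assms in simp)
  with assms show ?thesis by (simp add: E_def Qs power2_sum)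
qed

lemma E_uminus: "- z \<in> E R \<longleftrightarrow> z \<in> E R"
  by (simp add: E_def Q_def)

lemma lsquare_close:
  assumes "\<delta> > 0"
  obtains \<tau> where "0 < \<tau>" "\<tau> < 1/2" "\<And>n z. z \<in> lsquare \<tau> n \<Longrightarrow> z - emb n \<in> E \<delta>"
proof -
  \<comment> \<open>M bounds Q on the square of half-side 1, so M \<tau>^2 bounds it on half-side
    \<tau>; the cap 1/4 keeps the square inside its cell.\<close>
  define M where "M = a + \<bar>b\<bar> + c"
  have M: "M > 0" using a_pos c_pos by (simp add: M_def add_pos_nonneg)
  define \<tau> where "\<tau> = min (1/4) (\<delta> / sqrt M)"
  have \<tau>: "0 < \<tau>" "\<tau> < 1/2" "\<tau> \<le> \<delta> / sqrt M" using assms M by (auto simp: \<tau>_def)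
  have "z - emb n \<in> E \<delta>" if "z \<in> lsquare \<tau> n" for n z
  proof -
    define x y where "x = fst z - of_int (fst n)" and "y = snd z - of_int (snd n)"
    have xy: "\<bar>x\<bar> \<le> \<tau>" "\<bar>y\<bar> \<le> \<tau>" using that unfolding lsquare_def x_def y_def by (cases z; auto simp: abs_le_iff)+
    have "x\<^sup>2 \<le> \<tau>\<^sup>2" "y\<^sup>2 \<le> \<tau>\<^sup>2" using xy \<tau> by (auto simp: abs_le_square_iff[symmetric])
    have "\<bar>x\<bar> * \<bar>y\<bar> \<le> \<tau> * \<tau>" using xy \<tau> by (intro mult_mono) auto
    then have "\<bar>b\<bar> * (\<bar>x\<bar> * \<bar>y\<bar>) \<le> \<bar>b\<bar> * \<tau>\<^sup>2" by (intro mult_left_mono) (auto simp: power2_eq_square)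
    moreover have "b * x * y \<le> \<bar>b\<bar> * (\<bar>x\<bar> * \<bar>y\<bar>)"
      using abs_ge_self[of "b * x * y"] by (simp add: abs_mult mult.assoc)
    ultimately have "b * x * y \<le> \<bar>b\<bar> * \<tau>\<^sup>2" by linarith
    with \<open>x\<^sup>2 \<le> \<tau>\<^sup>2\<close> \<open>y\<^sup>2 \<le> \<tau>\<^sup>2\<close> have "a * x\<^sup>2 + b * x * y + c * y\<^sup>2 \<le> a * \<tau>\<^sup>2 + \<bar>b\<bar> * \<tau>\<^sup>2 + c * \<tau>\<^sup>2"
      using a_pos c_pos by (intro add_mono mult_left_mono) auto
    also have "\<dots> = M * \<tau>\<^sup>2" by (simp add: M_def algebra_simps)
    also have "\<dots> \<le> M * (\<delta> / sqrt M)\<^sup>2" using \<tau> M by (intro mult_left_mono power_mono) auto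
    also have "\<dots> = \<delta>\<^sup>2" using M by (simp add: power_divide)
    finally show ?thesis by (simp add: E_def Q_def x_def y_def emb_def)
  qed
  with \<tau> that show thesis by blast
qed

text \<open>For large N the kernel puts almost all mass of a cell near its lattice point, so the
  integral nearly counts the lattice points of \<open>E X\<close>. Points close to the boundary are
  counted only partly, which is why the counts refer to X + \<delta> and X - \<delta>. In the proof
  \<eta> N is the mass of a cell outside its small central square, and B bounds the number of cells
  that can matter.\<close>

lemma integral_E_fejer2_bounds:
  assumes "X \<ge> 0" "\<delta> > 0"
  obtains \<eta> B where "\<eta> \<longlonglongrightarrow> 0"
    "\<And>N. N > 0 \<Longrightarrow> (LBINT z. indicator (E X) z * fejer2 N z) \<le> real (card (L (X + \<delta>))) + B * \<eta> N"
    "\<And>N. N > 0 \<Longrightarrow> X > \<delta> \<Longrightarrow> real (card (L (X - \<delta>))) - B * \<eta> N \<le> (LBINT z. indicator (E X) z * fejer2 N z)"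
proof -
  obtain \<tau> where \<tau>: "0 < \<tau>" "\<tau> < 1/2" and close: "\<And>n z. z \<in> lsquare \<tau> n \<Longrightarrow> z - emb n \<in> E \<delta>"
    using lsquare_close[OF assms(2)] by blast
  define \<eta> where "\<eta> = (\<lambda>N. 1 - (LBINT x. indicator {-\<tau>..\<tau>} x * fejer N x)\<^sup>2)"
  have "\<eta> \<longlonglongrightarrow> 1 - 1\<^sup>2" unfolding \<eta>_def by (intro tendsto_intros integral_fejer_centre_tendsto \<tau>)
  then have \<eta>0: "\<eta> \<longlonglongrightarrow> 0" by simp
  have int_diff: "(LBINT z. indicator (lcell n - lsquare \<tau> n) z * fejer2 N z) = \<eta> N" if "N > 0" for N n
  proof -
    have "indicator (lcell n - lsquare \<tau> n) z * fejer2 N z = indicator (lcell n) z * fejer2 N z - indicator (lsquare \<tau> n) z * fejer2 N z" for z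
      using lsquare_subset_lcell[OF \<tau>(2), of n] by (auto simp: indicator_def)
    then show ?thesis
      using that by (simp add: Bochner_Integration.integral_diff integrable_indicator_fejer2 bounded_lcell integral_fejer2_lcell integral_fejer2_lsquare \<eta>_def)
  qed
  obtain H where H: "\<And>z. z \<in> E X \<Longrightarrow> norm z \<le> H" using bounded_E[of X] by (auto simp: bounded_iff)
  \<comment> \<open>A finite set containing the centres of all cells that meet \<open>E X\<close>,
    as a cell lies within distance 1 of its centre. Adding the two lattice sets lets the same
    constant serve in the lower bound.\<close>
  define BB where "BB = {n. emb n \<in> cball 0 (H + 2)} \<union> L (X + \<delta>) \<union> L (X - \<delta>)"
  have finBB: "finite BB" unfolding BB_def by (intro finite_UnI finite_lattice_bounded finite_L bounded_cball)
  have cellBB: "n \<in> BB" if "z \<in> E X" "z \<in> lcell n" for z n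
  proof -
    have "norm (emb n - z) \<le> norm (fst (emb n - z)) + norm (snd (emb n - z))"
      by (metis norm_Pair_le prod.collapse)
    also have "\<dots> \<le> 1/2 + 1/2" using that(2) unfolding lcell_def emb_def by (cases z) (auto simp: abs_le_iff intro!: add_mono)
    finally have "norm (emb n) \<le> H + 2" using H[OF that(1)] norm_triangle_sub[of "emb n" z] by linarith
    then show ?thesis by (simp add: BB_def)
  qed
  have ind_i: "integrable lborel (\<lambda>z. indicator (lcell n) z * fejer2 N z)" "integrable lborel (\<lambda>z. indicator (lcell n - lsquare \<tau> n) z * fejer2 N z)"
     "integrable lborel (\<lambda>z. indicator (lsquare \<tau> n) z * fejer2 N z)" for n N
    by (auto intro!: integrable_indicator_fejer2 bounded_lcell bounded_subset[OF bounded_lcell(1)])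
  have up: "(LBINT z. indicator (E X) z * fejer2 N z) \<le> real (card (L (X + \<delta>))) + real (card BB) * \<eta> N" if N: "N > 0" for N
  proof -
    \<comment> \<open>z is charged to its cell: if it is in the central square, the lattice point
      lies in \<open>E (X + \<delta>)\<close> and the whole cell is counted; otherwise z is in the
      part of small mass.\<close>
    have pw: "indicator (E X) z * fejer2 N z \<le> (\<Sum>n\<in>L (X + \<delta>). indicator (lcell n) z * fejer2 N z)
        + (\<Sum>n\<in>BB. indicator (lcell n - lsquare \<tau> n) z * fejer2 N z)" (is "_ \<le> ?S1 + ?S2") for z
    proof (cases "z \<in> E X")
      case True
      obtain n where n: "z \<in> lcell n" using lcell_exists by blast
      have nB: "n \<in> BB" by (rule cellBB[OF True n])
      have s1: "?S1 \<ge> 0" and s2: "?S2 \<ge> 0" by (auto intro!: sum_nonneg mult_nonneg_nonneg fejer2_nonneg)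
      show ?thesis
      proof (cases "z \<in> lsquare \<tau> n")
        case sq: True
        have "z + - (z - emb n) \<in> E (X + \<delta>)"
        proof (rule E_add)
          show "- (z - emb n) \<in> E \<delta>" using close[OF sq] E_uminus by blast
        qed (use True assms in auto)
        then have "n \<in> L (X + \<delta>)" by (simp add: L_def)
        then have "indicator (lcell n) z * fejer2 N z \<le> ?S1"
          by (intro member_le_sum finite_L) (auto intro!: mult_nonneg_nonneg fejer2_nonneg)
        then show ?thesis using True n s2 by simp
      next
        case False
        have "indicator (lcell n - lsquare \<tau> n) z * fejer2 N z \<le> ?S2"
          using nB by (intro member_le_sum finBB) (auto intro!: mult_nonneg_nonneg fejer2_nonneg)
        then show ?thesis using True False n s1 by simp
      qed
    qed (auto intro!: add_nonneg_nonneg sum_nonneg mult_nonneg_nonneg fejer2_nonneg)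
    have "(LBINT z. indicator (E X) z * fejer2 N z) \<le> (LBINT z. (\<Sum>n\<in>L (X + \<delta>). indicator (lcell n) z * fejer2 N z)
        + (\<Sum>n\<in>BB. indicator (lcell n - lsquare \<tau> n) z * fejer2 N z))"
      by (intro integral_mono pw integrable_indicator_fejer2 E_borel bounded_E Bochner_Integration.integrable_add Bochner_Integration.integrable_sum ind_i)
    also have "\<dots> = (\<Sum>n\<in>L (X + \<delta>). 1) + (\<Sum>n\<in>BB. \<eta> N)"
      by (subst Bochner_Integration.integral_add)
         (auto simp: Bochner_Integration.integral_sum ind_i integral_fejer2_lcell[OF N] int_diff[OF N])
    finally show ?thesis by simp
  qed
  have lo: "real (card (L (X - \<delta>))) - real (card BB) * \<eta> N \<le> (LBINT z. indicator (E X) z * fejer2 N z)" if N: "N > 0" and X: "X > \<delta>" for N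
  proof -
    have \<eta>pos: "\<eta> N \<ge> 0"
      unfolding int_diff[OF N, of "(0,0)", symmetric] by (intro Bochner_Integration.integral_nonneg mult_nonneg_nonneg fejer2_nonneg indicator_pos_le)
    \<comment> \<open>The central squares are disjoint, and those around points of
      \<open>E (X - \<delta>)\<close> lie inside \<open>E X\<close>.\<close>
    have pw: "(\<Sum>n\<in>L (X - \<delta>). indicator (lsquare \<tau> n) z * fejer2 N z) \<le> indicator (E X) z * fejer2 N z" for z
    proof (cases "\<exists>n\<in>L (X - \<delta>). z \<in> lsquare \<tau> n")
      case True
      then obtain n where n: "n \<in> L (X - \<delta>)" "z \<in> lsquare \<tau> n" by blast
      have "emb n + (z - emb n) \<in> E (X - \<delta> + \<delta>)"
        using n close[OF n(2)] assms X by (intro E_add) (auto simp: L_def)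
      then have z: "z \<in> E X" by simp
      have "indicator (lsquare \<tau> m) z = (if m = n then 1 else 0 :: real)" for m
      proof (cases "m = n")
        case False
        then have "z \<notin> lsquare \<tau> m"
          using n(2) lcell_unique[of z m n] lsquare_subset_lcell[OF \<tau>(2)] by blast
        with False show ?thesis by simp
      qed (use n(2) in simp)
      then have "(\<Sum>m\<in>L (X - \<delta>). indicator (lsquare \<tau> m) z * fejer2 N z) = (\<Sum>m\<in>L (X - \<delta>). if m = n then fejer2 N z else 0)"
        by (intro sum.cong) auto
      also have "\<dots> = fejer2 N z" using n(1) by (simp add: sum.delta[OF finite_L])
      finally show ?thesis using z by simp
    next
      case False
      then have "(\<Sum>n\<in>L (X - \<delta>). indicator (lsquare \<tau> n) z * fejer2 N z) = 0" by (intro sum.neutral) auto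
      then show ?thesis by (simp add: fejer2_nonneg)
    qed
    have "(\<Sum>n\<in>L (X - \<delta>). 1 - \<eta> N) = (LBINT z. (\<Sum>n\<in>L (X - \<delta>). indicator (lsquare \<tau> n) z * fejer2 N z))"
      by (simp add: Bochner_Integration.integral_sum ind_i integral_fejer2_lsquare \<eta>_def)
    also have "\<dots> \<le> (LBINT z. indicator (E X) z * fejer2 N z)"
      by (intro integral_mono pw integrable_indicator_fejer2 E_borel bounded_E Bochner_Integration.integrable_sum ind_i)
    finally have "real (card (L (X - \<delta>))) - real (card (L (X - \<delta>))) * \<eta> N \<le> (LBINT z. indicator (E X) z * fejer2 N z)"
      by (simp add: algebra_simps)
    moreover have "real (card (L (X - \<delta>))) * \<eta> N \<le> real (card BB) * \<eta> N"
      using \<eta>pos card_mono[OF finBB, of "L (X - \<delta>)"] by (intro mult_right_mono) (auto simp: BB_def)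
    ultimately show ?thesis by linarith
  qed
  show thesis by (rule that[OF \<eta>0 up lo])
qed

end

section \<open>Poisson summation smoothed by a small ellipse\<close>

lemma lborel_integral_translate:
  fixes f :: "real \<times> real \<Rightarrow> real"
  assumes [measurable]: "f \<in> borel_measurable borel"
  shows "(LBINT z. f (w + z)) = (LBINT z. f z)"
proof -
  have "(LBINT z. f z) = integral\<^sup>L (distr lborel borel ((+) w)) f" by (simp add: lborel_distr_plus)
  also have "\<dots> = (LBINT z. f (w + z))" by (rule integral_distr) measurable
  finally show ?thesis ..
qed

lemma lborel_integral_reflect_odd:
  fixes f :: "real \<times> real \<Rightarrow> real"
  assumes "f \<in> borel_measurable borel" and odd: "\<And>x. f (- x) = - f x"
  shows "(LBINT z. f z) = 0"
proof -
  have "distr lborel borel (uminus :: real \<times> real \<Rightarrow> _) = lborel"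
    by (subst lborel_affine[of "-1" 0]) (auto simp: density_1)
  then have "(LBINT z. f z) = integral\<^sup>L (distr lborel borel uminus) f" by simp
  also have "\<dots> = (LBINT z. f (- z))" using assms(1) by (intro integral_distr) measurable
  also have "\<dots> = - (LBINT z. f z)" unfolding odd by simp
  finally show ?thesis by simp
qed

text \<open>Dominated convergence for the counting measure: on the box the weights lie in [0, 1],
  and each of them tends to 1.\<close>

lemma fejer_weight_sum_tendsto:
  fixes G :: "int \<times> int \<Rightarrow> real"
  assumes "G summable_on UNIV"
  shows "(\<lambda>N. \<Sum>n\<in>fejer_box N. fejer_weight N n * G n) \<longlonglongrightarrow> infsum G UNIV"
proof -
  define h where "h = (\<lambda>N n. (if n \<in> fejer_box N then fejer_weight N n else 0) * G n)"
  have abs: "Infinite_Set_Sum.abs_summable_on G UNIV"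
    using summable_on_iff_abs_summable_on_real[THEN iffD1, OF assms] by (simp only: abs_summable_equivalent)
  then have int: "integrable (count_space UNIV) G" by (simp add: Infinite_Set_Sum.abs_summable_on_def)
  have "(\<lambda>N. integral\<^sup>L (count_space UNIV) (h N)) \<longlonglongrightarrow> integral\<^sup>L (count_space UNIV) G"
  proof (rule integral_dominated_convergence[where w = "\<lambda>n. \<bar>G n\<bar>"])
    show "integrable (count_space UNIV) (\<lambda>n. \<bar>G n\<bar>)" using int by simp
    show "AE n in count_space UNIV. (\<lambda>N. h N n) \<longlonglongrightarrow> G n"
    proof (rule AE_I2)
      fix n :: "int \<times> int"
      have ev: "\<forall>\<^sub>F N in sequentially. n \<in> fejer_box N"
        using eventually_ge_at_top[of "nat (\<bar>fst n\<bar> + \<bar>snd n\<bar>)"]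
      proof eventually_elim
        case (elim N)
        then have "\<bar>fst n\<bar> \<le> int N" "\<bar>snd n\<bar> \<le> int N" by linarith+
        then show ?case by (cases n) (auto simp: fejer_box_def abs_le_iff)
      qed
      have "(\<lambda>N. fejer_weight N n * G n) \<longlonglongrightarrow> ((1 - 0) * (1 - 0)) * G n"
        unfolding fejer_weight_def by (intro tendsto_intros lim_const_over_n)
      then have "(\<lambda>N. fejer_weight N n * G n) \<longlonglongrightarrow> G n" by simp
      moreover have "\<forall>\<^sub>F N in sequentially. fejer_weight N n * G n = h N n"
        using ev by eventually_elim (simp add: h_def)
      ultimately show "(\<lambda>N. h N n) \<longlonglongrightarrow> G n" by (rule Lim_transform_eventually)
    qed
    fix N
    show "AE n in count_space UNIV. norm (h N n) \<le> \<bar>G n\<bar>"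
    proof (rule AE_I2)
      fix n :: "int \<times> int"
      have "\<bar>fejer_weight N n\<bar> \<le> 1 * 1" if "n \<in> fejer_box N"
      proof -
        have "0 \<le> 1 - \<bar>of_int k\<bar> / real N \<and> 1 - \<bar>of_int k\<bar> / real N \<le> 1" if "k \<in> {- int N..int N}" for k
        proof -
          have "\<bar>k\<bar> \<le> int N" using that by auto
          then have "\<bar>real_of_int k\<bar> \<le> real N" by (metis of_int_abs of_int_le_iff of_int_of_nat_eq)
          then show ?thesis by (cases "N = 0") auto
        qed
        from this[of "fst n"] this[of "snd n"] that show ?thesis
          unfolding fejer_weight_def abs_mult by (intro mult_mono) (auto simp: fejer_box_def)
      qed
      then show "norm (h N n) \<le> \<bar>G n\<bar>" by (simp add: h_def abs_mult mult_left_le_one_le)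
    qed
  qed auto
  moreover have "integral\<^sup>L (count_space UNIV) G = infsum G UNIV"
    using infsetsum_infsum[OF abs] by (simp add: infsetsum_def)
  moreover have "integral\<^sup>L (count_space UNIV) (h N) = (\<Sum>n\<in>fejer_box N. fejer_weight N n * G n)" for N
  proof -
    have f: "finite (fejer_box N)" by (simp add: fejer_box_def)
    then have "integral\<^sup>L (count_space UNIV) (h N) = (\<Sum>n | n \<in> UNIV \<and> h N n \<noteq> 0. h N n)"
      by (intro lebesgue_integral_count_space_finite_support) (auto simp: h_def elim: finite_subset[rotated])
    also have "\<dots> = (\<Sum>n\<in>fejer_box N. h N n)"
      using f by (intro sum.mono_neutral_left) (auto simp: h_def split: if_splits)
    finally show ?thesis by (simp add: h_def)
  qed
  ultimately show ?thesis by simp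
qed

context pos_form begin

abbreviation dot :: "int \<times> int \<Rightarrow> real \<times> real \<Rightarrow> real" where
  "dot n z \<equiv> of_int (fst n) * fst z + of_int (snd n) * snd z"

lemma trig_dot_measurable [measurable]:
  "(\<lambda>z. cos (2 * pi * dot n z)) \<in> borel_measurable borel"
  "(\<lambda>z. sin (2 * pi * dot n z)) \<in> borel_measurable borel"
  unfolding borel_prod[symmetric] by measurable

lemma integrable_E_trig:
  "integrable lborel (\<lambda>z. indicator (E R) z * cos (2 * pi * dot n z))"
  "integrable lborel (\<lambda>z. indicator (E R) z * sin (2 * pi * dot n z))"
  by (rule integrable_indicator_mult_bounded[OF E_borel bounded_E trig_dot_measurable(1) abs_cos_le_one])
     (rule integrable_indicator_mult_bounded[OF E_borel bounded_E trig_dot_measurable(2) abs_sin_le_one])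

lemma fourier_E_lattice:
  assumes "R > 0"
  shows "(LBINT z. indicator (E R) z * cos (2 * pi * dot n z)) = A * R\<^sup>2 * nbessel (freq (emb n) * R)"
  using fourier_E[OF assms, of "of_int (fst n)" "of_int (snd n)"] by (simp add: emb_def)

text \<open>The kernel is a finite cosine sum, so only transforms of \<open>E R\<close> occur; the
  sine parts integrate to 0 because the ellipse is symmetric about the origin.\<close>

lemma fourier_E_translate:
  assumes "R > 0"
  shows "(LBINT z. indicator (E R) z * fejer2 N (w + z)) =
    (\<Sum>n\<in>fejer_box N. fejer_weight N n * (A * R\<^sup>2 * nbessel (freq (emb n) * R)) * cos (2 * pi * dot n w))"
proof -
  have "(LBINT z. indicator (E R) z * fejer2 N (w + z)) = (LBINT z. (\<Sum>n\<in>fejer_box N.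
      fejer_weight N n * cos (2 * pi * dot n w) * (indicator (E R) z * cos (2 * pi * dot n z))
      - fejer_weight N n * sin (2 * pi * dot n w) * (indicator (E R) z * sin (2 * pi * dot n z))))"
  proof (intro Bochner_Integration.integral_cong refl)
    fix z
    have c: "cos (2 * pi * dot n (w + z)) = cos (2 * pi * dot n w) * cos (2 * pi * dot n z) - sin (2 * pi * dot n w) * sin (2 * pi * dot n z)" for n
      unfolding cos_add[symmetric] by (simp add: algebra_simps)
    show "indicator (E R) z * fejer2 N (w + z) = (\<Sum>n\<in>fejer_box N.
      fejer_weight N n * cos (2 * pi * dot n w) * (indicator (E R) z * cos (2 * pi * dot n z))
      - fejer_weight N n * sin (2 * pi * dot n w) * (indicator (E R) z * sin (2 * pi * dot n z)))"
      unfolding fejer2_expansion sum_distrib_left c by (intro sum.cong refl) (simp add: algebra_simps)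
  qed
  also have "\<dots> = (\<Sum>n\<in>fejer_box N.
      fejer_weight N n * cos (2 * pi * dot n w) * (LBINT z. indicator (E R) z * cos (2 * pi * dot n z))
      - fejer_weight N n * sin (2 * pi * dot n w) * (LBINT z. indicator (E R) z * sin (2 * pi * dot n z)))"
    using integrable_E_trig
    by (subst Bochner_Integration.integral_sum)
       (auto intro!: Bochner_Integration.integrable_diff sum.cong simp: Bochner_Integration.integral_diff)
  also have "\<dots> = (\<Sum>n\<in>fejer_box N. fejer_weight N n * (A * R\<^sup>2 * nbessel (freq (emb n) * R)) * cos (2 * pi * dot n w))"
  proof (intro sum.cong refl)
    fix n
    have "(LBINT z. indicator (E R) z * sin (2 * pi * dot n z)) = 0"
    proof (rule lborel_integral_reflect_odd)
      show "(\<lambda>z. indicator (E R) z * sin (2 * pi * dot n z)) \<in> borel_measurable borel" by measurable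
      show "indicator (E R) (- z) * sin (2 * pi * dot n (- z)) = - (indicator (E R) z * sin (2 * pi * dot n z))" for z
      proof -
        have e: "2 * pi * dot n (- z) = - (2 * pi * dot n z)" by (simp add: algebra_simps)
        show ?thesis unfolding e sin_minus by (simp add: indicator_def E_uminus)
      qed
    qed
    then show "fejer_weight N n * cos (2 * pi * dot n w) * (LBINT z. indicator (E R) z * cos (2 * pi * dot n z))
      - fejer_weight N n * sin (2 * pi * dot n w) * (LBINT z. indicator (E R) z * sin (2 * pi * dot n z))
      = fejer_weight N n * (A * R\<^sup>2 * nbessel (freq (emb n) * R)) * cos (2 * pi * dot n w)"
      unfolding fourier_E_lattice[OF assms] by simp
  qed
  finally show ?thesis .
qed

text \<open>By the triangle inequality the translate of \<open>E R\<close> by w contains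
  \<open>E (R - \<delta>)\<close> and is contained in \<open>E (R + \<delta>)\<close>; the kernel is
  nonnegative.\<close>

lemma integral_E_translate_bounds:
  assumes "R > 0" "\<delta> > 0" "w \<in> E \<delta>"
  shows "(LBINT z. indicator (E R) z * fejer2 N (w + z)) \<le> (LBINT z. indicator (E (R + \<delta>)) z * fejer2 N z)"
    "R > \<delta> \<Longrightarrow> (LBINT z. indicator (E (R - \<delta>)) z * fejer2 N z) \<le> (LBINT z. indicator (E R) z * fejer2 N (w + z))"
proof -
  have [measurable]: "(\<lambda>z. indicator (E R) (z - w) * fejer2 N z) \<in> borel_measurable borel" by measurable
  have eq: "(LBINT z. indicator (E R) z * fejer2 N (w + z)) = (LBINT z. indicator (E R) (z - w) * fejer2 N z)"
    using lborel_integral_translate[of "\<lambda>z. indicator (E R) (z - w) * fejer2 N z" w] by simp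
  have sub: "z \<in> E (R + \<delta>)" if "z - w \<in> E R" for z
    using E_add[OF that assms(3)] assms by simp
  have b: "bounded ((\<lambda>z. z - w) -` E R)"
    by (rule bounded_subset[OF bounded_E[of "R + \<delta>"]]) (use sub in auto)
  have i: "integrable lborel (\<lambda>z. indicator (E R) (z - w) * fejer2 N z)"
  proof -
    have "(\<lambda>z. z - w) -` E R \<in> sets borel"
      using measurable_sets[of "\<lambda>z. z - w" borel borel "E R"] by simp
    from integrable_indicator_fejer2[OF this b] show ?thesis by (simp add: indicator_def)
  qed
  show "(LBINT z. indicator (E R) z * fejer2 N (w + z)) \<le> (LBINT z. indicator (E (R + \<delta>)) z * fejer2 N z)"
    unfolding eq by (intro integral_mono i integrable_indicator_fejer2 E_borel bounded_E)
      (use sub fejer2_nonneg in \<open>auto simp: indicator_def\<close>)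
  assume "R > \<delta>"
  then have sub2: "z - w \<in> E R" if "z \<in> E (R - \<delta>)" for z
    using E_add[OF that, of "- w" \<delta>] assms by (simp add: E_uminus)
  show "(LBINT z. indicator (E (R - \<delta>)) z * fejer2 N z) \<le> (LBINT z. indicator (E R) z * fejer2 N (w + z))"
    unfolding eq by (intro integral_mono i integrable_indicator_fejer2 E_borel bounded_E)
      (use sub2 fejer2_nonneg in \<open>auto simp: indicator_def\<close>)
qed

text \<open>Averaging the translation w over \<open>E \<delta>\<close> multiplies each coefficient
  by the transform of \<open>E \<delta>\<close>; after division by the area A \<delta>^2 this is the
  factor \<open>nbessel\<close> at \<delta>. The convolution thus appears only as an iterated
  integral.\<close>

lemma fejer_weighted_bessel_bounds:
  assumes R: "R > 0" and d: "\<delta> > 0"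
  defines "S \<equiv> \<lambda>N. A * R\<^sup>2 * (\<Sum>n\<in>fejer_box N. fejer_weight N n * (nbessel (freq (emb n) * R) * nbessel (freq (emb n) * \<delta>)))"
  shows "S N \<le> (LBINT z. indicator (E (R + \<delta>)) z * fejer2 N z)"
    "R > \<delta> \<Longrightarrow> (LBINT z. indicator (E (R - \<delta>)) z * fejer2 N z) \<le> S N"
proof -
  define \<Phi> where "\<Phi> = (\<lambda>w. LBINT z. indicator (E R) z * fejer2 N (w + z))"
  have i: "integrable lborel (\<lambda>w. indicator (E \<delta>) w * \<Phi> w)" and v: "(LBINT w. indicator (E \<delta>) w * \<Phi> w) = A * \<delta>\<^sup>2 * S N"
  proof -
    have e: "indicator (E \<delta>) w * \<Phi> w = (\<Sum>n\<in>fejer_box N. fejer_weight N n * (A * R\<^sup>2 * nbessel (freq (emb n) * R)) * (indicator (E \<delta>) w * cos (2 * pi * dot n w)))" for w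
      unfolding \<Phi>_def fourier_E_translate[OF R] sum_distrib_left by (intro sum.cong refl) simp
    show "integrable lborel (\<lambda>w. indicator (E \<delta>) w * \<Phi> w)"
      unfolding e by (intro Bochner_Integration.integrable_sum integrable_mult_right integrable_E_trig)
    have "(LBINT w. indicator (E \<delta>) w * \<Phi> w) = (\<Sum>n\<in>fejer_box N. fejer_weight N n * (A * R\<^sup>2 * nbessel (freq (emb n) * R)) * (A * \<delta>\<^sup>2 * nbessel (freq (emb n) * \<delta>)))"
      unfolding e using integrable_E_trig(1) by (subst Bochner_Integration.integral_sum) (auto simp: fourier_E_lattice[OF d])
    then show "(LBINT w. indicator (E \<delta>) w * \<Phi> w) = A * \<delta>\<^sup>2 * S N"
      unfolding S_def sum_distrib_left by (simp add: mult_ac)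
  qed
  have c: "integrable lborel (\<lambda>w. indicator (E \<delta>) w * C)" "(LBINT w. indicator (E \<delta>) w * C) = A * \<delta>\<^sup>2 * C" for C :: real
  proof -
    show "integrable lborel (\<lambda>w. indicator (E \<delta>) w * C)"
      by (rule integrable_indicator_mult_bounded[OF E_borel bounded_E]) auto
    show "(LBINT w. indicator (E \<delta>) w * C) = A * \<delta>\<^sup>2 * C" using measure_E[OF d] by simp
  qed
  have pos: "A * \<delta>\<^sup>2 > 0" using A_pos d by simp
  have pw1: "indicator (E \<delta>) w * \<Phi> w \<le> indicator (E \<delta>) w * (LBINT z. indicator (E (R + \<delta>)) z * fejer2 N z)" for w
    using integral_E_translate_bounds(1)[OF R d, of w N] by (cases "w \<in> E \<delta>") (simp_all add: \<Phi>_def)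
  have "(LBINT w. indicator (E \<delta>) w * \<Phi> w) \<le> (LBINT w. indicator (E \<delta>) w * (LBINT z. indicator (E (R + \<delta>)) z * fejer2 N z))"
    by (intro integral_mono i c(1) pw1)
  then have "A * \<delta>\<^sup>2 * S N \<le> A * \<delta>\<^sup>2 * (LBINT z. indicator (E (R + \<delta>)) z * fejer2 N z)"
    unfolding v c(2) .
  then show "S N \<le> (LBINT z. indicator (E (R + \<delta>)) z * fejer2 N z)" by (rule mult_left_le_imp_le) (rule pos)
  assume Rd: "R > \<delta>"
  have pw2: "indicator (E \<delta>) w * (LBINT z. indicator (E (R - \<delta>)) z * fejer2 N z) \<le> indicator (E \<delta>) w * \<Phi> w" for w
    using integral_E_translate_bounds(2)[OF R d _ Rd, of w N] by (cases "w \<in> E \<delta>") (simp_all add: \<Phi>_def)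
  have "(LBINT w. indicator (E \<delta>) w * (LBINT z. indicator (E (R - \<delta>)) z * fejer2 N z)) \<le> (LBINT w. indicator (E \<delta>) w * \<Phi> w)"
    by (intro integral_mono i c(1) pw2)
  then have "A * \<delta>\<^sup>2 * (LBINT z. indicator (E (R - \<delta>)) z * fejer2 N z) \<le> A * \<delta>\<^sup>2 * S N"
    unfolding v c(2) .
  then show "(LBINT z. indicator (E (R - \<delta>)) z * fejer2 N z) \<le> S N" by (rule mult_left_le_imp_le) (rule pos)
qed

text \<open>Passage to the limit in N. The averaging over translates shifts the radius by \<delta>,
  and the comparison of kernel mass with lattice points by another \<delta>, hence 2
  \<delta>.\<close>

lemma lattice_count_poisson_bounds:
  assumes R: "R > 2 * \<delta>" and d: "\<delta> > 0"
    and G: "(\<lambda>n. nbessel (freq (emb n) * R) * nbessel (freq (emb n) * \<delta>)) summable_on UNIV"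
  defines "S \<equiv> A * R\<^sup>2 * (\<Sum>\<^sub>\<infinity>n. nbessel (freq (emb n) * R) * nbessel (freq (emb n) * \<delta>))"
  shows "S \<le> real (card (L (R + 2 * \<delta>)))" "real (card (L (R - 2 * \<delta>))) \<le> S"
proof -
  have R0: "R > 0" "R > \<delta>" "R - \<delta> > \<delta>" using R d by auto
  define SN where "SN = (\<lambda>N. A * R\<^sup>2 * (\<Sum>n\<in>fejer_box N. fejer_weight N n * (nbessel (freq (emb n) * R) * nbessel (freq (emb n) * \<delta>))))"
  have lim: "SN \<longlonglongrightarrow> S" unfolding SN_def S_def by (intro tendsto_intros fejer_weight_sum_tendsto G)
  have B: "SN N \<le> (LBINT z. indicator (E (R + \<delta>)) z * fejer2 N z)"
    "(LBINT z. indicator (E (R - \<delta>)) z * fejer2 N z) \<le> SN N" for N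
    unfolding SN_def by (rule fejer_weighted_bessel_bounds[OF R0(1) d])+ (rule R0(2))
  obtain \<eta> B1 where 1: "\<eta> \<longlonglongrightarrow> 0"
    "\<And>N. N > 0 \<Longrightarrow> (LBINT z. indicator (E (R + \<delta>)) z * fejer2 N z) \<le> real (card (L (R + \<delta> + \<delta>))) + B1 * \<eta> N"
  proof (rule integral_E_fejer2_bounds[of "R + \<delta>" \<delta>])
    show "R + \<delta> \<ge> 0" "\<delta> > 0" using R0 d by auto
  qed (rule that)
  obtain \<eta>' B2 where 2: "\<eta>' \<longlonglongrightarrow> 0"
    "\<And>N. N > 0 \<Longrightarrow> R - \<delta> > \<delta> \<Longrightarrow> real (card (L (R - \<delta> - \<delta>))) - B2 * \<eta>' N \<le> (LBINT z. indicator (E (R - \<delta>)) z * fejer2 N z)"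
  proof (rule integral_E_fejer2_bounds[of "R - \<delta>" \<delta>])
    show "R - \<delta> \<ge> 0" "\<delta> > 0" using R0 d by auto
  qed (rule that)
  have "(\<lambda>N. real (card (L (R + \<delta> + \<delta>))) + B1 * \<eta> N) \<longlonglongrightarrow> real (card (L (R + \<delta> + \<delta>))) + B1 * 0"
    by (intro tendsto_intros 1)
  moreover have "\<forall>\<^sub>F N in sequentially. SN N \<le> real (card (L (R + \<delta> + \<delta>))) + B1 * \<eta> N"
    by (rule eventually_mono[OF eventually_gt_at_top[of 0]]) (rule order_trans[OF B(1) 1(2)])
  ultimately have "S \<le> real (card (L (R + \<delta> + \<delta>))) + B1 * 0" by (rule tendsto_le[OF sequentially_bot _ lim])
  then show "S \<le> real (card (L (R + 2 * \<delta>)))" by (simp add: algebra_simps)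
  have "(\<lambda>N. real (card (L (R - \<delta> - \<delta>))) - B2 * \<eta>' N) \<longlonglongrightarrow> real (card (L (R - \<delta> - \<delta>))) - B2 * 0"
    by (intro tendsto_intros 2)
  moreover have "\<forall>\<^sub>F N in sequentially. real (card (L (R - \<delta> - \<delta>))) - B2 * \<eta>' N \<le> SN N"
    by (rule eventually_mono[OF eventually_gt_at_top[of 0]]) (rule order_trans[OF 2(2)[OF _ R0(3)] B(2)])
  ultimately have "real (card (L (R - \<delta> - \<delta>))) - B2 * 0 \<le> S" by (rule tendsto_le[OF sequentially_bot lim])
  then show "real (card (L (R - 2 * \<delta>))) \<le> S" by (simp add: algebra_simps)
qed

end

section \<open>Sums over dual frequencies and lattice points in thin annuli\<close>

lemma int_powr_summable:
  fixes t :: real assumes "t > 1"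
  shows "(\<lambda>i::int. (1 + \<bar>of_int i\<bar>) powr (- t)) summable_on UNIV"
proof -
  define f where "f = (\<lambda>i::int. (1 + \<bar>of_int i\<bar>) powr (- t))"
  have "summable (\<lambda>n. real n powr (- t))" using assms by (simp add: summable_real_powr_iff)
  then have "summable (\<lambda>n. real (Suc n) powr (- t))" by (subst summable_Suc_iff)
  then have "summable (\<lambda>n. (1 + real n) powr (- t))" by simp
  then have n: "(\<lambda>n. (1 + real n) powr (- t)) summable_on UNIV"
    by (subst summable_on_UNIV_nonneg_real_iff) auto
  have "f summable_on range int" "f summable_on range (\<lambda>n. - int n)"
    using n by (subst summable_on_reindex; simp add: f_def o_def inj_on_def)+
  then have "f summable_on (range int \<union> range (\<lambda>n. - int n))" by (rule summable_on_union)
  moreover have "range int \<union> range (\<lambda>n. - int n) = UNIV"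
  proof -
    have "i \<in> range int \<union> range (\<lambda>n. - int n)" for i by (cases i rule: int_cases2) auto
    then show ?thesis by auto
  qed
  ultimately show ?thesis by (simp add: f_def)
qed

lemma int_pair_powr_summable:
  fixes t :: real assumes "t > 1"
  shows "(\<lambda>(i::int, j::int). (1 + \<bar>of_int i\<bar>) powr (- t) * (1 + \<bar>of_int j\<bar>) powr (- t)) summable_on UNIV"
proof -
  define f where "f = (\<lambda>i::int. (1 + \<bar>of_int i\<bar>) powr (- t))"
  have f: "f summable_on UNIV" using int_powr_summable[OF assms] by (simp add: f_def)
  have "(\<lambda>(i, j). f i * f j) summable_on Sigma UNIV (\<lambda>_. UNIV)"
  proof (rule summable_on_SigmaI)
    show "((\<lambda>j. case (i, j) of (i, j) \<Rightarrow> f i * f j) has_sum f i * infsum f UNIV) UNIV" for i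
      using has_sum_cmult_right[OF has_sum_infsum[OF f]] by simp
    show "(\<lambda>i. f i * infsum f UNIV) summable_on UNIV" using f by (rule summable_on_cmult_left)
  qed (auto simp: f_def)
  then show ?thesis by (simp add: f_def case_prod_beta)
qed

context pos_form begin

lemma freq_nonneg: "freq p \<ge> 0"
  using D_pos Qadj_pos[of p] by (cases "p = 0") (auto simp: freq_def Qadj_def)

lemma freq_0 [simp]: "freq 0 = 0"
  by (simp add: freq_def Qadj_def)

lemma emb_eq_0_iff: "emb n = 0 \<longleftrightarrow> n = 0"
  by (cases n) (auto simp: emb_def zero_prod_def)

lemma emb_0 [simp]: "emb 0 = 0"
  by (simp add: emb_eq_0_iff)

lemma freq_square: "(freq p)\<^sup>2 = 16 * pi\<^sup>2 * Qadj p / D"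
  using D_pos Qadj_pos[of p] by (cases "p = 0") (auto simp: freq_def power_mult_distrib power_divide Qadj_def)

lemma freq_square_lower: "4 * pi\<^sup>2 / (a + c) * ((fst p)\<^sup>2 + (snd p)\<^sup>2) \<le> (freq p)\<^sup>2"
proof -
  have "D * (fst p)\<^sup>2 \<le> 4 * a * Qadj p" "D * (snd p)\<^sup>2 \<le> 4 * c * Qadj p"
    using pos_form.coordinate_bounds[OF adj, of p] unfolding Qadj_conv[symmetric] pos_form.D_def[OF adj]
    by (simp_all add: D_def mult_ac)
  then have "D * ((fst p)\<^sup>2 + (snd p)\<^sup>2) \<le> 4 * (a + c) * Qadj p" by (simp add: algebra_simps)
  then have "4 * pi\<^sup>2 * (D * ((fst p)\<^sup>2 + (snd p)\<^sup>2)) \<le> 4 * pi\<^sup>2 * (4 * (a + c) * Qadj p)" by (intro mult_left_mono) auto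
  then show ?thesis unfolding freq_square using D_pos a_pos c_pos by (simp add: field_simps)
qed

text \<open>A positive lower bound for the nonzero frequencies, coming from the fact that a nonzero
  integer vector has length at least 1; it need not be attained.\<close>

definition fmin :: real where "fmin = sqrt (4 * pi\<^sup>2 / (a + c))"

lemma fmin_pos: "fmin > 0" using a_pos c_pos by (simp add: fmin_def)

text \<open>Integrality gives |k| <= k^2, and AM-GM handles the cross term. A product on the left is
  wanted because it splits a planar sum of powers into two sums over the integers.\<close>

lemma int_pair_product_le:
  assumes "n \<noteq> (0 :: int \<times> int)"
  shows "(1 + \<bar>of_int (fst n)\<bar>) * (1 + \<bar>of_int (snd n)\<bar>) \<le> 4 * ((of_int (fst n))\<^sup>2 + (of_int (snd n))\<^sup>2 :: real)"
    "1 \<le> ((of_int (fst n))\<^sup>2 + (of_int (snd n))\<^sup>2 :: real)"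
proof -
  obtain i j where n: "n = (i, j)" by (cases n)
  have sq: "\<bar>k\<bar> \<le> k\<^sup>2" for k :: int
  proof (cases "k = 0")
    case False
    then have "\<bar>k\<bar> * 1 \<le> \<bar>k\<bar> * \<bar>k\<bar>" by (intro mult_left_mono) auto
    then show ?thesis by (simp add: power2_eq_square flip: abs_mult)
  qed simp
  have ge1: "1 \<le> i\<^sup>2 + j\<^sup>2" using assms sq[of i] sq[of j] by (auto simp: n zero_prod_def)
  then show *: "1 \<le> ((of_int (fst n))\<^sup>2 + (of_int (snd n))\<^sup>2 :: real)"
    unfolding n by (metis fst_conv of_int_1_le_iff of_int_add of_int_power snd_conv)
  have "2 * (\<bar>i\<bar> * \<bar>j\<bar>) \<le> i\<^sup>2 + j\<^sup>2"
    using zero_le_power2[of "\<bar>i\<bar> - \<bar>j\<bar>"] by (simp add: power2_diff)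
  then have "(1 + \<bar>i\<bar>) * (1 + \<bar>j\<bar>) \<le> 4 * (i\<^sup>2 + j\<^sup>2)"
    using ge1 sq[of i] sq[of j] by (simp add: algebra_simps)
  then have "real_of_int ((1 + \<bar>i\<bar>) * (1 + \<bar>j\<bar>)) \<le> real_of_int (4 * (i\<^sup>2 + j\<^sup>2))" by (simp only: of_int_le_iff)
  then show "(1 + \<bar>of_int (fst n)\<bar>) * (1 + \<bar>of_int (snd n)\<bar>) \<le> 4 * ((of_int (fst n))\<^sup>2 + (of_int (snd n))\<^sup>2 :: real)"
    by (simp add: n)
qed

lemma freq_ge_fmin: assumes "n \<noteq> 0" shows "freq (emb n) \<ge> fmin"
proof -
  have k: "4 * pi\<^sup>2 / (a + c) \<ge> 0" using a_pos c_pos by simp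
  have "4 * pi\<^sup>2 / (a + c) * 1 \<le> 4 * pi\<^sup>2 / (a + c) * ((fst (emb n))\<^sup>2 + (snd (emb n))\<^sup>2)"
    using int_pair_product_le(2)[OF assms] k by (intro mult_left_mono) (auto simp: emb_def)
  also have "\<dots> \<le> (freq (emb n))\<^sup>2" by (rule freq_square_lower)
  finally show ?thesis unfolding fmin_def by (intro real_le_lsqrt) (auto simp: freq_nonneg)
qed

lemma freq_pos: "n \<noteq> 0 \<Longrightarrow> freq (emb n) > 0"
  using freq_ge_fmin[of n] fmin_pos by linarith

text \<open>The origin contributes nothing to such sums, since \<open>0 powr x = 0\<close>.\<close>
lemma freq_powr_summable:
  fixes s :: real assumes s: "s > 2"
  shows "(\<lambda>n. freq (emb n) powr (- s)) summable_on UNIV"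
proof (rule summable_on_comparison_test)
  define K where "K = (fmin\<^sup>2 / 4) powr (- (s / 2))"
  show "(\<lambda>n. K * (case n of (i::int, j::int) \<Rightarrow> (1 + \<bar>of_int i\<bar>) powr (- (s / 2)) * (1 + \<bar>of_int j\<bar>) powr (- (s / 2)))) summable_on UNIV"
    using s by (intro summable_on_cmult_right int_pair_powr_summable) auto
  fix n :: "int \<times> int"
  show "freq (emb n) powr (- s) \<le> K * (case n of (i::int, j::int) \<Rightarrow> (1 + \<bar>of_int i\<bar>) powr (- (s / 2)) * (1 + \<bar>of_int j\<bar>) powr (- (s / 2)))"
  proof (cases "n = 0")
    case False
    obtain i j where n: "n = (i, j)" by (cases n)
    define P where "P = (1 + \<bar>of_int i\<bar>) * (1 + \<bar>of_int j :: real\<bar>)"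
    have P: "P > 0" by (simp add: P_def)
    have f2: "fmin\<^sup>2 = 4 * pi\<^sup>2 / (a + c)" using a_pos c_pos by (simp add: fmin_def)
    have "fmin\<^sup>2 / 4 * P \<le> fmin\<^sup>2 / 4 * (4 * ((of_int i)\<^sup>2 + (of_int j)\<^sup>2))"
      using int_pair_product_le(1)[OF False] by (intro mult_left_mono) (auto simp: n P_def)
    also have "\<dots> = fmin\<^sup>2 * ((fst (emb n))\<^sup>2 + (snd (emb n))\<^sup>2)" by (simp add: n emb_def)
    also have "\<dots> \<le> (freq (emb n))\<^sup>2" unfolding f2 by (rule freq_square_lower)
    finally have le: "fmin\<^sup>2 / 4 * P \<le> (freq (emb n))\<^sup>2" .
    \<comment> \<open>Each coordinate receives the exponent s / 2, which explains the threshold s >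
      2.\<close>
    have "freq (emb n) powr (- s) = ((freq (emb n))\<^sup>2) powr (- (s / 2))"
      using freq_pos[OF False] by (simp add: powr_powr flip: powr_numeral)
    also have "\<dots> \<le> (fmin\<^sup>2 / 4 * P) powr (- (s / 2))"
      using le P fmin_pos s by (intro powr_mono2') auto
    also have "\<dots> = K * P powr (- (s / 2))" unfolding K_def using P by (subst powr_mult) auto
    also have "P powr (- (s / 2)) = (1 + \<bar>of_int i\<bar>) powr (- (s / 2)) * (1 + \<bar>of_int j\<bar>) powr (- (s / 2))"
      unfolding P_def by (subst powr_mult) auto
    finally show ?thesis by (simp add: n)
  qed (auto simp: K_def split: prod.split intro!: mult_nonneg_nonneg)
qed auto

text \<open>Up to a scaling factor, the Epstein zeta function of \<open>Qadj\<close> at s /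
  2.\<close>

definition zsum :: "real \<Rightarrow> real" where
  "zsum s = (\<Sum>\<^sub>\<infinity>n. freq (emb n) powr (- s))"

lemma zsum_nonneg: "zsum s \<ge> 0"
  unfolding zsum_def by (intro infsum_nonneg) auto

text \<open>The factor at R takes the full decay 3/2, the factor at \<delta> only \<theta>. The
  resulting sum over the lattice converges for \<theta> > 1/2; below it is used with \<theta> =
  1.\<close>

lemma nbessel_pair_bound:
  assumes "n \<noteq> 0" "R > 0" "\<delta> > 0" "0 \<le> \<theta>" "\<theta> \<le> 3/2"
  shows "\<bar>nbessel (freq (emb n) * R) * nbessel (freq (emb n) * \<delta>)\<bar>
     \<le> 36 * R powr (-3/2) * \<delta> powr (- \<theta>) * freq (emb n) powr (- (3/2 + \<theta>))"
proof -
  define \<nu> where "\<nu> = freq (emb n)"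
  have \<nu>: "\<nu> > 0" using freq_pos[OF assms(1)] by (simp add: \<nu>_def)
  have "\<bar>nbessel (\<nu> * R)\<bar> * \<bar>nbessel (\<nu> * \<delta>)\<bar> \<le> (6 * (\<nu> * R) powr (- (3/2))) * (6 * (\<nu> * \<delta>) powr (- \<theta>))"
    using \<nu> assms by (intro mult_mono nbessel_decay) auto
  also have "\<dots> = 36 * R powr (-3/2) * \<delta> powr (- \<theta>) * (\<nu> powr (- (3/2)) * \<nu> powr (- \<theta>))"
    using \<nu> assms by (simp add: powr_mult)
  also have "\<nu> powr (- (3/2)) * \<nu> powr (- \<theta>) = \<nu> powr (- (3/2 + \<theta>))"
    by (simp flip: powr_add)
  finally show ?thesis by (simp add: abs_mult \<nu>_def)
qed

text \<open>The oscillating part of the Poisson sum, relative to the main term \<open>A R\<^sup>2\<close>.\<close>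
definition osc :: "real \<Rightarrow> real \<Rightarrow> real" where
  "osc R \<delta> = (\<Sum>\<^sub>\<infinity>n\<in>-{0}. nbessel (freq (emb n) * R) * nbessel (freq (emb n) * \<delta>))"

lemma nbessel_pair_summable:
  assumes "R > 0" "\<delta> > 0"
  shows "(\<lambda>n. nbessel (freq (emb n) * R) * nbessel (freq (emb n) * \<delta>)) summable_on -{0}"
proof -
  have "(\<lambda>n. 36 * R powr (-3/2) * \<delta> powr (- 1) * freq (emb n) powr (- (3/2 + 1))) summable_on -{0}"
    by (intro summable_on_cmult_right summable_on_subset[OF freq_powr_summable]) auto
  then have "(\<lambda>n. \<bar>nbessel (freq (emb n) * R) * nbessel (freq (emb n) * \<delta>)\<bar>) summable_on -{0}"
    by (rule summable_on_comparison_test) (use nbessel_pair_bound[OF _ assms, of _ 1] in auto)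
  then show ?thesis unfolding real_norm_def[symmetric] by (rule summable_on_iff_abs_summable_on_real[THEN iffD2])
qed

lemma abs_osc_le:
  assumes "R > 0" "\<delta> > 0"
  shows "\<bar>osc R \<delta>\<bar> \<le> 36 * zsum (5/2) * R powr (-3/2) * \<delta> powr (- 1)"
proof -
  define g where "g = (\<lambda>n. nbessel (freq (emb n) * R) * nbessel (freq (emb n) * \<delta>))"
  have s: "(\<lambda>n. freq (emb n) powr (- (5/2))) summable_on UNIV" by (rule freq_powr_summable) simp
  have gs: "(\<lambda>n. norm (g n)) summable_on -{0}"
    using summable_on_iff_abs_summable_on_real[THEN iffD1, OF nbessel_pair_summable[OF assms]] by (simp only: g_def)
  have "\<bar>osc R \<delta>\<bar> \<le> (\<Sum>\<^sub>\<infinity>n\<in>-{0}. norm (g n))"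
    using norm_infsum_bound[OF gs] by (simp add: osc_def g_def)
  also have "\<dots> \<le> (\<Sum>\<^sub>\<infinity>n\<in>-{0}. 36 * R powr (-3/2) * \<delta> powr (- 1) * freq (emb n) powr (- (5/2)))"
    using nbessel_pair_bound[OF _ assms, of _ 1]
    by (intro infsum_mono gs summable_on_cmult_right summable_on_subset[OF s]) (auto simp: g_def)
  also have "\<dots> = 36 * R powr (-3/2) * \<delta> powr (- 1) * (\<Sum>\<^sub>\<infinity>n\<in>-{0}. freq (emb n) powr (- (5/2)))"
    by (intro infsum_cmult_right summable_on_subset[OF s]) auto
  also have "(\<Sum>\<^sub>\<infinity>n\<in>-{0}. freq (emb n) powr (- (5/2))) \<le> zsum (5/2)"
    unfolding zsum_def by (intro infsum_mono2 s summable_on_subset[OF s]) auto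
  then have "36 * R powr (-3/2) * \<delta> powr (- 1) * (\<Sum>\<^sub>\<infinity>n\<in>-{0}. freq (emb n) powr (- (5/2)))
    \<le> 36 * R powr (-3/2) * \<delta> powr (- 1) * zsum (5/2)" by (intro mult_left_mono) auto
  finally show ?thesis by (simp add: mult_ac)
qed

lemma lattice_count_osc_bounds:
  assumes R: "R > 2 * \<delta>" and d: "\<delta> > 0"
  shows "A * R\<^sup>2 + A * R\<^sup>2 * osc R \<delta> \<le> real (card (L (R + 2 * \<delta>)))"
    "real (card (L (R - 2 * \<delta>))) \<le> A * R\<^sup>2 + A * R\<^sup>2 * osc R \<delta>"
proof -
  define g where "g = (\<lambda>n. nbessel (freq (emb n) * R) * nbessel (freq (emb n) * \<delta>))"
  have R0: "R > 0" using R d by linarith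
  have s: "g summable_on -{0}" using nbessel_pair_summable[OF R0 d] by (simp add: g_def)
  have U: "UNIV = insert 0 (-{0 :: int \<times> int})" by auto
  have sU: "g summable_on UNIV" unfolding U summable_on_insert_iff by (rule s)
  have "infsum g UNIV = 1 + osc R \<delta>"
    unfolding U using infsum_insert[OF s, of 0] by (simp add: g_def osc_def)
  with lattice_count_poisson_bounds[OF R d] sU
  show "A * R\<^sup>2 + A * R\<^sup>2 * osc R \<delta> \<le> real (card (L (R + 2 * \<delta>)))"
    "real (card (L (R - 2 * \<delta>))) \<le> A * R\<^sup>2 + A * R\<^sup>2 * osc R \<delta>"
    unfolding g_def[symmetric] by (simp_all add: g_def distrib_left)
qed

section \<open>The lattice point count with a power saving, and its dual form\<close>

lemma L_mono: assumes "0 \<le> R" "R \<le> S" shows "L R \<subseteq> L S"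
proof -
  have "R\<^sup>2 \<le> S\<^sup>2" using assms by (intro power_mono) auto
  then show ?thesis by (auto simp: L_def E_def)
qed

text \<open>The two costs of smoothing balance at \<delta> of order R^(-1/4): moving the radius by 2
  \<delta> changes the area by O(\<delta> R), and \<open>abs_osc_le\<close> bounds the oscillating
  part by O(R^(1/2) / \<delta>); both become O(R^(3/4)). Writing 1 + R makes the bound hold down to
  R = 0.\<close>

lemma lattice_count_asymptotic:
  obtains C where "C > 0" "\<And>R. R \<ge> 0 \<Longrightarrow> \<bar>real (card (L R)) - A * R\<^sup>2\<bar> \<le> C * (1 + R) powr (3/4)"
proof -
  define Z where "Z = zsum (5/2)"
  have Z: "Z \<ge> 0" by (simp add: Z_def zsum_nonneg)
  define C1 where "C1 = A + A * 36 * Z * 16"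
  have large: "\<bar>real (card (L R)) - A * R\<^sup>2\<bar> \<le> C1 * R powr (3/4)" if R: "R \<ge> 1" for R
  proof -
    define \<delta> where "\<delta> = R powr (-1/4) / 8"
    have d: "\<delta> > 0" using R by (simp add: \<delta>_def)
    have "R powr (-1/4) \<le> R powr 0" using R by (intro powr_mono) auto
    then have d8: "\<delta> \<le> 1/8" using R by (simp add: \<delta>_def)
    have dR: "\<delta> * R = R powr (3/4) / 8"
      using R by (simp add: \<delta>_def powr_mult_base[symmetric] flip: powr_add) (simp add: powr_mult_base mult.commute)
    have R34: "1 \<le> R powr (3/4)" using R by (simp add: ge_one_powr_ge_zero)
    have oscb: "\<bar>A * X\<^sup>2 * osc X \<delta>\<bar> \<le> A * 36 * Z * 16 * R powr (3/4)" if X: "X > 0" "X \<le> 2 * R" for X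
    proof -
      have "\<bar>A * X\<^sup>2 * osc X \<delta>\<bar> = A * X\<^sup>2 * \<bar>osc X \<delta>\<bar>" using A_pos by (simp add: abs_mult)
      also have "\<dots> \<le> A * X\<^sup>2 * (36 * Z * X powr (-3/2) * \<delta> powr (- 1))"
        unfolding Z_def using A_pos by (intro mult_left_mono abs_osc_le X d) auto
      also have "\<dots> = A * 36 * Z * (X\<^sup>2 * X powr (-3/2)) * (1 / \<delta>)" using d by (simp add: powr_minus_divide)
      also have "X\<^sup>2 * X powr (-3/2) = X powr (1/2)"
        using X by (simp flip: powr_numeral powr_add)
      also have "1 / \<delta> = 8 * R powr (1/4)" by (simp add: \<delta>_def powr_minus_divide)
      also have "A * 36 * Z * X powr (1/2) * (8 * R powr (1/4)) \<le> A * 36 * Z * (2 * R powr (1/2)) * (8 * R powr (1/4))"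
      proof (intro mult_right_mono mult_left_mono)
        have "X powr (1/2) \<le> (2 * R) powr (1/2)" using X by (intro powr_mono2) auto
        also have "\<dots> = 2 powr (1/2) * R powr (1/2)" using R by (intro powr_mult)
        also have "(2::real) powr (1/2) \<le> 2 powr 1" by (intro powr_mono) auto
        finally show "X powr (1/2) \<le> 2 * R powr (1/2)" by (simp add: mult_right_mono)
      qed (use A_pos Z in auto)
      also have "\<dots> = A * 36 * Z * 16 * (R powr (1/2) * R powr (1/4))" by simp
      also have "R powr (1/2) * R powr (1/4) = R powr (3/4)" by (simp flip: powr_add)
      finally show ?thesis .
    qed
    have dd: "\<delta> * \<delta> \<le> 1/8 * (1/8)" using d d8 by (intro mult_mono) auto
    \<comment> \<open>The sandwich controls counts at shifted radii, so it is applied at R + 2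
      \<delta> for the upper bound and at R - 2 \<delta> for the lower one.\<close>
    have "real (card (L (R + 2 * \<delta> - 2 * \<delta>))) \<le> A * (R + 2 * \<delta>)\<^sup>2 + A * (R + 2 * \<delta>)\<^sup>2 * osc (R + 2 * \<delta>) \<delta>"
      using R d by (intro lattice_count_osc_bounds) auto
    moreover have "\<bar>A * (R + 2 * \<delta>)\<^sup>2 * osc (R + 2 * \<delta>) \<delta>\<bar> \<le> A * 36 * Z * 16 * R powr (3/4)"
      using R d d8 by (intro oscb) auto
    moreover have "(R + 2 * \<delta>)\<^sup>2 \<le> R\<^sup>2 + R powr (3/4)"
    proof -
      have "(R + 2 * \<delta>)\<^sup>2 = R\<^sup>2 + 4 * (\<delta> * R) + 4 * (\<delta> * \<delta>)" by (simp add: power2_eq_square algebra_simps)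
      with dd R34 show ?thesis unfolding dR by linarith
    qed
    then have "A * (R + 2 * \<delta>)\<^sup>2 \<le> A * R\<^sup>2 + A * R powr (3/4)"
      using A_pos by (metis distrib_left less_imp_le mult_left_mono)
    ultimately have up: "real (card (L R)) - A * R\<^sup>2 \<le> C1 * R powr (3/4)"
      unfolding C1_def distrib_right by simp
    have "A * (R - 2 * \<delta>)\<^sup>2 + A * (R - 2 * \<delta>)\<^sup>2 * osc (R - 2 * \<delta>) \<delta> \<le> real (card (L (R - 2 * \<delta> + 2 * \<delta>)))"
      using R d d8 by (intro lattice_count_osc_bounds) auto
    moreover have "\<bar>A * (R - 2 * \<delta>)\<^sup>2 * osc (R - 2 * \<delta>) \<delta>\<bar> \<le> A * 36 * Z * 16 * R powr (3/4)"
      using R d d8 by (intro oscb) auto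
    moreover have "R\<^sup>2 - R powr (3/4) \<le> (R - 2 * \<delta>)\<^sup>2"
    proof -
      have "(R - 2 * \<delta>)\<^sup>2 = R\<^sup>2 - 4 * (\<delta> * R) + 4 * (\<delta> * \<delta>)" by (simp add: power2_eq_square algebra_simps)
      moreover have "0 \<le> \<delta> * \<delta>" by simp
      ultimately show ?thesis unfolding dR using R34 by linarith
    qed
    then have "A * R\<^sup>2 - A * R powr (3/4) \<le> A * (R - 2 * \<delta>)\<^sup>2"
      using A_pos by (metis right_diff_distrib less_imp_le mult_left_mono)
    ultimately have lo: "- (C1 * R powr (3/4)) \<le> real (card (L R)) - A * R\<^sup>2"
      unfolding C1_def distrib_right by simp
    from up lo show ?thesis by linarith
  qed
  define C where "C = C1 + A + real (card (L 1))"
  have C1: "C1 \<ge> 0" using A_pos Z by (simp add: C1_def)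
  have "C > 0" unfolding C_def using C1 A_pos by linarith
  moreover have "\<bar>real (card (L R)) - A * R\<^sup>2\<bar> \<le> C * (1 + R) powr (3/4)" if R: "R \<ge> 0" for R
  proof (cases "R \<ge> 1")
    case True
    have "\<bar>real (card (L R)) - A * R\<^sup>2\<bar> \<le> C1 * R powr (3/4)" by (rule large[OF True])
    also have "\<dots> \<le> C * (1 + R) powr (3/4)"
      using C1 A_pos R by (intro mult_mono powr_mono2) (auto simp: C_def)
    finally show ?thesis .
  next
    case False
    have "real (card (L R)) \<le> real (card (L 1))" using False R by (intro of_nat_mono card_mono finite_L L_mono) auto
    moreover have "A * R\<^sup>2 \<le> A * 1" using False R A_pos by (intro mult_left_mono) (auto simp: abs_square_le_1)
    moreover have "0 \<le> A * R\<^sup>2" using A_pos by simp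
    ultimately have "\<bar>real (card (L R)) - A * R\<^sup>2\<bar> \<le> C * 1" unfolding C_def using C1 by (simp add: abs_le_iff)
    also have "\<dots> \<le> C * (1 + R) powr (3/4)"
      using \<open>C > 0\<close> R by (intro mult_left_mono ge_one_powr_ge_zero) auto
    finally show ?thesis .
  qed
  ultimately show thesis using that by blast
qed

text \<open>Dual frequencies up to x belong to the lattice points of a dilated ellipse of the
  adjugate form, so the count above applies to them.\<close>

lemma freq_le_iff:
  assumes "x \<ge> 0"
  shows "freq (emb n) \<le> x \<longleftrightarrow> n \<in> pos_form.L c (- b) a (x * sqrt D / (4 * pi))"
proof -
  have "freq (emb n) \<le> x \<longleftrightarrow> (freq (emb n))\<^sup>2 \<le> x\<^sup>2"
    using assms freq_nonneg by (meson abs_le_square_iff abs_of_nonneg power2_le_imp_le power_mono)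
  also have "\<dots> \<longleftrightarrow> Qadj (emb n) \<le> (x * sqrt D / (4 * pi))\<^sup>2"
    unfolding freq_square using D_pos by (simp add: power_divide power_mult_distrib field_simps)
  also have "\<dots> \<longleftrightarrow> n \<in> pos_form.L c (- b) a (x * sqrt D / (4 * pi))"
    by (simp add: pos_form.L_def[OF adj] pos_form.E_def[OF adj] Qadj_conv)
  finally show ?thesis .
qed

lemma finite_freq_le: "finite {n. freq (emb n) \<le> x}"
proof (cases "x \<ge> 0")
  case True
  then show ?thesis using freq_le_iff pos_form.finite_L[OF adj] by simp
next
  case False
  then have "\<not> freq (emb n) \<le> x" for n using freq_nonneg[of "emb n"] by linarith
  then have "{n. freq (emb n) \<le> x} = {}" by blast
  then show ?thesis by (simp only: finite.emptyI)
qed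

text \<open>A difference of two counts for the adjugate form: the areas differ by O(\<nu> \<eta>),
  and the errors are O((1 + \<nu>)^(3/4)). Nothing about the spacing of the values of the form
  enters.\<close>

lemma freq_annulus_count:
  obtains C where "C > 0" 
    "\<And>\<nu> \<eta>. \<nu> \<ge> 0 \<Longrightarrow> 0 < \<eta> \<Longrightarrow> \<eta> \<le> 1 \<Longrightarrow> real (card {m. \<bar>freq (emb m) - \<nu>\<bar> \<le> \<eta>}) \<le> C * (\<nu> * \<eta> + (1 + \<nu>) powr (3/4))"
proof -
  interpret P: pos_form c "- b" a by (rule adj)
  define k where "k = sqrt D / (4 * pi)"
  have k: "k > 0" using D_pos by (simp add: k_def)
  obtain C0 where C0: "C0 > 0" "\<And>R. R \<ge> 0 \<Longrightarrow> \<bar>real (card (P.L R)) - P.A * R\<^sup>2\<bar> \<le> C0 * (1 + R) powr (3/4)"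
    using P.lattice_count_asymptotic by blast
  define C where "C = 6 * (P.A * k\<^sup>2) + 2 * C0 * (1 + k) powr (3/4) + real (card (P.L (3 * k)))"
  have Ak: "P.A * k\<^sup>2 > 0" using P.A_pos k by simp
  have C: "C > 0" unfolding C_def using Ak C0(1) by (intro add_pos_nonneg) auto
  have sc: "(1 + x * k) powr (3/4) \<le> (1 + k) powr (3/4) * (1 + \<nu>) powr (3/4)" if "0 \<le> x" "x \<le> \<nu> + 1" "0 \<le> \<nu>" for x \<nu>
  proof -
    have "x * k \<le> (\<nu> + 1) * k" using that k by (intro mult_right_mono) auto
    then have "1 + x * k \<le> (1 + k) * (1 + \<nu>)" using that k by (simp add: algebra_simps)
    then have "(1 + x * k) powr (3/4) \<le> ((1 + k) * (1 + \<nu>)) powr (3/4)" using that k by (intro powr_mono2) auto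
    then show ?thesis using that k by (simp add: powr_mult)
  qed
  have "real (card {m. \<bar>freq (emb m) - \<nu>\<bar> \<le> \<eta>}) \<le> C * (\<nu> * \<eta> + (1 + \<nu>) powr (3/4))"
    if \<nu>: "\<nu> \<ge> 0" and \<eta>: "0 < \<eta>" "\<eta> \<le> 1" for \<nu> \<eta>
  proof -
    have p1: "1 \<le> (1 + \<nu>) powr (3/4)" using \<nu> by (intro ge_one_powr_ge_zero) auto
    have conv: "freq (emb m) \<le> x \<longleftrightarrow> m \<in> P.L (x * k)" if "x \<ge> 0" for x m
      using freq_le_iff[OF that] by (simp add: k_def)
    show ?thesis
    proof (cases "\<nu> \<ge> 2 * \<eta>")
      case True
      \<comment> \<open>The annulus is closed, so a strictly smaller inner radius has to be
        subtracted; \<nu> - 2 \<eta> is one, and it only affects the constant.\<close>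
      have sub: "P.L ((\<nu> - 2 * \<eta>) * k) \<subseteq> P.L ((\<nu> + \<eta>) * k)"
        using True \<eta> k by (intro P.L_mono mult_right_mono mult_nonneg_nonneg) auto
      have "{m. \<bar>freq (emb m) - \<nu>\<bar> \<le> \<eta>} \<subseteq> P.L ((\<nu> + \<eta>) * k) - P.L ((\<nu> - 2 * \<eta>) * k)"
      proof
        fix m assume "m \<in> {m. \<bar>freq (emb m) - \<nu>\<bar> \<le> \<eta>}"
        then have "freq (emb m) \<le> \<nu> + \<eta>" "\<not> freq (emb m) \<le> \<nu> - 2 * \<eta>" using True \<eta> by auto
        then show "m \<in> P.L ((\<nu> + \<eta>) * k) - P.L ((\<nu> - 2 * \<eta>) * k)"
          using conv[of "\<nu> + \<eta>"] conv[of "\<nu> - 2 * \<eta>"] True \<eta> by auto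
      qed
      then have "card {m. \<bar>freq (emb m) - \<nu>\<bar> \<le> \<eta>} \<le> card (P.L ((\<nu> + \<eta>) * k) - P.L ((\<nu> - 2 * \<eta>) * k))"
        by (intro card_mono finite_Diff P.finite_L)
      also have "\<dots> = card (P.L ((\<nu> + \<eta>) * k)) - card (P.L ((\<nu> - 2 * \<eta>) * k))"
        by (intro card_Diff_subset sub P.finite_L)
      finally have "real (card {m. \<bar>freq (emb m) - \<nu>\<bar> \<le> \<eta>}) \<le> real (card (P.L ((\<nu> + \<eta>) * k))) - real (card (P.L ((\<nu> - 2 * \<eta>) * k)))"
        using card_mono[OF P.finite_L sub] by linarith
      moreover have "real (card (P.L ((\<nu> + \<eta>) * k))) \<le> P.A * ((\<nu> + \<eta>) * k)\<^sup>2 + C0 * (1 + (\<nu> + \<eta>) * k) powr (3/4)"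
        using C0(2)[of "(\<nu> + \<eta>) * k"] k \<nu> \<eta> by simp
      moreover have "real (card (P.L ((\<nu> - 2 * \<eta>) * k))) \<ge> P.A * ((\<nu> - 2 * \<eta>) * k)\<^sup>2 - C0 * (1 + (\<nu> - 2 * \<eta>) * k) powr (3/4)"
        using C0(2)[of "(\<nu> - 2 * \<eta>) * k"] k True by simp
      moreover have "C0 * (1 + (\<nu> + \<eta>) * k) powr (3/4) \<le> C0 * ((1 + k) powr (3/4) * (1 + \<nu>) powr (3/4))"
        using C0(1) \<nu> \<eta> by (intro mult_left_mono sc) auto
      moreover have "C0 * (1 + (\<nu> - 2 * \<eta>) * k) powr (3/4) \<le> C0 * ((1 + k) powr (3/4) * (1 + \<nu>) powr (3/4))"
        using C0(1) \<nu> \<eta> True by (intro mult_left_mono sc) auto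
      moreover have "P.A * ((\<nu> + \<eta>) * k)\<^sup>2 - P.A * ((\<nu> - 2 * \<eta>) * k)\<^sup>2 \<le> 6 * (P.A * k\<^sup>2) * (\<nu> * \<eta>)"
      proof -
        have "P.A * ((\<nu> + \<eta>) * k)\<^sup>2 - P.A * ((\<nu> - 2 * \<eta>) * k)\<^sup>2 = 6 * (P.A * k\<^sup>2) * (\<nu> * \<eta>) - 3 * (P.A * k\<^sup>2) * \<eta>\<^sup>2"
          by (simp add: power2_eq_square algebra_simps)
        moreover have "0 \<le> 3 * (P.A * k\<^sup>2) * \<eta>\<^sup>2" using Ak by simp
        ultimately show ?thesis by linarith
      qed
      ultimately have "real (card {m. \<bar>freq (emb m) - \<nu>\<bar> \<le> \<eta>}) \<le> 6 * (P.A * k\<^sup>2) * (\<nu> * \<eta>) + (2 * C0 * (1 + k) powr (3/4)) * (1 + \<nu>) powr (3/4)"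
        by linarith
      also have "\<dots> \<le> C * (\<nu> * \<eta>) + C * (1 + \<nu>) powr (3/4)"
        using Ak C0(1) \<nu> \<eta> by (intro add_mono mult_right_mono) (auto simp: C_def)
      finally show ?thesis by (simp add: distrib_left)
    next
      case False
      \<comment> \<open>Here \<nu> < 2 \<eta> and \<eta> <= 1, so all frequencies concerned are at
        most 3.\<close>
      have "{m. \<bar>freq (emb m) - \<nu>\<bar> \<le> \<eta>} \<subseteq> P.L (3 * k)"
      proof
        fix m assume "m \<in> {m. \<bar>freq (emb m) - \<nu>\<bar> \<le> \<eta>}"
        then have "freq (emb m) \<le> 3" using False \<eta> by auto
        then show "m \<in> P.L (3 * k)" using conv[of 3] by simp
      qed
      then have "real (card {m. \<bar>freq (emb m) - \<nu>\<bar> \<le> \<eta>}) \<le> real (card (P.L (3 * k)))"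
        by (simp add: card_mono P.finite_L)
      also have "\<dots> \<le> C" unfolding C_def using Ak C0(1) by (auto intro!: add_nonneg_nonneg)
      also have "\<dots> \<le> C * (\<nu> * \<eta> + (1 + \<nu>) powr (3/4))"
        using C p1 \<nu> \<eta> by (simp add: add_increasing)
      finally show ?thesis .
    qed
  qed
  with C that show thesis by blast
qed

end

section \<open>Mean values of trigonometric sums\<close>

text \<open>The real part of the characteristic function of the standard normal distribution,
  rotated by the phase \<psi>.\<close>

lemma has_bochner_integral_gaussian_cos:
  "has_bochner_integral lborel (\<lambda>x. std_normal_density x * cos (\<omega> * x + \<psi>)) (cos \<psi> * exp (- (\<omega>\<^sup>2) / 2))"
proof -
  define f where "f = (\<lambda>x. complex_of_real (std_normal_density x) * iexp (\<omega> * x))"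
  have i: "integrable lborel f"
  proof (rule Bochner_Integration.integrable_bound)
    show "integrable lborel (\<lambda>x. std_normal_density x)" by simp
    show "f \<in> borel_measurable lborel" unfolding f_def by measurable
    show "AE x in lborel. norm (f x) \<le> norm (std_normal_density x)"
      by (intro AE_I2) (simp add: f_def norm_mult)
  qed
  have "char std_normal_distribution \<omega> = (LBINT x. f x)"
    unfolding char_def f_def
    by (subst integral_density) (auto simp: scaleR_conv_of_real)
  then have v: "(LBINT x. f x) = complex_of_real (exp (- (\<omega>\<^sup>2) / 2))"
    by (simp add: char_std_normal_distribution)
  have "has_bochner_integral lborel (\<lambda>x. Re (cis \<psi> * f x)) (Re (cis \<psi> * complex_of_real (exp (- (\<omega>\<^sup>2) / 2))))"
    using i v by (intro has_bochner_integral_Re has_bochner_integral_mult_right) (auto simp: has_bochner_integral_iff)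
  moreover have "Re (cis \<psi> * f x) = std_normal_density x * cos (\<omega> * x + \<psi>)" for x
    unfolding f_def cis_conv_exp[symmetric] by (simp add: cos_add algebra_simps)
  ultimately show ?thesis by simp
qed

text \<open>Product-to-sum leaves Gaussian factors at the differences and at the sums of
  frequencies. All frequencies being positive, a sum is at least the difference in absolute value,
  so its factor is no larger, and the phases can be bounded away.\<close>

lemma gaussian_mean_square_cos_sum:
  fixes c \<nu> \<phi> :: "'a \<Rightarrow> real"
  assumes B: "finite B" and \<nu>: "\<And>n. n \<in> B \<Longrightarrow> \<nu> n > 0"
  shows "integrable lborel (\<lambda>x. std_normal_density x * (\<Sum>n\<in>B. c n * cos (\<nu> n * (T * x) + \<phi> n))\<^sup>2)" (is ?i)
    "(LBINT x. std_normal_density x * (\<Sum>n\<in>B. c n * cos (\<nu> n * (T * x) + \<phi> n))\<^sup>2)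
      \<le> (\<Sum>n\<in>B. \<Sum>m\<in>B. \<bar>c n\<bar> * \<bar>c m\<bar> * exp (- (T\<^sup>2 * (\<nu> n - \<nu> m)\<^sup>2) / 2))" (is ?le)
proof -
  define I where "I = (\<lambda>n m. cos (\<phi> n - \<phi> m) * exp (- (((\<nu> n - \<nu> m) * T)\<^sup>2) / 2) + cos (\<phi> n + \<phi> m) * exp (- (((\<nu> n + \<nu> m) * T)\<^sup>2) / 2))"
  have e: "std_normal_density x * (\<Sum>n\<in>B. c n * cos (\<nu> n * (T * x) + \<phi> n))\<^sup>2
    = (\<Sum>n\<in>B. \<Sum>m\<in>B. (c n * c m / 2) * (std_normal_density x * cos (((\<nu> n - \<nu> m) * T) * x + (\<phi> n - \<phi> m))
         + std_normal_density x * cos (((\<nu> n + \<nu> m) * T) * x + (\<phi> n + \<phi> m))))" for x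
  proof -
    have "cos (\<nu> n * (T * x) + \<phi> n) * cos (\<nu> m * (T * x) + \<phi> m) =
       (cos (((\<nu> n - \<nu> m) * T) * x + (\<phi> n - \<phi> m)) + cos (((\<nu> n + \<nu> m) * T) * x + (\<phi> n + \<phi> m))) / 2" for n m
    proof -
      have a: "\<nu> n * (T * x) + \<phi> n - (\<nu> m * (T * x) + \<phi> m) = ((\<nu> n - \<nu> m) * T) * x + (\<phi> n - \<phi> m)"
        "\<nu> n * (T * x) + \<phi> n + (\<nu> m * (T * x) + \<phi> m) = ((\<nu> n + \<nu> m) * T) * x + (\<phi> n + \<phi> m)"
        by (simp_all add: algebra_simps)
      show ?thesis unfolding cos_times_cos a ..
    qed
    moreover have "c n * p * (c m * q) = (c n * c m / 2) * r" if "p * q = r / 2" for n m p q r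
    proof -
      have "c n * p * (c m * q) = (c n * c m) * (p * q)" by (simp only: mult_ac)
      then show ?thesis unfolding that by simp
    qed
    ultimately have "c n * cos (\<nu> n * (T * x) + \<phi> n) * (c m * cos (\<nu> m * (T * x) + \<phi> m)) = (c n * c m / 2) * 
       (cos (((\<nu> n - \<nu> m) * T) * x + (\<phi> n - \<phi> m)) + cos (((\<nu> n + \<nu> m) * T) * x + (\<phi> n + \<phi> m)))" for n m
      by blast
    then show ?thesis
      unfolding power2_eq_square sum_product unfolding sum_distrib_left by (intro sum.cong refl) (simp only: distrib_left mult.left_commute)
  qed
  have h: "has_bochner_integral lborel (\<lambda>x. std_normal_density x * (\<Sum>n\<in>B. c n * cos (\<nu> n * (T * x) + \<phi> n))\<^sup>2)
     (\<Sum>n\<in>B. \<Sum>m\<in>B. (c n * c m / 2) * I n m)"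
    unfolding e I_def
    by (intro has_bochner_integral_sum has_bochner_integral_mult_right has_bochner_integral_add has_bochner_integral_gaussian_cos)
  then show ?i by (rule integrable.intros)
  have "(LBINT x. std_normal_density x * (\<Sum>n\<in>B. c n * cos (\<nu> n * (T * x) + \<phi> n))\<^sup>2) = (\<Sum>n\<in>B. \<Sum>m\<in>B. (c n * c m / 2) * I n m)"
    by (rule has_bochner_integral_integral_eq[OF h])
  also have "\<dots> \<le> (\<Sum>n\<in>B. \<Sum>m\<in>B. \<bar>c n\<bar> * \<bar>c m\<bar> * exp (- (T\<^sup>2 * (\<nu> n - \<nu> m)\<^sup>2) / 2))"
  proof (intro sum_mono)
    fix n m assume nm: "n \<in> B" "m \<in> B"
    define X where "X = exp (- (T\<^sup>2 * (\<nu> n - \<nu> m)\<^sup>2) / 2)"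
    have X: "exp (- (((\<nu> n - \<nu> m) * T)\<^sup>2) / 2) = X" by (simp add: X_def power_mult_distrib mult.commute)
    have "\<bar>\<nu> n - \<nu> m\<bar> \<le> \<bar>\<nu> n + \<nu> m\<bar>" using \<nu>[OF nm(1)] \<nu>[OF nm(2)] by simp
    then have "(\<nu> n - \<nu> m)\<^sup>2 * T\<^sup>2 \<le> (\<nu> n + \<nu> m)\<^sup>2 * T\<^sup>2" by (intro mult_right_mono) (auto simp: abs_le_square_iff)
    then have Y: "exp (- (((\<nu> n + \<nu> m) * T)\<^sup>2) / 2) \<le> X" by (simp add: X_def power_mult_distrib mult.commute)
    have 1: "\<bar>cos (\<phi> n - \<phi> m) * exp (- (((\<nu> n - \<nu> m) * T)\<^sup>2) / 2)\<bar> \<le> 1 * X"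
      unfolding abs_mult X by (intro mult_mono) (auto simp: X_def)
    have 2: "\<bar>cos (\<phi> n + \<phi> m) * exp (- (((\<nu> n + \<nu> m) * T)\<^sup>2) / 2)\<bar> \<le> 1 * X"
      unfolding abs_mult using Y by (intro mult_mono) auto
    have "\<bar>I n m\<bar> \<le> 2 * X" unfolding I_def using 1 2 by linarith
    have "(c n * c m / 2) * I n m \<le> \<bar>(c n * c m / 2) * I n m\<bar>" by simp
    also have "\<dots> = \<bar>c n\<bar> * \<bar>c m\<bar> / 2 * \<bar>I n m\<bar>" by (simp add: abs_mult)
    also have "\<dots> \<le> \<bar>c n\<bar> * \<bar>c m\<bar> / 2 * (2 * X)" using \<open>\<bar>I n m\<bar> \<le> 2 * X\<close> by (intro mult_left_mono) auto
    finally show "(c n * c m / 2) * I n m \<le> \<bar>c n\<bar> * \<bar>c m\<bar> * X" by simp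
  qed
  finally show ?le .
qed

text \<open>The constant 5 works because the density at t / T is at least 1/5 on the interval, as
  exp (-1/2) >= 3/5 and sqrt (2 pi) <= 3. A Gaussian replaces the sharp cutoff since its transform
  is positive and decays fast.\<close>

lemma mean_square_cos_sum_le_gaussian:
  fixes c \<nu> \<phi> :: "'a \<Rightarrow> real"
  assumes B: "finite B" and \<nu>: "\<And>n. n \<in> B \<Longrightarrow> \<nu> n > 0" and T: "T \<ge> 1"
  shows "(LBINT t:{1..T}. (\<Sum>n\<in>B. c n * cos (\<nu> n * t + \<phi> n))\<^sup>2)
      \<le> 5 * T * (\<Sum>n\<in>B. \<Sum>m\<in>B. \<bar>c n\<bar> * \<bar>c m\<bar> * exp (- (T\<^sup>2 * (\<nu> n - \<nu> m)\<^sup>2) / 2))"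
proof -
  define f where "f = (\<lambda>t. (\<Sum>n\<in>B. c n * cos (\<nu> n * t + \<phi> n))\<^sup>2)"
  note G = gaussian_mean_square_cos_sum[where c = c and \<phi> = \<phi> and T = T, OF B \<nu>]
  have f0: "f t \<ge> 0" for t by (simp add: f_def)
  have i1: "set_integrable lborel {1..T} f"
    unfolding f_def by (intro borel_integrable_atLeastAtMost' continuous_intros)
  have i2: "integrable lborel (\<lambda>t. std_normal_density (0 + 1 / T * t) * f t)"
    using G(1) lborel_integrable_real_affine[of "\<lambda>x. std_normal_density x * f (T * x)" "1 / T" 0] T by (simp add: f_def)
  have dens: "1 \<le> 5 * std_normal_density x" if "0 \<le> x" "x \<le> 1" for x :: real
  proof -
    have "x\<^sup>2 \<le> 1" using that by (simp add: abs_square_le_1)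
    then have "exp (- 1 / 2) \<le> exp (- x\<^sup>2 / 2)" by simp
    moreover have "(3/5 :: real) \<le> exp (- 1 / 2)"
    proof (rule power2_le_imp_le)
      have "(exp (- 1 / 2 :: real))\<^sup>2 = exp (- 1)" by (simp add: exp_double[symmetric])
      moreover have "exp 1 < (272/100::real)" using e_less_272 by simp
      then have "exp (- 1 :: real) \<ge> 100/272" by (simp add: exp_minus field_simps)
      ultimately show "(3/5)\<^sup>2 \<le> (exp (- 1 / 2 :: real))\<^sup>2" by (simp add: power2_eq_square)
    qed simp
    moreover have "sqrt (2 * pi) \<le> 3" 
    proof (rule real_le_lsqrt)
      show "2 * pi \<le> 3\<^sup>2" using pi_less_4 by simp
    qed auto
    then have "1 / 3 \<le> 1 / sqrt (2 * pi)" by (intro divide_left_mono) auto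
    ultimately have "5 * ((1 / 3) * (3/5)) \<le> 5 * (1 / sqrt (2 * pi) * exp (- x\<^sup>2 / 2))"
      by (intro mult_left_mono mult_mono) (linarith | simp)+
    then show ?thesis by (simp add: std_normal_density_def)
  qed
  have "(LBINT t:{1..T}. f t) \<le> (LBINT t. 5 * (std_normal_density (0 + 1 / T * t) * f t))"
    unfolding set_lebesgue_integral_def
  proof (rule integral_mono)
    show "integrable lborel (\<lambda>t. indicator {1..T} t *\<^sub>R f t)" using i1 by (simp add: set_integrable_def)
    show "integrable lborel (\<lambda>t. 5 * (std_normal_density (0 + 1 / T * t) * f t))" using i2 by (rule integrable_mult_right)
    fix t
    show "indicator {1..T} t *\<^sub>R f t \<le> 5 * (std_normal_density (0 + 1 / T * t) * f t)"
    proof (cases "t \<in> {1..T}")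
      case True
      then have "1 \<le> 5 * std_normal_density (1 / T * t)" using T by (intro dens) auto
      then have "1 * f t \<le> 5 * std_normal_density (1 / T * t) * f t" using f0 by (intro mult_right_mono)
      then show ?thesis using True by simp
    qed (use f0 in auto)
  qed
  also have "\<dots> = 5 * (LBINT t. std_normal_density (0 + 1 / T * t) * f t)" by simp
  also have "(LBINT t. std_normal_density (0 + 1 / T * t) * f t) = \<bar>T\<bar> *\<^sub>R (LBINT x. std_normal_density (0 + 1 / T * (0 + T * x)) * f (0 + T * x))"
    by (rule lborel_integral_real_affine) (use T in simp)
  also have "\<dots> = T * (LBINT x. std_normal_density x * f (T * x))" using T by simp
  also have "5 * (T * (LBINT x. std_normal_density x * f (T * x))) \<le>
      5 * (T * (\<Sum>n\<in>B. \<Sum>m\<in>B. \<bar>c n\<bar> * \<bar>c m\<bar> * exp (- (T\<^sup>2 * (\<nu> n - \<nu> m)\<^sup>2) / 2)))"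
    unfolding f_def using T by (intro mult_left_mono G(2)) auto
  finally show ?thesis by (simp add: f_def)
qed

text \<open>Pairs of frequencies further apart than \<open>\<eta>\<close> are damped by the Gaussian; the others are counted by \<open>N\<close> after
  an application of the AM-GM inequality.\<close>
lemma mean_square_cos_sum:
  fixes c \<nu> \<phi> N :: "'a \<Rightarrow> real"
  assumes B: "finite B" and \<nu>: "\<And>n. n \<in> B \<Longrightarrow> \<nu> n > 0" and T: "T \<ge> 1" and \<eta>: "\<eta> \<ge> 0"
    and N: "\<And>n. n \<in> B \<Longrightarrow> real (card {m \<in> B. \<bar>\<nu> m - \<nu> n\<bar> \<le> \<eta>}) \<le> N n"
  shows "(LBINT t:{1..T}. (\<Sum>n\<in>B. c n * cos (\<nu> n * t + \<phi> n))\<^sup>2)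
      \<le> 5 * T * ((\<Sum>n\<in>B. (c n)\<^sup>2 * N n) + exp (- (T\<^sup>2 * \<eta>\<^sup>2) / 2) * (\<Sum>n\<in>B. \<bar>c n\<bar>)\<^sup>2)"
proof -
  define X where "X = exp (- (T\<^sup>2 * \<eta>\<^sup>2) / 2)"
  \<comment> \<open>Indicator of a close pair. Its symmetry makes the two halves produced by AM-GM
    equal, so their sum counts, for each n, all its close partners.\<close>
  define J where "J = (\<lambda>n m. of_bool (\<bar>\<nu> m - \<nu> n\<bar> \<le> \<eta>) :: real)"
  have Jsym: "J n m = J m n" for n m by (simp add: J_def abs_minus_commute)
  have cardJ: "(\<Sum>m\<in>B. J n m) = real (card {m \<in> B. \<bar>\<nu> m - \<nu> n\<bar> \<le> \<eta>})" for n
    using B by (simp add: J_def of_bool_def flip: sum.inter_filter)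
  have "(\<Sum>n\<in>B. \<Sum>m\<in>B. \<bar>c n\<bar> * \<bar>c m\<bar> * exp (- (T\<^sup>2 * (\<nu> n - \<nu> m)\<^sup>2) / 2))
    \<le> (\<Sum>n\<in>B. \<Sum>m\<in>B. ((c n)\<^sup>2 / 2 * J n m + (c m)\<^sup>2 / 2 * J m n) + X * (\<bar>c n\<bar> * \<bar>c m\<bar>))"
  proof (intro sum_mono)
    fix n m
    have cc: "\<bar>c n\<bar> * \<bar>c m\<bar> \<le> (c n)\<^sup>2 / 2 + (c m)\<^sup>2 / 2"
      using sum_squares_bound[of "\<bar>c n\<bar>" "\<bar>c m\<bar>"] by simp
    have X0: "X * (\<bar>c n\<bar> * \<bar>c m\<bar>) \<ge> 0" by (simp add: X_def)
    show "\<bar>c n\<bar> * \<bar>c m\<bar> * exp (- (T\<^sup>2 * (\<nu> n - \<nu> m)\<^sup>2) / 2) \<le> ((c n)\<^sup>2 / 2 * J n m + (c m)\<^sup>2 / 2 * J m n) + X * (\<bar>c n\<bar> * \<bar>c m\<bar>)"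
    proof (cases "\<bar>\<nu> m - \<nu> n\<bar> \<le> \<eta>")
      case True
      have "\<bar>c n\<bar> * \<bar>c m\<bar> * exp (- (T\<^sup>2 * (\<nu> n - \<nu> m)\<^sup>2) / 2) \<le> \<bar>c n\<bar> * \<bar>c m\<bar> * 1"
        by (intro mult_left_mono) auto
      with cc X0 True show ?thesis unfolding Jsym[of m n] by (simp add: J_def)
    next
      case False
      then have "\<eta>\<^sup>2 \<le> (\<nu> n - \<nu> m)\<^sup>2" using \<eta> abs_le_square_iff[of \<eta> "\<nu> n - \<nu> m"] by (simp add: abs_minus_commute)
      then have "exp (- (T\<^sup>2 * (\<nu> n - \<nu> m)\<^sup>2) / 2) \<le> X" by (simp add: X_def mult_left_mono)
      then have "\<bar>c n\<bar> * \<bar>c m\<bar> * exp (- (T\<^sup>2 * (\<nu> n - \<nu> m)\<^sup>2) / 2) \<le> \<bar>c n\<bar> * \<bar>c m\<bar> * X" by (intro mult_left_mono) auto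
      moreover have "0 \<le> (c n)\<^sup>2 / 2 * J n m + (c m)\<^sup>2 / 2 * J m n" by (simp add: J_def)
      ultimately show ?thesis by (simp add: mult.commute)
    qed
  qed
  also have "\<dots> = (\<Sum>n\<in>B. \<Sum>m\<in>B. (c n)\<^sup>2 / 2 * J n m) + (\<Sum>n\<in>B. \<Sum>m\<in>B. (c m)\<^sup>2 / 2 * J m n) + X * (\<Sum>n\<in>B. \<bar>c n\<bar>)\<^sup>2"
  proof -
    have "(\<Sum>n\<in>B. \<Sum>m\<in>B. X * (\<bar>c n\<bar> * \<bar>c m\<bar>)) = X * (\<Sum>n\<in>B. \<bar>c n\<bar>)\<^sup>2"
      unfolding power2_eq_square sum_product unfolding sum_distrib_left ..
    then show ?thesis by (simp add: sum.distrib)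
  qed
  finally have 1: "(\<Sum>n\<in>B. \<Sum>m\<in>B. \<bar>c n\<bar> * \<bar>c m\<bar> * exp (- (T\<^sup>2 * (\<nu> n - \<nu> m)\<^sup>2) / 2))
    \<le> (\<Sum>n\<in>B. \<Sum>m\<in>B. (c n)\<^sup>2 / 2 * J n m) + (\<Sum>n\<in>B. \<Sum>m\<in>B. (c m)\<^sup>2 / 2 * J m n) + X * (\<Sum>n\<in>B. \<bar>c n\<bar>)\<^sup>2" .
  have 2: "(\<Sum>n\<in>B. \<Sum>m\<in>B. (c m)\<^sup>2 / 2 * J m n) = (\<Sum>n\<in>B. \<Sum>m\<in>B. (c n)\<^sup>2 / 2 * J n m)" by (rule sum.swap)
  have "(\<Sum>n\<in>B. \<Sum>m\<in>B. (c n)\<^sup>2 / 2 * J n m) = (\<Sum>n\<in>B. (c n)\<^sup>2 / 2 * real (card {m \<in> B. \<bar>\<nu> m - \<nu> n\<bar> \<le> \<eta>}))"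
    unfolding cardJ[symmetric] sum_distrib_left ..
  also have "\<dots> \<le> (\<Sum>n\<in>B. (c n)\<^sup>2 / 2 * N n)" by (intro sum_mono mult_left_mono N) auto
  finally have 3: "(\<Sum>n\<in>B. \<Sum>m\<in>B. (c n)\<^sup>2 / 2 * J n m) \<le> (\<Sum>n\<in>B. (c n)\<^sup>2 / 2 * N n)" .
  have 4: "(\<Sum>n\<in>B. (c n)\<^sup>2 / 2 * N n) + (\<Sum>n\<in>B. (c n)\<^sup>2 / 2 * N n) = (\<Sum>n\<in>B. (c n)\<^sup>2 * N n)"
    unfolding sum.distrib[symmetric] by (intro sum.cong refl) simp
  have le: "(\<Sum>n\<in>B. \<Sum>m\<in>B. \<bar>c n\<bar> * \<bar>c m\<bar> * exp (- (T\<^sup>2 * (\<nu> n - \<nu> m)\<^sup>2) / 2))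
    \<le> (\<Sum>n\<in>B. (c n)\<^sup>2 * N n) + X * (\<Sum>n\<in>B. \<bar>c n\<bar>)\<^sup>2"
    using 1 3 unfolding 2 4[symmetric] by linarith
  have "(LBINT t:{1..T}. (\<Sum>n\<in>B. c n * cos (\<nu> n * t + \<phi> n))\<^sup>2)
      \<le> 5 * T * (\<Sum>n\<in>B. \<Sum>m\<in>B. \<bar>c n\<bar> * \<bar>c m\<bar> * exp (- (T\<^sup>2 * (\<nu> n - \<nu> m)\<^sup>2) / 2))"
    by (rule mean_square_cos_sum_le_gaussian[OF B \<nu> T])
  also have "\<dots> \<le> 5 * T * ((\<Sum>n\<in>B. (c n)\<^sup>2 * N n) + X * (\<Sum>n\<in>B. \<bar>c n\<bar>)\<^sup>2)"
    using T by (intro mult_left_mono le) auto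
  finally show ?thesis by (simp add: X_def)
qed

section \<open>Means of cosines and of their products\<close>

lemma mean_cos:
  fixes \<omega> \<psi> :: real
  shows "((\<lambda>T. 1 / T * (LBINT t:{1..T}. cos (\<omega> * t + \<psi>))) \<longlongrightarrow> (if \<omega> = 0 then cos \<psi> else 0)) at_top"
proof (cases "\<omega> = 0")
  case True
  have "(LBINT t:{1..T}. cos (\<omega> * t + \<psi>)) = (T - 1) * cos \<psi>" if "T \<ge> 1" for T
    using that True by (simp add: set_lebesgue_integral_def)
  then have "\<forall>\<^sub>F T in at_top. 1 / T * ((T - 1) * cos \<psi>) = 1 / T * (LBINT t:{1..T}. cos (\<omega> * t + \<psi>))"
    by (intro eventually_mono[OF eventually_ge_at_top[of 1]]) simp
  moreover have "((\<lambda>T. 1 / T * ((T - 1) * cos \<psi>)) \<longlongrightarrow> cos \<psi>) at_top" by real_asymp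
  ultimately show ?thesis using True by (simp add: Lim_transform_eventually)
next
  case False
  have v: "\<bar>LBINT t:{1..T}. cos (\<omega> * t + \<psi>)\<bar> \<le> 2 / \<bar>\<omega>\<bar>" if T: "T \<ge> 1" for T
  proof -
    have "((\<lambda>t. cos (\<omega> * t + \<psi>)) has_integral (sin (\<omega> * T + \<psi>) / \<omega> - sin (\<omega> * 1 + \<psi>) / \<omega>)) {1..T}"
      using False T by (intro fundamental_theorem_of_calculus[where f = "\<lambda>t. sin (\<omega> * t + \<psi>) / \<omega>"])
       (auto simp: has_real_derivative_iff_has_vector_derivative[symmetric] intro!: derivative_eq_intros)
    moreover have "set_integrable lborel {1..T} (\<lambda>t. cos (\<omega> * t + \<psi>))"
      by (intro borel_integrable_atLeastAtMost' continuous_intros)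
    ultimately have "(LBINT t:{1..T}. cos (\<omega> * t + \<psi>)) = (sin (\<omega> * T + \<psi>) - sin (\<omega> * 1 + \<psi>)) / \<omega>"
      using set_borel_integral_eq_integral(2) by (metis diff_divide_distrib integral_unique)
    moreover have "\<bar>sin (\<omega> * T + \<psi>) - sin (\<omega> * 1 + \<psi>)\<bar> \<le> 2"
      using abs_sin_le_one[of "\<omega> * T + \<psi>"] abs_sin_le_one[of "\<omega> * 1 + \<psi>"] by linarith
    ultimately show ?thesis by (simp add: abs_divide divide_right_mono)
  qed
  have "((\<lambda>T. 1 / T * (LBINT t:{1..T}. cos (\<omega> * t + \<psi>))) \<longlongrightarrow> 0) at_top"
  proof (rule Lim_null_comparison)
    show "\<forall>\<^sub>F T in at_top. norm (1 / T * (LBINT t:{1..T}. cos (\<omega> * t + \<psi>))) \<le> 1 / T * (2 / \<bar>\<omega>\<bar>)"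
    proof (rule eventually_mono[OF eventually_ge_at_top[of 1]])
      fix T :: real assume T: "1 \<le> T"
      have "\<bar>1 / T\<bar> * \<bar>LBINT t:{1..T}. cos (\<omega> * t + \<psi>)\<bar> \<le> 1 / T * (2 / \<bar>\<omega>\<bar>)"
        using v[OF T] T by (intro mult_mono) auto
      then show "norm (1 / T * (LBINT t:{1..T}. cos (\<omega> * t + \<psi>))) \<le> 1 / T * (2 / \<bar>\<omega>\<bar>)" by (simp only: real_norm_def abs_mult)
    qed
    show "((\<lambda>T. 1 / T * (2 / \<bar>\<omega>\<bar>)) \<longlongrightarrow> 0) at_top" by real_asymp
  qed
  then show ?thesis using False by simp
qed

text \<open>In the product-to-sum formula the common phase \<psi> cancels at the difference
  frequency and survives only at \<alpha> + \<beta>, which is positive and therefore has mean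
  0.\<close>

lemma mean_cos_product:
  fixes \<alpha> \<beta> \<psi> :: real
  assumes "\<alpha> > 0" "\<beta> > 0"
  shows "((\<lambda>T. 1 / T * (LBINT t:{1..T}. cos (\<alpha> * t + \<psi>) * cos (\<beta> * t + \<psi>))) \<longlongrightarrow> (if \<alpha> = \<beta> then 1/2 else 0)) at_top"
proof -
  have pr: "cos (\<alpha> * t + \<psi>) * cos (\<beta> * t + \<psi>) = 1/2 * cos ((\<alpha> - \<beta>) * t + 0) + 1/2 * cos ((\<alpha> + \<beta>) * t + 2 * \<psi>)" for t
    unfolding cos_times_cos by (simp add: algebra_simps)
  have si: "set_integrable lborel {1..T} (\<lambda>t. 1/2 * cos (\<omega> * t + \<phi>))" for T \<omega> \<phi> :: real
    by (intro borel_integrable_atLeastAtMost' continuous_intros)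
  have e: "1 / T * (LBINT t:{1..T}. cos (\<alpha> * t + \<psi>) * cos (\<beta> * t + \<psi>)) =
     1/2 * (1 / T * (LBINT t:{1..T}. cos ((\<alpha> - \<beta>) * t + 0))) + 1/2 * (1 / T * (LBINT t:{1..T}. cos ((\<alpha> + \<beta>) * t + 2 * \<psi>)))" for T
    unfolding pr set_integral_add(2)[OF si si] set_integral_mult_right by (simp only: distrib_left mult_ac)
  have "((\<lambda>T. 1 / T * (LBINT t:{1..T}. cos (\<alpha> * t + \<psi>) * cos (\<beta> * t + \<psi>))) \<longlongrightarrow>
    1/2 * (if \<alpha> - \<beta> = 0 then cos 0 else 0) + 1/2 * (if \<alpha> + \<beta> = 0 then cos (2 * \<psi>) else 0)) at_top"
    unfolding e by (intro tendsto_intros mean_cos)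
  then show ?thesis using assms by (auto split: if_splits)
qed

section \<open>Mean-square approximation of the error term\<close>

text \<open>A class closed under sums and products that guarantees integrability on bounded
  intervals. Measurability is asked of the function cut off to S, so its values elsewhere are
  irrelevant.\<close>

definition bdd_meas_on :: "real set \<Rightarrow> (real \<Rightarrow> real) \<Rightarrow> bool" where
  "bdd_meas_on S f \<longleftrightarrow> (\<lambda>t. indicator S t * f t) \<in> borel_measurable borel \<and> (\<exists>B. \<forall>t\<in>S. \<bar>f t\<bar> \<le> B)"

lemma bdd_meas_onI:
  assumes "(\<lambda>t. indicator S t * f t) \<in> borel_measurable borel" "\<And>t. t \<in> S \<Longrightarrow> \<bar>f t\<bar> \<le> B"
  shows "bdd_meas_on S f"
  using assms unfolding bdd_meas_on_def by blast

lemma bdd_meas_onE: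
  assumes "bdd_meas_on S f"
  obtains B where "(\<lambda>t. indicator S t * f t) \<in> borel_measurable borel" "\<And>t. t \<in> S \<Longrightarrow> \<bar>f t\<bar> \<le> B"
  using assms unfolding bdd_meas_on_def by blast

lemma bdd_meas_on_add:
  assumes "bdd_meas_on S f" "bdd_meas_on S g" shows "bdd_meas_on S (\<lambda>t. f t + g t)"
proof -
  from assms(1) obtain B where B: "(\<lambda>t. indicator S t * f t) \<in> borel_measurable borel" "\<And>t. t \<in> S \<Longrightarrow> \<bar>f t\<bar> \<le> B"
    by (rule bdd_meas_onE) blast
  from assms(2) obtain C where C: "(\<lambda>t. indicator S t * g t) \<in> borel_measurable borel" "\<And>t. t \<in> S \<Longrightarrow> \<bar>g t\<bar> \<le> C"
    by (rule bdd_meas_onE) blast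
  show ?thesis
  proof (rule bdd_meas_onI)
    show "(\<lambda>t. indicator S t * (f t + g t)) \<in> borel_measurable borel"
      using borel_measurable_add[OF B(1) C(1)] by (simp only: distrib_left)
    show "\<bar>f t + g t\<bar> \<le> B + C" if "t \<in> S" for t using B(2)[OF that] C(2)[OF that] by linarith
  qed
qed

lemma bdd_meas_on_mult:
  assumes "bdd_meas_on S f" "bdd_meas_on S g" shows "bdd_meas_on S (\<lambda>t. f t * g t)"
proof -
  from assms(1) obtain B where B: "(\<lambda>t. indicator S t * f t) \<in> borel_measurable borel" "\<And>t. t \<in> S \<Longrightarrow> \<bar>f t\<bar> \<le> B"
    by (rule bdd_meas_onE) blast
  from assms(2) obtain C where C: "(\<lambda>t. indicator S t * g t) \<in> borel_measurable borel" "\<And>t. t \<in> S \<Longrightarrow> \<bar>g t\<bar> \<le> C"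
    by (rule bdd_meas_onE) blast
  show ?thesis
  proof (rule bdd_meas_onI)
    have e: "(indicator S t * f t) * (indicator S t * g t) = indicator S t * (f t * g t)" for t
      by (cases "t \<in> S") auto
    show "(\<lambda>t. indicator S t * (f t * g t)) \<in> borel_measurable borel"
      using borel_measurable_times[OF B(1) C(1)] by (simp only: e)
    show "\<bar>f t * g t\<bar> \<le> B * C" if "t \<in> S" for t
      unfolding abs_mult using B(2)[OF that] C(2)[OF that] by (intro mult_mono) auto
  qed
qed

lemma bdd_meas_on_continuous:
  assumes "continuous_on {x..y} f" shows "bdd_meas_on {x..y} f"
proof -
  have "bounded (f ` {x..y})" using assms by (intro compact_imp_bounded compact_continuous_image) auto
  then obtain B where B: "\<forall>z\<in>f ` {x..y}. norm z \<le> B" unfolding bounded_iff by blast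
  have "(\<lambda>t. indicator {x..y} t *\<^sub>R f t) \<in> borel_measurable borel"
    by (rule borel_measurable_continuous_on_indicator[OF _ assms]) simp
  then show ?thesis using B by (intro bdd_meas_onI[of _ _ B]) auto
qed

lemma bdd_meas_on_diff:
  assumes "bdd_meas_on {x..y} f" "bdd_meas_on {x..y} g" shows "bdd_meas_on {x..y} (\<lambda>t. f t - g t)"
proof -
  have "bdd_meas_on {x..y} (\<lambda>t. f t + (-1) * g t)"
    by (intro bdd_meas_on_add bdd_meas_on_mult assms bdd_meas_on_continuous continuous_intros)
  then show ?thesis by simp
qed

lemma bdd_meas_on_power2:
  "bdd_meas_on S f \<Longrightarrow> bdd_meas_on S (\<lambda>t. (f t)\<^sup>2)"
  unfolding power2_eq_square by (rule bdd_meas_on_mult)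

lemma bdd_meas_on_integrable:
  assumes "bdd_meas_on {x..y} f" shows "set_integrable lborel {x..y} f"
proof -
  from assms obtain B where m: "(\<lambda>t. indicator {x..y} t * f t) \<in> borel_measurable borel" and B: "\<And>t. t \<in> {x..y} \<Longrightarrow> \<bar>f t\<bar> \<le> B"
    by (rule bdd_meas_onE) blast
  have B': "\<bar>indicator {x..y} t * f t\<bar> \<le> \<bar>B\<bar>" for t
  proof (cases "t \<in> {x..y}")
    case True
    then show ?thesis using B[OF True] by simp
  qed simp
  have "integrable lborel (\<lambda>t. indicator {x..y} t * (indicator {x..y} t * f t))"
    by (rule integrable_indicator_mult_bounded[OF _ _ m B']) simp_all
  moreover have "indicator {x..y} t * (indicator {x..y} t * f t) = indicator {x..y} t *\<^sub>R f t" for t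
    by (simp add: indicator_def)
  ultimately show ?thesis by (simp add: set_integrable_def)
qed

lemma abs_cos_diff_le: "\<bar>cos x - cos y\<bar> \<le> \<bar>x - y :: real\<bar>"
proof -
  have "cos x - cos y = 2 * (sin ((x + y) / 2) * sin ((y - x) / 2))" by (simp add: cos_diff_cos)
  then have "\<bar>cos x - cos y\<bar> = 2 * (\<bar>sin ((x + y) / 2)\<bar> * \<bar>sin ((y - x) / 2)\<bar>)" by (simp add: abs_mult)
  also have "\<dots> \<le> 2 * (1 * \<bar>(y - x) / 2\<bar>)"
    by (intro mult_left_mono mult_mono abs_sin_x_le_abs_x abs_sin_le_one) auto
  finally show ?thesis by simp
qed

section \<open>Wave sums: the leading part of the oscillation\<close>

context pos_form begin

definition freq_ball :: "real \<Rightarrow> (int \<times> int) set" where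
  "freq_ball M = {n. n \<noteq> 0 \<and> freq (emb n) \<le> M}"

definition ztail :: "real \<Rightarrow> real \<Rightarrow> real" where
  "ztail s M = (\<Sum>\<^sub>\<infinity>n\<in>{n. M < freq (emb n)}. freq (emb n) powr (- s))"

lemma finite_freq_ball: "finite (freq_ball M)"
  by (rule finite_subset[OF _ finite_freq_le[of M]]) (auto simp: freq_ball_def)

lemma freq_ball_pos: "n \<in> freq_ball M \<Longrightarrow> freq (emb n) > 0"
  by (auto simp: freq_ball_def intro: freq_pos)

lemma freq_ball_mono: "M \<le> K \<Longrightarrow> freq_ball M \<subseteq> freq_ball K"
  by (auto simp: freq_ball_def)

lemma filterlim_freq_le:
  "filterlim (\<lambda>M. {n. freq (emb n) \<le> M}) (finite_subsets_at_top UNIV) at_top"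
  unfolding filterlim_finite_subsets_at_top
proof (intro allI impI)
  fix X :: "(int \<times> int) set" assume X: "finite X \<and> X \<subseteq> UNIV"
  have "\<forall>\<^sub>F M in at_top. \<forall>n\<in>X. freq (emb n) \<le> M"
    using X by (intro eventually_ball_finite) (auto simp: eventually_ge_at_top)
  then show "\<forall>\<^sub>F M in at_top. finite {n. freq (emb n) \<le> M} \<and> X \<subseteq> {n. freq (emb n) \<le> M} \<and> {n. freq (emb n) \<le> M} \<subseteq> UNIV"
    by eventually_elim (auto simp: finite_freq_le)
qed

lemma ztail_tendsto_0:
  assumes "s > 2" shows "(ztail s \<longlongrightarrow> 0) at_top"
proof -
  define f where "f = (\<lambda>n. freq (emb n) powr (- s))"
  have f: "f summable_on UNIV" using freq_powr_summable[OF assms] by (simp add: f_def)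
  have "((\<lambda>M. sum f {n. freq (emb n) \<le> M}) \<longlongrightarrow> infsum f UNIV) at_top"
    using filterlim_compose[OF infsum_tendsto[OF f] filterlim_freq_le] by simp
  then have "((\<lambda>M. infsum f UNIV - sum f {n. freq (emb n) \<le> M}) \<longlongrightarrow> infsum f UNIV - infsum f UNIV) at_top"
    by (intro tendsto_intros)
  moreover have "infsum f UNIV - sum f {n. freq (emb n) \<le> M} = ztail s M" for M
  proof -
    have "infsum f ({n. freq (emb n) \<le> M} \<union> {n. M < freq (emb n)}) = infsum f {n. freq (emb n) \<le> M} + infsum f {n. M < freq (emb n)}"
      by (intro infsum_Un_disjoint summable_on_subset[OF f]) auto
    moreover have "{n. freq (emb n) \<le> M} \<union> {n. M < freq (emb n)} = UNIV" by auto
    ultimately show ?thesis by (simp add: ztail_def f_def finite_freq_le)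
  qed
  ultimately show ?thesis by simp
qed

lemma infsum_freq_dominated:
  assumes "s > 2" and "K \<ge> 0" and b: "\<And>n. n \<in> S \<Longrightarrow> \<bar>f n\<bar> \<le> K * freq (emb n) powr (- s)"
  shows "f summable_on S" "\<bar>infsum f S\<bar> \<le> K * (\<Sum>\<^sub>\<infinity>n\<in>S. freq (emb n) powr (- s))" "\<bar>infsum f S\<bar> \<le> K * zsum s"
proof -
  have s: "(\<lambda>n. freq (emb n) powr (- s)) summable_on S" for S
    using freq_powr_summable[OF assms(1)] by (rule summable_on_subset) auto
  have ks: "(\<lambda>n. K * freq (emb n) powr (- s)) summable_on S" by (intro summable_on_cmult_right s)
  have a: "(\<lambda>n. norm (f n)) summable_on S"
    by (rule summable_on_comparison_test[OF ks]) (use b in auto)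
  then show "f summable_on S" by (rule summable_on_iff_abs_summable_on_real[THEN iffD2])
  have "\<bar>infsum f S\<bar> \<le> (\<Sum>\<^sub>\<infinity>n\<in>S. norm (f n))" using norm_infsum_bound[OF a] by simp
  also have "\<dots> \<le> (\<Sum>\<^sub>\<infinity>n\<in>S. K * freq (emb n) powr (- s))" by (intro infsum_mono a ks) (use b in auto)
  also have "\<dots> = K * (\<Sum>\<^sub>\<infinity>n\<in>S. freq (emb n) powr (- s))" by (intro infsum_cmult_right s)
  finally show 1: "\<bar>infsum f S\<bar> \<le> K * (\<Sum>\<^sub>\<infinity>n\<in>S. freq (emb n) powr (- s))" .
  have "(\<Sum>\<^sub>\<infinity>n\<in>S. freq (emb n) powr (- s)) \<le> zsum s"
    unfolding zsum_def by (intro infsum_mono2 s) auto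
  then have "K * (\<Sum>\<^sub>\<infinity>n\<in>S. freq (emb n) powr (- s)) \<le> K * zsum s" using assms(2) by (intro mult_left_mono)
  with 1 show "\<bar>infsum f S\<bar> \<le> K * zsum s" by linarith
qed

definition kap :: real where "kap = 2 * sqrt (2 / pi)"

lemma kap_pos: "kap > 0" by (simp add: kap_def)

text \<open>Up to the factor \<open>kap\<close> times a square root of \<open>X\<close>, the leading term of \<open>X\<^sup>2\<close> times the summand of \<open>osc X \<delta>\<close>.\<close>
definition wave_term :: "real \<Rightarrow> real \<Rightarrow> int \<times> int \<Rightarrow> real" where
  "wave_term X \<delta> n = freq (emb n) powr (-3/2) * nbessel (freq (emb n) * \<delta>) * cos (freq (emb n) * X - 3 * pi / 4)"

definition wave_sum :: "real \<Rightarrow> real \<Rightarrow> real" where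
  "wave_sum X \<delta> = (\<Sum>\<^sub>\<infinity>n\<in>-{0}. wave_term X \<delta> n)"

lemma wave_term_bound:
  assumes "n \<noteq> 0" "\<delta> > 0"
  shows "\<bar>wave_term X \<delta> n\<bar> \<le> 6 * \<delta> powr (- 1) * freq (emb n) powr (- (5/2))"
proof -
  define \<nu> where "\<nu> = freq (emb n)"
  have \<nu>: "\<nu> > 0" using freq_pos[OF assms(1)] by (simp add: \<nu>_def)
  have "\<bar>wave_term X \<delta> n\<bar> \<le> \<nu> powr (-3/2) * (6 * (\<nu> * \<delta>) powr (- 1)) * 1"
    unfolding wave_term_def abs_mult \<nu>_def[symmetric] using \<nu> assms
    by (intro mult_mono nbessel_decay) auto
  also have "(\<nu> * \<delta>) powr (- 1) = \<nu> powr (- 1) * \<delta> powr (- 1)" using \<nu> assms by (simp add: powr_mult)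
  also have "\<nu> powr (-3/2) * (6 * (\<nu> powr (- 1) * \<delta> powr (- 1))) * 1 = 6 * \<delta> powr (- 1) * (\<nu> powr (-3/2) * \<nu> powr (- 1))"
    by (simp only: mult_ac mult_1_right)
  also have "\<nu> powr (-3/2) * \<nu> powr (- 1) = \<nu> powr (- (5/2))" by (subst powr_add[symmetric]) simp
  finally show ?thesis by (simp add: \<nu>_def)
qed

lemma wave_sum_bound:
  assumes "\<delta> > 0"
  shows "\<bar>wave_sum X \<delta>\<bar> \<le> 6 * \<delta> powr (- 1) * zsum (5/2)"
  unfolding wave_sum_def
  by (rule infsum_freq_dominated(3)) (use wave_term_bound[OF _ assms] in auto)

text \<open>Mean squares are estimated for finite sums, so the series is cut at K. The loss contains
  1 / \<delta>, which is harmless because K can be taken as large as desired for each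
  \<delta>.\<close>

lemma wave_sum_truncation:
  assumes "\<delta> > 0" "K \<ge> 0"
  shows "\<bar>wave_sum X \<delta> - (\<Sum>n\<in>freq_ball K. wave_term X \<delta> n)\<bar> \<le> 6 * \<delta> powr (- 1) * ztail (5/2) K"
proof -
  have s: "wave_term X \<delta> summable_on -{0}"
    by (rule infsum_freq_dominated(1)[of "5/2" "6 * \<delta> powr (- 1)"]) (use wave_term_bound[OF _ assms(1)] in auto)
  have z: "n \<noteq> 0" if "K < freq (emb n)" for n using that assms(2) by auto
  have u: "freq_ball K \<union> {n. K < freq (emb n)} = -{0}"
    using z by (auto simp: freq_ball_def)
  have sub: "freq_ball K \<subseteq> -{0}" "{n. K < freq (emb n)} \<subseteq> -{0}" using u by blast+
  have disj: "freq_ball K \<inter> {n. K < freq (emb n)} = {}" by (auto simp: freq_ball_def)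
  have e: "wave_sum X \<delta> - (\<Sum>n\<in>freq_ball K. wave_term X \<delta> n) = infsum (wave_term X \<delta>) {n. K < freq (emb n)}"
    unfolding wave_sum_def u[symmetric]
    unfolding infsum_Un_disjoint[OF summable_on_subset[OF s sub(1)] summable_on_subset[OF s sub(2)] disj]
      infsum_finite[OF finite_freq_ball] by simp
  show ?thesis unfolding e ztail_def
  proof (rule infsum_freq_dominated(2))
    fix n assume "n \<in> {n. K < freq (emb n)}"
    then have "n \<noteq> 0" using z by blast
    then show "\<bar>wave_term X \<delta> n\<bar> \<le> 6 * \<delta> powr (- 1) * freq (emb n) powr (- (5/2))"
      using assms(1) by (rule wave_term_bound)
  qed auto
qed

text \<open>The asymptotic remainder of the factor at X is of order (\<nu> X)^(-2), and \<nu>^(-2)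
  just fails to be summable over the lattice. Half a power of decay of the factor at \<delta>
  restores convergence, at the price \<delta>^(-1/2).\<close>

lemma osc_wave_sum:
  assumes X: "X > 0" and d: "\<delta> > 0"
  shows "\<bar>X\<^sup>2 * osc X \<delta> - kap * sqrt X * wave_sum X \<delta>\<bar> \<le> 24 * \<delta> powr (- 1/2) * zsum (5/2)"
proof -
  define g where "g = (\<lambda>n. nbessel (freq (emb n) * X) * nbessel (freq (emb n) * \<delta>))"
  have gs: "g summable_on -{0}" unfolding g_def by (rule nbessel_pair_summable[OF X d])
  have ws: "wave_term X \<delta> summable_on -{0}"
    by (rule infsum_freq_dominated(1)[of "5/2" "6 * \<delta> powr (- 1)"]) (use wave_term_bound[OF _ d] in auto)
  have "(\<Sum>\<^sub>\<infinity>n\<in>-{0}. X\<^sup>2 * g n + k * wave_term X \<delta> n) = X\<^sup>2 * osc X \<delta> + k * wave_sum X \<delta>" for k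
    unfolding osc_def wave_sum_def g_def[symmetric]
    by (subst infsum_add) (auto intro!: summable_on_cmult_right gs ws simp: infsum_cmult_right gs ws)
  from this[of "- (kap * sqrt X)"]
  have "X\<^sup>2 * osc X \<delta> - kap * sqrt X * wave_sum X \<delta> = (\<Sum>\<^sub>\<infinity>n\<in>-{0}. X\<^sup>2 * g n + (- (kap * sqrt X)) * wave_term X \<delta> n)"
    by (simp only: mult_minus_left diff_conv_add_uminus)
  moreover have "\<bar>\<Sum>\<^sub>\<infinity>n\<in>-{0}. X\<^sup>2 * g n + (- (kap * sqrt X)) * wave_term X \<delta> n\<bar> \<le> 24 * \<delta> powr (- 1/2) * zsum (5/2)"
  proof (rule infsum_freq_dominated(3))
    fix n :: "int \<times> int" assume "n \<in> -{0}"
    define \<nu> where "\<nu> = freq (emb n)"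
    have \<nu>: "\<nu> > 0" using freq_pos[of n] \<open>n \<in> -{0}\<close> by (simp add: \<nu>_def)
    have sx: "X\<^sup>2 * (\<nu> * X) powr (-3/2) = sqrt X * \<nu> powr (-3/2)"
    proof -
      have "X\<^sup>2 * (\<nu> * X) powr (-3/2) = \<nu> powr (-3/2) * (X powr 2 * X powr (-3/2))" using \<nu> X by (simp add: powr_mult powr_numeral)
      also have "X powr 2 * X powr (-3/2) = X powr (1/2)" by (simp flip: powr_add)
      finally show ?thesis using X by (simp add: powr_half_sqrt)
    qed
    have "X\<^sup>2 * g n + (- (kap * sqrt X)) * wave_term X \<delta> n
      = X\<^sup>2 * (nbessel (\<nu> * X) - 2 * sqrt (2 / pi) * (\<nu> * X) powr (-3/2) * cos (\<nu> * X - 3 * pi / 4)) * nbessel (\<nu> * \<delta>)"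
    proof -
      have "X\<^sup>2 * (x - k * p * c) * y = X\<^sup>2 * (x * y) + (- (k * S)) * (q * y * c)" if "X\<^sup>2 * p = S * q" for x y k p c q S
      proof -
        have "X\<^sup>2 * (x - k * p * c) * y = X\<^sup>2 * (x * y) - k * c * y * (X\<^sup>2 * p)" by (simp add: algebra_simps)
        then show ?thesis unfolding that by (simp add: algebra_simps)
      qed
      from this[OF sx] show ?thesis by (simp add: g_def wave_term_def \<nu>_def[symmetric] kap_def)
    qed
    also have "\<bar>\<dots>\<bar> \<le> X\<^sup>2 * (4 / (\<nu> * X)\<^sup>2) * (6 * (\<nu> * \<delta>) powr (- (1/2)))"
      unfolding abs_mult using \<nu> X d
      by (intro mult_mono nbessel_asymptotic nbessel_decay) auto
    also have "\<dots> = 24 * \<delta> powr (- 1/2) * (\<nu> powr (- 2) * \<nu> powr (- (1/2)))"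
      using \<nu> X d by (simp add: powr_mult power_mult_distrib powr_minus_divide powr_numeral)
    also have "\<nu> powr (- 2) * \<nu> powr (- (1/2)) = \<nu> powr (- (5/2))" by (simp flip: powr_add)
    finally show "\<bar>X\<^sup>2 * g n + (- (kap * sqrt X)) * wave_term X \<delta> n\<bar> \<le> 24 * \<delta> powr (- 1/2) * freq (emb n) powr (- (5/2))"
      by (simp add: \<nu>_def)
  qed auto
  ultimately show ?thesis by simp
qed

definition F :: "real \<Rightarrow> real" where
  "F R = (real (card (L R)) - A * R\<^sup>2) / R powr (1/2)"

text \<open>The summands bound in turn the change of area between R and X, the remainder in
  \<open>osc_wave_sum\<close>, and the replacement of sqrt X by sqrt R in
  \<open>F_near_wave_sum\<close>.\<close>

definition W :: real where "W = 5 * A + 24 * A * zsum (5/2) + 12 * A * kap * zsum (5/2)"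

text \<open>The amplitude is moved to R, since the error is later divided by sqrt R, while the
  phases stay at X. The amplitude changes by at most 2 \<delta> and the wave sum is O(1 / \<delta>),
  so this move costs only O(1).\<close>

lemma F_near_wave_sum:
  assumes R: "R \<ge> 1" and d: "0 < \<delta>" "\<delta> \<le> 1/8" and X: "\<bar>X - R\<bar> = 2 * \<delta>"
  shows "\<bar>A * X\<^sup>2 + A * X\<^sup>2 * osc X \<delta> - A * R\<^sup>2 - A * kap * sqrt R * wave_sum X \<delta>\<bar>
    \<le> W * (\<delta> * R + 1 / sqrt \<delta>)"
proof -
  define Z where "Z = zsum (5/2)"
  have Z: "Z \<ge> 0" by (simp add: Z_def zsum_nonneg)
  have X0: "X > 0" "X + R \<le> 5/2 * R" "X + R \<ge> 0" using X d R by linarith+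
  have 1: "\<bar>A * X\<^sup>2 - A * R\<^sup>2\<bar> \<le> 5 * A * (\<delta> * R)"
  proof -
    have "A * X\<^sup>2 - A * R\<^sup>2 = A * ((X - R) * (X + R))" by (simp add: power2_eq_square algebra_simps)
    then have "\<bar>A * X\<^sup>2 - A * R\<^sup>2\<bar> = A * (2 * \<delta> * (X + R))" using A_pos X X0 by (simp add: abs_mult)
    also have "\<dots> \<le> A * (2 * \<delta> * (5/2 * R))" using A_pos d X0 by (intro mult_left_mono) auto
    finally show ?thesis by (simp add: mult_ac)
  qed
  have s: "1 \<le> 1 / sqrt \<delta>" using d by simp
  have pd: "\<delta> powr (- 1/2) = 1 / sqrt \<delta>" using d by (simp add: powr_minus_divide powr_half_sqrt)
  have 2: "\<bar>A * (X\<^sup>2 * osc X \<delta> - kap * sqrt X * wave_sum X \<delta>)\<bar> \<le> A * (24 * (1 / sqrt \<delta>) * Z)"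
    unfolding abs_mult using osc_wave_sum[OF X0(1) d(1)] A_pos unfolding pd Z_def by (intro mult_mono) auto
  have 3: "\<bar>A * kap * (sqrt X - sqrt R) * wave_sum X \<delta>\<bar> \<le> 12 * A * kap * Z * (1 / sqrt \<delta>)"
  proof -
    have "(sqrt X - sqrt R) * (sqrt X + sqrt R) = X - R" using X0 R by (simp add: algebra_simps)
    then have "\<bar>sqrt X - sqrt R\<bar> * \<bar>sqrt X + sqrt R\<bar> = 2 * \<delta>" using X by (metis abs_mult)
    moreover have "\<bar>sqrt X - sqrt R\<bar> * 1 \<le> \<bar>sqrt X - sqrt R\<bar> * \<bar>sqrt X + sqrt R\<bar>"
    proof (rule mult_left_mono)
      have "1 \<le> sqrt R" "0 \<le> sqrt X" using R X0 by auto
      then show "1 \<le> \<bar>sqrt X + sqrt R\<bar>" by linarith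
    qed simp
    ultimately have sd: "\<bar>sqrt X - sqrt R\<bar> \<le> 2 * \<delta>" by simp
    have "\<bar>A * kap * (sqrt X - sqrt R) * wave_sum X \<delta>\<bar> \<le> A * kap * (2 * \<delta>) * (6 * \<delta> powr (- 1) * Z)"
      unfolding abs_mult Z_def using A_pos kap_pos sd d by (intro mult_mono wave_sum_bound) auto
    also have "\<dots> = 12 * A * kap * Z * 1" using d by (simp add: powr_minus_divide)
    also have "\<dots> \<le> 12 * A * kap * Z * (1 / sqrt \<delta>)" using s A_pos kap_pos Z by (intro mult_left_mono) auto
    finally show ?thesis .
  qed
  have dec: "A * X\<^sup>2 + A * X\<^sup>2 * osc X \<delta> - A * R\<^sup>2 - A * kap * sqrt R * wave_sum X \<delta> =
     (A * X\<^sup>2 - A * R\<^sup>2) + A * (X\<^sup>2 * osc X \<delta> - kap * sqrt X * wave_sum X \<delta>) + A * kap * (sqrt X - sqrt R) * wave_sum X \<delta>"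
    by (simp add: algebra_simps)
  have "\<bar>A * X\<^sup>2 + A * X\<^sup>2 * osc X \<delta> - A * R\<^sup>2 - A * kap * sqrt R * wave_sum X \<delta>\<bar>
    \<le> 5 * A * (\<delta> * R) + (24 * A * Z + 12 * A * kap * Z) * (1 / sqrt \<delta>)"
  proof -
    have "(24 * A * Z + 12 * A * kap * Z) * (1 / sqrt \<delta>) = A * (24 * (1 / sqrt \<delta>) * Z) + 12 * A * kap * Z * (1 / sqrt \<delta>)"
      by (simp add: distrib_left distrib_right mult_ac)
    with dec 1 2 3 show ?thesis by linarith
  qed
  also have "\<dots> \<le> W * (\<delta> * R) + W * (1 / sqrt \<delta>)"
  proof -
    have "0 \<le> A * Z" "0 \<le> A * kap * Z" "0 \<le> A" using A_pos kap_pos Z by simp_all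
    then have "5 * A \<le> W" "24 * A * Z + 12 * A * kap * Z \<le> W" unfolding W_def Z_def[symmetric] by linarith+
    then show ?thesis using d R by (intro add_mono mult_right_mono) auto
  qed
  finally show ?thesis by (simp add: distrib_left)
qed

lemma F_wave_sum_bounds:
  assumes R: "R \<ge> 1" and d: "0 < \<delta>" "\<delta> \<le> 1/8"
  shows "F R \<le> A * kap * wave_sum (R + 2 * \<delta>) \<delta> + W * (\<delta> * sqrt R + 1 / (sqrt \<delta> * sqrt R))"
    "A * kap * wave_sum (R - 2 * \<delta>) \<delta> - W * (\<delta> * sqrt R + 1 / (sqrt \<delta> * sqrt R)) \<le> F R"
proof -
  have sR: "sqrt R > 0" and FR: "F R = (real (card (L R)) - A * R\<^sup>2) / sqrt R"
    using R by (auto simp: F_def powr_half_sqrt)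
  have Wd: "W * (\<delta> * R + 1 / sqrt \<delta>) = (W * (\<delta> * sqrt R + 1 / (sqrt \<delta> * sqrt R))) * sqrt R"
  proof -
    have "R = sqrt R * sqrt R" using R by simp
    then have "(\<delta> * sqrt R + 1 / (sqrt \<delta> * sqrt R)) * sqrt R = \<delta> * R + 1 / sqrt \<delta>"
      using sR by (simp add: distrib_right)
    then show ?thesis by (simp add: mult.assoc)
  qed
  have "real (card (L (R + 2 * \<delta> - 2 * \<delta>))) \<le> A * (R + 2 * \<delta>)\<^sup>2 + A * (R + 2 * \<delta>)\<^sup>2 * osc (R + 2 * \<delta>) \<delta>"
    using R d by (intro lattice_count_osc_bounds) auto
  then have "real (card (L R)) - A * R\<^sup>2 \<le> A * kap * sqrt R * wave_sum (R + 2 * \<delta>) \<delta> + W * (\<delta> * R + 1 / sqrt \<delta>)"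
    using F_near_wave_sum[OF R d, of "R + 2 * \<delta>"] d by (simp add: abs_le_iff)
  also have "\<dots> = (A * kap * wave_sum (R + 2 * \<delta>) \<delta> + W * (\<delta> * sqrt R + 1 / (sqrt \<delta> * sqrt R))) * sqrt R"
    unfolding Wd by (simp add: distrib_right)
  finally show "F R \<le> A * kap * wave_sum (R + 2 * \<delta>) \<delta> + W * (\<delta> * sqrt R + 1 / (sqrt \<delta> * sqrt R))"
    unfolding FR using sR by (simp add: pos_divide_le_eq)
  have "A * (R - 2 * \<delta>)\<^sup>2 + A * (R - 2 * \<delta>)\<^sup>2 * osc (R - 2 * \<delta>) \<delta> \<le> real (card (L (R - 2 * \<delta> + 2 * \<delta>)))"
    using R d by (intro lattice_count_osc_bounds) auto
  then have "A * kap * sqrt R * wave_sum (R - 2 * \<delta>) \<delta> - W * (\<delta> * R + 1 / sqrt \<delta>) \<le> real (card (L R)) - A * R\<^sup>2"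
    using F_near_wave_sum[OF R d, of "R - 2 * \<delta>"] d by (simp add: abs_le_iff)
  moreover have "A * kap * sqrt R * wave_sum (R - 2 * \<delta>) \<delta> - W * (\<delta> * R + 1 / sqrt \<delta>) =
     (A * kap * wave_sum (R - 2 * \<delta>) \<delta> - W * (\<delta> * sqrt R + 1 / (sqrt \<delta> * sqrt R))) * sqrt R"
    unfolding Wd by (simp add: left_diff_distrib)
  ultimately show "A * kap * wave_sum (R - 2 * \<delta>) \<delta> - W * (\<delta> * sqrt R + 1 / (sqrt \<delta> * sqrt R)) \<le> F R"
    unfolding FR using sR by (simp add: pos_le_divide_eq)
qed

lemma bdd_meas_on_F: "bdd_meas_on {1..T} F"
proof -
  \<comment> \<open>The count is monotone for R >= 0 only, because \<open>E\<close> depends on R^2;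
    clamping at 1 makes it globally monotone and hence Borel.\<close>
  have "mono (\<lambda>R. real (card (L (max 1 R))))"
    by (intro monoI of_nat_mono card_mono finite_L L_mono) auto
  then have "(\<lambda>R. real (card (L (max 1 R)))) \<in> borel_measurable borel" by (rule borel_measurable_mono)
  then have "(\<lambda>R. indicator {1..T} R * real (card (L (max 1 R)))) \<in> borel_measurable borel" by measurable
  moreover have "indicator {1..T} R * real (card (L (max 1 R))) = indicator {1..T} R * real (card (L R))" for R
    by (simp add: indicator_def max_def)
  ultimately have m: "(\<lambda>R. indicator {1..T} R * real (card (L R))) \<in> borel_measurable borel" by simp
  have 1: "bdd_meas_on {1..T} (\<lambda>R. real (card (L R)))"
  proof (rule bdd_meas_onI[OF m])
    fix R assume "R \<in> {1..T}"
    then have "L R \<subseteq> L T" by (intro L_mono) auto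
    then show "\<bar>real (card (L R))\<bar> \<le> real (card (L T))" by (simp add: card_mono finite_L)
  qed
  have "bdd_meas_on {1..T} (\<lambda>R. A * R\<^sup>2)"
    by (intro bdd_meas_on_continuous continuous_intros)
  moreover have "bdd_meas_on {1..T} (\<lambda>R. 1 / R powr (1/2))"
    by (intro bdd_meas_on_continuous continuous_on_divide continuous_on_powr continuous_intros) auto
  moreover note 1
  ultimately have 1: "bdd_meas_on {1..T} (\<lambda>R. real (card (L R)))" "bdd_meas_on {1..T} (\<lambda>R. A * R\<^sup>2)" "bdd_meas_on {1..T} (\<lambda>R. 1 / R powr (1/2))" by blast+
  from bdd_meas_on_mult[OF bdd_meas_on_diff[OF 1(1,2)] 1(3)]
  show ?thesis by (simp add: F_def[abs_def])
qed

end

section \<open>Approximation by trigonometric polynomials in mean square\<close>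

lemma power2_sum3_le: "(x + y + z)\<^sup>2 \<le> 3 * (x\<^sup>2 + y\<^sup>2 + z\<^sup>2)" for x y z :: real
proof -
  have "3 * (x\<^sup>2 + y\<^sup>2 + z\<^sup>2) - (x + y + z)\<^sup>2 = (x - y)\<^sup>2 + (y - z)\<^sup>2 + (x - z)\<^sup>2"
    by (simp add: power2_eq_square algebra_simps)
  then show ?thesis using zero_le_power2[of "x - y"] zero_le_power2[of "y - z"] zero_le_power2[of "x - z"] by linarith
qed

lemma set_integral_inverse: "T \<ge> 1 \<Longrightarrow> (LBINT t:{1..T}. 1 / t) = ln T" for T :: real
proof -
  assume T: "T \<ge> 1"
  have "((\<lambda>t. 1 / t) has_integral (ln T - ln 1)) {1..T}"
    using T by (intro fundamental_theorem_of_calculus)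
      (auto simp: has_real_derivative_iff_has_vector_derivative[symmetric] intro!: derivative_eq_intros)
  moreover have "set_integrable lborel {1..T} (\<lambda>t. 1 / t)"
    by (intro borel_integrable_atLeastAtMost' continuous_intros) auto
  ultimately show ?thesis using set_borel_integral_eq_integral(2) by (metis diff_zero integral_unique ln_one)
qed

lemma set_integral_const: "T \<ge> 1 \<Longrightarrow> (LBINT t:{1..T}. c) = c * (T - 1)" for T c :: real
  by (simp add: set_lebesgue_integral_def)

context pos_form begin

text \<open>Up to the constant factor, the wave sum truncated at M with the smoothing factor
  replaced by 1, its value at \<delta> = 0.\<close>

definition trig_poly :: "real \<Rightarrow> real \<Rightarrow> real" where
  "trig_poly M t = A * kap * (\<Sum>n\<in>freq_ball M. freq (emb n) powr (-3/2) * cos (freq (emb n) * t - 3 * pi / 4))"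

lemma continuous_trig_poly: "continuous_on S (trig_poly M)"
  unfolding trig_poly_def[abs_def] by (intro continuous_intros)

lemma one_plus_freq_powr_le:
  assumes "n \<noteq> 0"
  shows "(1 + freq (emb n)) powr (3/4) \<le> (1 + 1 / fmin) powr (3/4) * freq (emb n) powr (3/4)"
proof -
  have "1 + freq (emb n) \<le> (1 + 1 / fmin) * freq (emb n)"
    using freq_ge_fmin[OF assms] fmin_pos by (simp add: field_simps)
  then have "(1 + freq (emb n)) powr (3/4) \<le> ((1 + 1 / fmin) * freq (emb n)) powr (3/4)"
    using freq_nonneg[of "emb n"] by (intro powr_mono2) auto
  also have "\<dots> = (1 + 1 / fmin) powr (3/4) * freq (emb n) powr (3/4)"
    using fmin_pos freq_nonneg by (intro powr_mult)
  finally show ?thesis .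
qed

lemma sum_freq_powr_le_zsum:
  assumes "s > 2" "finite B" shows "(\<Sum>n\<in>B. freq (emb n) powr (- s)) \<le> zsum s"
  unfolding zsum_def using freq_powr_summable[OF assms(1)] assms(2) by (intro finite_sum_le_infsum) auto

lemma sum_freq_powr_le_ztail:
  assumes "s > 2" "finite B" "\<And>n. n \<in> B \<Longrightarrow> M < freq (emb n)"
  shows "(\<Sum>n\<in>B. freq (emb n) powr (- s)) \<le> ztail s M"
  unfolding ztail_def using assms
  by (intro finite_sum_le_infsum summable_on_subset[OF freq_powr_summable[OF assms(1)]]) auto

text \<open>Pairs at distance at most \<eta> = T^(-7/8) are counted by
  \<open>freq_annulus_count\<close>. For the others T^2 \<eta>^2 = T^(1/4), and the factor exp (-
  T^(1/4) / 2) beats \<delta>^(-2) once \<delta> is a power of T. The bound is uniform in K and in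
  the shift \<sigma>, so K may depend on T and both shifts by 2 \<delta> are covered.\<close>

lemma tail_mean_square:
  obtains K1 K2 where "K1 \<ge> 0" "K2 \<ge> 0"
    "\<And>M K \<delta> \<sigma> T. T \<ge> 1 \<Longrightarrow> \<delta> > 0 \<Longrightarrow>
       (LBINT t:{1..T}. (\<Sum>n\<in>freq_ball K - freq_ball M. wave_term (t + \<sigma>) \<delta> n)\<^sup>2)
        \<le> T * (K1 * ztail (9/4) M + K2 * (T powr (-7/8) * \<delta> powr (-1/2) + exp (- (T powr (1/4)) / 2) * \<delta> powr (-2)))"
proof -
  obtain C0 where C0: "C0 > 0" 
    "\<And>\<nu> \<eta>. \<nu> \<ge> 0 \<Longrightarrow> 0 < \<eta> \<Longrightarrow> \<eta> \<le> 1 \<Longrightarrow> real (card {m. \<bar>freq (emb m) - \<nu>\<bar> \<le> \<eta>}) \<le> C0 * (\<nu> * \<eta> + (1 + \<nu>) powr (3/4))"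
    using freq_annulus_count by blast
  define q where "q = (1 + 1 / fmin) powr (3/4)"
  define Z where "Z = zsum (5/2)"
  have q: "q \<ge> 0" and Z: "Z \<ge> 0" by (simp_all add: q_def Z_def zsum_nonneg)
  define K1 where "K1 = 5 * C0 * q"
  define K2 where "K2 = 30 * C0 * Z + 180 * Z\<^sup>2"
  have "(LBINT t:{1..T}. (\<Sum>n\<in>freq_ball K - freq_ball M. wave_term (t + \<sigma>) \<delta> n)\<^sup>2)
        \<le> T * (K1 * ztail (9/4) M + K2 * (T powr (-7/8) * \<delta> powr (-1/2) + exp (- (T powr (1/4)) / 2) * \<delta> powr (-2)))"
    if T: "T \<ge> 1" and d: "\<delta> > 0" for M K \<delta> \<sigma> T
  proof -
    define B where "B = freq_ball K - freq_ball M"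
    define \<nu> where "\<nu> = (\<lambda>n. freq (emb n))"
    define c where "c = (\<lambda>n. \<nu> n powr (-3/2) * nbessel (\<nu> n * \<delta>))"
    define \<phi> where "\<phi> = (\<lambda>n. \<nu> n * \<sigma> - 3 * pi / 4)"
    define \<eta> where "\<eta> = T powr (-7/8)"
    define N where "N = (\<lambda>n. C0 * (\<nu> n * \<eta> + (1 + \<nu> n) powr (3/4)))"
    define e where "e = exp (- (T powr (1/4)) / 2)"
    have B: "finite B" by (simp add: B_def finite_freq_ball)
    have Bnz: "n \<noteq> 0" "M < freq (emb n)" if "n \<in> B" for n using that by (auto simp: B_def freq_ball_def)
    have \<nu>: "\<nu> n > 0" if "n \<in> B" for n using freq_pos[OF Bnz(1)[OF that]] by (simp add: \<nu>_def)
    have \<eta>0: "0 < \<eta>" using T by (simp add: \<eta>_def)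
    have "T powr (-7/8) \<le> T powr 0" using T by (intro powr_mono) auto
    then have \<eta>1: "\<eta> \<le> 1" using T by (simp add: \<eta>_def)
    have card: "real (card {m \<in> B. \<bar>\<nu> m - \<nu> n\<bar> \<le> \<eta>}) \<le> N n" if "n \<in> B" for n
    proof -
      have "{m. \<bar>freq (emb m) - \<nu> n\<bar> \<le> \<eta>} \<subseteq> {m. freq (emb m) \<le> \<nu> n + \<eta>}" by auto
      then have "finite {m. \<bar>freq (emb m) - \<nu> n\<bar> \<le> \<eta>}" using finite_freq_le by (rule finite_subset)
      moreover have "{m \<in> B. \<bar>\<nu> m - \<nu> n\<bar> \<le> \<eta>} \<subseteq> {m. \<bar>freq (emb m) - \<nu> n\<bar> \<le> \<eta>}" by (auto simp: \<nu>_def)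
      ultimately have "real (card {m \<in> B. \<bar>\<nu> m - \<nu> n\<bar> \<le> \<eta>}) \<le> real (card {m. \<bar>freq (emb m) - \<nu> n\<bar> \<le> \<eta>})"
        by (simp add: card_mono)
      also have "\<dots> \<le> N n" unfolding N_def using C0(2)[OF _ \<eta>0 \<eta>1] \<nu>[OF that] by simp
      finally show ?thesis .
    qed
    have wt: "wave_term (t + \<sigma>) \<delta> n = c n * cos (\<nu> n * t + \<phi> n)" for t n
      by (simp add: wave_term_def c_def \<phi>_def \<nu>_def distrib_left add_diff_eq)
    have s1: "(\<Sum>n\<in>B. (c n)\<^sup>2 * N n) \<le> 6 * C0 * Z * (\<eta> * \<delta> powr (-1/2)) + C0 * q * ztail (9/4) M"
    proof -
      have "(c n)\<^sup>2 * N n \<le> 6 * C0 * (\<eta> * \<delta> powr (-1/2)) * \<nu> n powr (- (5/2)) + C0 * q * \<nu> n powr (- (9/4))" if n: "n \<in> B" for n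
      proof -
        define g where "g = nbessel (\<nu> n * \<delta>)"
        have g1: "\<bar>g\<bar> \<le> 1" by (simp add: g_def abs_nbessel_le_1)
        have g2: "\<bar>g\<bar> \<le> 6 * (\<nu> n * \<delta>) powr (- (1/2))" unfolding g_def using \<nu>[OF n] d by (intro nbessel_decay) auto
        have "\<bar>g\<bar> * \<bar>g\<bar> \<le> \<bar>g\<bar> * 1" using g1 by (intro mult_left_mono) auto
        \<comment> \<open>One factor g is given up, as half a power of decay suffices: it turns
          \<nu>^(-2) into the summable \<nu>^(-5/2).\<close>
        then have gg: "g\<^sup>2 \<le> \<bar>g\<bar>" by (simp add: power2_eq_square flip: abs_mult)
        have c2: "(c n)\<^sup>2 = \<nu> n powr (-3) * g\<^sup>2"
          by (simp add: c_def g_def power_mult_distrib power2_eq_square flip: powr_add)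
        have t1: "(c n)\<^sup>2 * (\<nu> n * \<eta>) \<le> 6 * (\<eta> * \<delta> powr (-1/2)) * \<nu> n powr (- (5/2))"
        proof -
          have "(c n)\<^sup>2 * (\<nu> n * \<eta>) = (\<nu> n powr (-3) * \<nu> n) * \<eta> * g\<^sup>2" unfolding c2 by simp
          also have "\<nu> n powr (-3) * \<nu> n = \<nu> n powr (-2)" using \<nu>[OF n] powr_add[of "\<nu> n" "-3" 1] by simp
          also have "\<nu> n powr (-2) * \<eta> * g\<^sup>2 \<le> \<nu> n powr (-2) * \<eta> * (6 * (\<nu> n * \<delta>) powr (- (1/2)))"
            using gg g2 \<eta>0 by (intro mult_left_mono) auto
          also have "(\<nu> n * \<delta>) powr (- (1/2)) = \<nu> n powr (- (1/2)) * \<delta> powr (- (1/2))" using \<nu>[OF n] d by (simp add: powr_mult)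
          also have "\<nu> n powr (-2) * \<eta> * (6 * (\<nu> n powr (- (1/2)) * \<delta> powr (- (1/2)))) = 6 * (\<eta> * \<delta> powr (-1/2)) * (\<nu> n powr (-2) * \<nu> n powr (- (1/2)))"
            by simp
          also have "\<nu> n powr (-2) * \<nu> n powr (- (1/2)) = \<nu> n powr (- (5/2))" by (subst powr_add[symmetric]) simp
          finally show ?thesis .
        qed
        \<comment> \<open>This part must not involve \<delta>: it is what survives as T grows, and
          it becomes the tail of the series in \<nu>^(-9/4).\<close>
        have t2: "(c n)\<^sup>2 * (1 + \<nu> n) powr (3/4) \<le> q * \<nu> n powr (- (9/4))"
        proof -
          have "g\<^sup>2 \<le> 1" using gg g1 by linarith
          then have "\<nu> n powr (-3) * g\<^sup>2 \<le> \<nu> n powr (-3) * 1" by (intro mult_left_mono) auto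
          then have "(c n)\<^sup>2 * (1 + \<nu> n) powr (3/4) \<le> \<nu> n powr (-3) * (q * \<nu> n powr (3/4))"
            unfolding c2 q_def \<nu>_def using one_plus_freq_powr_le[OF Bnz(1)[OF n]] by (intro mult_mono) auto
          also have "\<dots> = q * (\<nu> n powr (-3) * \<nu> n powr (3/4))" by simp
          also have "\<nu> n powr (-3) * \<nu> n powr (3/4) = \<nu> n powr (- (9/4))" by (subst powr_add[symmetric]) simp
          finally show ?thesis .
        qed
        have "(c n)\<^sup>2 * N n = C0 * ((c n)\<^sup>2 * (\<nu> n * \<eta>) + (c n)\<^sup>2 * (1 + \<nu> n) powr (3/4))"
          by (simp add: N_def algebra_simps)
        also have "\<dots> \<le> C0 * (6 * (\<eta> * \<delta> powr (-1/2)) * \<nu> n powr (- (5/2)) + q * \<nu> n powr (- (9/4)))"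
          using C0(1) t1 t2 by (intro mult_left_mono add_mono) auto
        finally show ?thesis by (simp add: algebra_simps)
      qed
      then have "(\<Sum>n\<in>B. (c n)\<^sup>2 * N n) \<le> (\<Sum>n\<in>B. 6 * C0 * (\<eta> * \<delta> powr (-1/2)) * \<nu> n powr (- (5/2)) + C0 * q * \<nu> n powr (- (9/4)))"
        by (rule sum_mono)
      also have "\<dots> = 6 * C0 * (\<eta> * \<delta> powr (-1/2)) * (\<Sum>n\<in>B. \<nu> n powr (- (5/2))) + C0 * q * (\<Sum>n\<in>B. \<nu> n powr (- (9/4)))"
        unfolding sum.distrib sum_distrib_left ..
      also have "\<dots> \<le> 6 * C0 * (\<eta> * \<delta> powr (-1/2)) * Z + C0 * q * ztail (9/4) M"
        unfolding Z_def \<nu>_def using C0(1) \<eta>0 q B Bnz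
        by (intro add_mono mult_left_mono sum_freq_powr_le_zsum sum_freq_powr_le_ztail) auto
      finally show ?thesis by (simp add: mult_ac)
    qed
    have s2: "(\<Sum>n\<in>B. \<bar>c n\<bar>)\<^sup>2 \<le> 36 * Z\<^sup>2 * \<delta> powr (-2)"
    proof -
      have "\<bar>c n\<bar> \<le> 6 * \<delta> powr (- 1) * \<nu> n powr (- (5/2))" if n: "n \<in> B" for n
      proof -
        have "\<bar>c n\<bar> \<le> \<nu> n powr (-3/2) * (6 * (\<nu> n * \<delta>) powr (- 1))"
          unfolding c_def abs_mult using \<nu>[OF n] d by (intro mult_mono nbessel_decay) auto
        also have "(\<nu> n * \<delta>) powr (- 1) = \<nu> n powr (- 1) * \<delta> powr (- 1)" using \<nu>[OF n] d by (simp add: powr_mult)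
        also have "\<nu> n powr (-3/2) * (6 * (\<nu> n powr (- 1) * \<delta> powr (- 1))) = 6 * \<delta> powr (- 1) * (\<nu> n powr (-3/2) * \<nu> n powr (- 1))"
          by (simp only: mult_ac)
        also have "\<nu> n powr (-3/2) * \<nu> n powr (- 1) = \<nu> n powr (- (5/2))" by (subst powr_add[symmetric]) simp
        finally show ?thesis .
      qed
      then have "(\<Sum>n\<in>B. \<bar>c n\<bar>) \<le> (\<Sum>n\<in>B. 6 * \<delta> powr (- 1) * \<nu> n powr (- (5/2)))" by (rule sum_mono)
      also have "\<dots> = 6 * \<delta> powr (- 1) * (\<Sum>n\<in>B. \<nu> n powr (- (5/2)))" by (rule sum_distrib_left[symmetric])
      also have "\<dots> \<le> 6 * \<delta> powr (- 1) * Z"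
        unfolding Z_def \<nu>_def using B by (intro mult_left_mono sum_freq_powr_le_zsum) auto
      finally have "(\<Sum>n\<in>B. \<bar>c n\<bar>)\<^sup>2 \<le> (6 * \<delta> powr (- 1) * Z)\<^sup>2" by (intro power_mono sum_nonneg) auto
      also have "\<dots> = 36 * Z\<^sup>2 * (\<delta> powr (- 1) * \<delta> powr (- 1))" by (simp only: power2_eq_square) simp
      also have "\<delta> powr (- 1) * \<delta> powr (- 1) = \<delta> powr (-2)" by (subst powr_add[symmetric]) simp
      finally show ?thesis .
    qed
    have "T\<^sup>2 * \<eta>\<^sup>2 = T powr (1/4)"
    proof -
      have "T\<^sup>2 * \<eta>\<^sup>2 = T powr 2 * (T powr (-7/8) * T powr (-7/8))"
        using T by (simp only: \<eta>_def power2_eq_square[of "T powr _"] powr_numeral)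
      also have "\<dots> = T powr (1/4)" unfolding powr_add[symmetric] by simp
      finally show ?thesis .
    qed
    then have ee: "exp (- (T\<^sup>2 * \<eta>\<^sup>2) / 2) = e" by (simp add: e_def)
    have "(LBINT t:{1..T}. (\<Sum>n\<in>B. wave_term (t + \<sigma>) \<delta> n)\<^sup>2) \<le> 5 * T * ((\<Sum>n\<in>B. (c n)\<^sup>2 * N n) + exp (- (T\<^sup>2 * \<eta>\<^sup>2) / 2) * (\<Sum>n\<in>B. \<bar>c n\<bar>)\<^sup>2)"
      unfolding wt by (rule mean_square_cos_sum[OF B \<nu> T less_imp_le[OF \<eta>0] card])
    also have "\<dots> \<le> 5 * T * ((6 * C0 * Z * (\<eta> * \<delta> powr (-1/2)) + C0 * q * ztail (9/4) M) + e * (36 * Z\<^sup>2 * \<delta> powr (-2)))"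
      unfolding ee using T s1 s2 by (intro mult_left_mono add_mono) (auto simp: e_def)
    also have "\<dots> = T * (K1 * ztail (9/4) M + (30 * C0 * Z * (\<eta> * \<delta> powr (-1/2)) + 180 * Z\<^sup>2 * (e * \<delta> powr (-2))))"
      by (simp add: K1_def algebra_simps)
    also have "\<dots> \<le> T * (K1 * ztail (9/4) M + (K2 * (\<eta> * \<delta> powr (-1/2)) + K2 * (e * \<delta> powr (-2))))"
    proof -
      have "0 \<le> C0 * Z" using C0(1) Z by simp
      then have "30 * C0 * Z \<le> K2" "180 * Z\<^sup>2 \<le> K2" unfolding K2_def by simp_all
      then show ?thesis using T \<eta>0 by (intro mult_left_mono add_mono mult_right_mono order_refl) (auto simp: e_def)
    qed
    finally show ?thesis by (simp add: B_def \<eta>_def e_def distrib_left)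
  qed
  moreover have "K1 \<ge> 0" "K2 \<ge> 0" using C0(1) q Z by (simp_all add: K1_def K2_def)
  ultimately show thesis using that by blast
qed

text \<open>It grows with M, which does no harm: M stays fixed while \<delta> tends to 0.\<close>

definition low_const :: "real \<Rightarrow> real" where
  "low_const M = (\<Sum>n\<in>freq_ball M. freq (emb n) powr (-3/2) * ((freq (emb n))\<^sup>2 + 2 * freq (emb n)))"

text \<open>Two replacements: \<open>nbessel\<close> at \<nu> \<delta> by 1, costing at most (\<nu>
  \<delta>)^2 / 2, and the shifted phase by the unshifted one, costing at most 2 \<nu>
  \<delta>.\<close>

lemma low_terms_bound:
  assumes d: "0 < \<delta>" "\<delta> \<le> 1" and \<sigma>: "\<bar>\<sigma>\<bar> = 2 * \<delta>"
  shows "\<bar>(\<Sum>n\<in>freq_ball M. wave_term (R + \<sigma>) \<delta> n) - (\<Sum>n\<in>freq_ball M. freq (emb n) powr (-3/2) * cos (freq (emb n) * R - 3 * pi / 4))\<bar>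
    \<le> low_const M * \<delta>"
proof -
  have "\<bar>wave_term (R + \<sigma>) \<delta> n - freq (emb n) powr (-3/2) * cos (freq (emb n) * R - 3 * pi / 4)\<bar>
     \<le> freq (emb n) powr (-3/2) * ((freq (emb n))\<^sup>2 + 2 * freq (emb n)) * \<delta>" if "n \<in> freq_ball M" for n
  proof -
    define \<nu> where "\<nu> = freq (emb n)"
    have \<nu>: "\<nu> > 0" using freq_ball_pos[OF that] by (simp add: \<nu>_def)
    define x where "x = cos (\<nu> * (R + \<sigma>) - 3 * pi / 4)"
    define y where "y = cos (\<nu> * R - 3 * pi / 4)"
    have "\<bar>x - y\<bar> \<le> \<bar>(\<nu> * (R + \<sigma>) - 3 * pi / 4) - (\<nu> * R - 3 * pi / 4)\<bar>" unfolding x_def y_def by (rule abs_cos_diff_le)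
    also have "\<dots> = \<nu> * (2 * \<delta>)" using \<nu> \<sigma> by (simp add: distrib_left abs_mult)
    finally have xy: "\<bar>x - y\<bar> \<le> 2 * \<nu> * \<delta>" by simp
    have "\<bar>nbessel (\<nu> * \<delta>) - 1\<bar> \<le> (\<nu> * \<delta>)\<^sup>2 / 2" by (rule nbessel_near_0)
    also have "\<dots> = \<nu>\<^sup>2 * (\<delta> * \<delta>) / 2" by (simp add: power2_eq_square)
    also have "\<dots> \<le> \<nu>\<^sup>2 * \<delta>"
    proof -
      have "\<delta> * \<delta> \<le> \<delta> * 1" using d by (intro mult_left_mono) auto
      then have "\<nu>\<^sup>2 * (\<delta> * \<delta>) \<le> \<nu>\<^sup>2 * \<delta>" by (intro mult_left_mono) auto
      moreover have "0 \<le> \<nu>\<^sup>2 * \<delta>" using d by simp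
      ultimately show ?thesis by simp
    qed
    finally have g: "\<bar>nbessel (\<nu> * \<delta>) - 1\<bar> \<le> \<nu>\<^sup>2 * \<delta>" .
    have "\<bar>(nbessel (\<nu> * \<delta>) - 1) * x\<bar> \<le> \<nu>\<^sup>2 * \<delta> * 1"
      unfolding abs_mult using g by (intro mult_mono) (auto simp: x_def)
    moreover have "nbessel (\<nu> * \<delta>) * x - y = (nbessel (\<nu> * \<delta>) - 1) * x + (x - y)" by (simp add: algebra_simps)
    ultimately have b: "\<bar>nbessel (\<nu> * \<delta>) * x - y\<bar> \<le> (\<nu>\<^sup>2 + 2 * \<nu>) * \<delta>" using xy by (simp add: distrib_right)
    have "wave_term (R + \<sigma>) \<delta> n - \<nu> powr (-3/2) * y = \<nu> powr (-3/2) * (nbessel (\<nu> * \<delta>) * x - y)"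
      by (simp add: wave_term_def \<nu>_def[symmetric] x_def algebra_simps)
    then have "\<bar>wave_term (R + \<sigma>) \<delta> n - \<nu> powr (-3/2) * y\<bar> = \<nu> powr (-3/2) * \<bar>nbessel (\<nu> * \<delta>) * x - y\<bar>"
      by (simp add: abs_mult)
    also have "\<dots> \<le> \<nu> powr (-3/2) * ((\<nu>\<^sup>2 + 2 * \<nu>) * \<delta>)" using b by (intro mult_left_mono) auto
    finally show ?thesis by (simp add: \<nu>_def y_def mult.assoc)
  qed
  then have "(\<Sum>n\<in>freq_ball M. \<bar>wave_term (R + \<sigma>) \<delta> n - freq (emb n) powr (-3/2) * cos (freq (emb n) * R - 3 * pi / 4)\<bar>)
    \<le> (\<Sum>n\<in>freq_ball M. freq (emb n) powr (-3/2) * ((freq (emb n))\<^sup>2 + 2 * freq (emb n)) * \<delta>)"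
    by (rule sum_mono)
  then show ?thesis
    unfolding sum_subtractf[symmetric] low_const_def sum_distrib_right by (rule order_trans[OF sum_abs])
qed

lemma wave_sum_trig_poly:
  assumes d: "0 < \<delta>" "\<delta> \<le> 1" and \<sigma>: "\<bar>\<sigma>\<bar> = 2 * \<delta>" and K: "0 \<le> M" "M \<le> K"
  shows "\<bar>A * kap * wave_sum (R + \<sigma>) \<delta> - trig_poly M R\<bar> \<le>
    A * kap * (low_const M * \<delta> + \<bar>\<Sum>n\<in>freq_ball K - freq_ball M. wave_term (R + \<sigma>) \<delta> n\<bar> + 6 * \<delta> powr (- 1) * ztail (5/2) K)"
proof -
  define X where "X = (\<Sum>n\<in>freq_ball M. wave_term (R + \<sigma>) \<delta> n)"
  define Y where "Y = (\<Sum>n\<in>freq_ball K - freq_ball M. wave_term (R + \<sigma>) \<delta> n)"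
  define P where "P = (\<Sum>n\<in>freq_ball M. freq (emb n) powr (-3/2) * cos (freq (emb n) * R - 3 * pi / 4))"
  have "(\<Sum>n\<in>freq_ball K. wave_term (R + \<sigma>) \<delta> n) = Y + X"
    unfolding X_def Y_def by (rule sum.subset_diff[OF freq_ball_mono[OF K(2)] finite_freq_ball])
  moreover have "\<bar>wave_sum (R + \<sigma>) \<delta> - (\<Sum>n\<in>freq_ball K. wave_term (R + \<sigma>) \<delta> n)\<bar> \<le> 6 * \<delta> powr (- 1) * ztail (5/2) K"
    using d K by (intro wave_sum_truncation) auto
  moreover have "\<bar>X - P\<bar> \<le> low_const M * \<delta>" unfolding X_def P_def by (rule low_terms_bound[OF d \<sigma>])
  ultimately have b: "\<bar>wave_sum (R + \<sigma>) \<delta> - P\<bar> \<le> low_const M * \<delta> + \<bar>Y\<bar> + 6 * \<delta> powr (- 1) * ztail (5/2) K" by linarith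
  have "A * kap * wave_sum (R + \<sigma>) \<delta> - trig_poly M R = A * kap * (wave_sum (R + \<sigma>) \<delta> - P)"
    by (simp add: trig_poly_def P_def right_diff_distrib)
  then have "\<bar>A * kap * wave_sum (R + \<sigma>) \<delta> - trig_poly M R\<bar> = A * kap * \<bar>wave_sum (R + \<sigma>) \<delta> - P\<bar>"
    using A_pos kap_pos by (simp add: abs_mult)
  also have "\<dots> \<le> A * kap * (low_const M * \<delta> + \<bar>Y\<bar> + 6 * \<delta> powr (- 1) * ztail (5/2) K)"
    using b A_pos kap_pos by (intro mult_left_mono) auto
  finally show ?thesis by (simp add: Y_def)
qed

text \<open>\<open>F R\<close> lies between two wave sums up to the sandwich error, hence its
  distance to the polynomial is at most the sum of their distances and that error. The term in 1 / R
  is kept because replacing it by 1 would leave 1 / \<delta> in the mean; integrated over [1, T] it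
  gives only ln T / \<delta>.\<close>

lemma F_trig_poly_pointwise:
  assumes R: "1 \<le> R" "R \<le> T" and d: "0 < \<delta>" "\<delta> \<le> 1/8" and K: "0 \<le> M" "M \<le> K" and tl: "ztail (5/2) K \<le> \<delta> / T"
  defines "V \<equiv> \<lambda>\<sigma>. \<Sum>n\<in>freq_ball K - freq_ball M. wave_term (R + \<sigma>) \<delta> n"
  shows "(F R - trig_poly M R)\<^sup>2 \<le> 3 * (A * kap)\<^sup>2 * (V (2 * \<delta>))\<^sup>2 + 3 * (A * kap)\<^sup>2 * (V (- (2 * \<delta>)))\<^sup>2
    + 9 * ((2 * A * kap * low_const M * \<delta>)\<^sup>2 + (12 * A * kap / T)\<^sup>2 + 2 * W\<^sup>2 * \<delta>\<^sup>2 * T) + 18 * W\<^sup>2 / \<delta> * (1 / R)"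
proof -
  define k where "k = A * kap"
  have k: "k > 0" using A_pos kap_pos by (simp add: k_def)
  define er where "er = W * (\<delta> * sqrt R + 1 / (sqrt \<delta> * sqrt R))"
  have T: "T > 0" using R by linarith
  have "6 * \<delta> powr (- 1) * ztail (5/2) K \<le> 6 * \<delta> powr (- 1) * (\<delta> / T)" using tl by (intro mult_left_mono) auto
  also have "\<dots> = 6 / T" using d by (simp add: powr_minus_divide)
  finally have t6: "6 * \<delta> powr (- 1) * ztail (5/2) K \<le> 6 / T" .
  have w: "\<bar>k * wave_sum (R + \<sigma>) \<delta> - trig_poly M R\<bar> \<le> k * (low_const M * \<delta> + \<bar>V \<sigma>\<bar> + 6 / T)" if "\<bar>\<sigma>\<bar> = 2 * \<delta>" for \<sigma>
  proof -
    have "k * (low_const M * \<delta> + \<bar>V \<sigma>\<bar> + 6 * \<delta> powr (- 1) * ztail (5/2) K) \<le> k * (low_const M * \<delta> + \<bar>V \<sigma>\<bar> + 6 / T)"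
      using t6 k by (intro mult_left_mono add_left_mono) auto
    then show ?thesis
      using wave_sum_trig_poly[of \<delta> \<sigma> M K R] d that K unfolding k_def V_def by fastforce
  qed
  have f1: "F R \<le> k * wave_sum (R + 2 * \<delta>) \<delta> + er" and f2: "k * wave_sum (R + - (2 * \<delta>)) \<delta> - er \<le> F R"
    using F_wave_sum_bounds[OF R(1) d] by (simp_all add: k_def er_def)
  have w1: "\<bar>k * wave_sum (R + 2 * \<delta>) \<delta> - trig_poly M R\<bar> \<le> k * (low_const M * \<delta> + \<bar>V (2 * \<delta>)\<bar> + 6 / T)"
    by (rule w) (use d in simp)
  have w2: "\<bar>k * wave_sum (R + - (2 * \<delta>)) \<delta> - trig_poly M R\<bar> \<le> k * (low_const M * \<delta> + \<bar>V (- (2 * \<delta>))\<bar> + 6 / T)"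
    by (rule w) (use d in simp)
  define G where "G = 2 * k * low_const M * \<delta> + 12 * k / T + er"
  have "\<bar>F R - trig_poly M R\<bar> \<le> k * \<bar>V (2 * \<delta>)\<bar> + k * \<bar>V (- (2 * \<delta>))\<bar> + G"
  proof -
    have "k * (low_const M * \<delta> + \<bar>V s\<bar> + 6 / T) = k * low_const M * \<delta> + k * \<bar>V s\<bar> + 6 * k / T" for s
      by (simp add: distrib_left)
    then show ?thesis using w1 w2 f1 f2 unfolding G_def by (simp add: abs_le_iff)
  qed
  then have "\<bar>F R - trig_poly M R\<bar>\<^sup>2 \<le> (k * \<bar>V (2 * \<delta>)\<bar> + k * \<bar>V (- (2 * \<delta>))\<bar> + G)\<^sup>2" by (intro power_mono) auto
  also have "\<dots> \<le> 3 * ((k * \<bar>V (2 * \<delta>)\<bar>)\<^sup>2 + (k * \<bar>V (- (2 * \<delta>))\<bar>)\<^sup>2 + G\<^sup>2)" by (rule power2_sum3_le)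
  finally have 1: "(F R - trig_poly M R)\<^sup>2 \<le> 3 * k\<^sup>2 * (V (2 * \<delta>))\<^sup>2 + 3 * k\<^sup>2 * (V (- (2 * \<delta>)))\<^sup>2 + 3 * G\<^sup>2"
    by (simp add: power_mult_distrib)
  have 2: "G\<^sup>2 \<le> 3 * ((2 * k * low_const M * \<delta>)\<^sup>2 + (12 * k / T)\<^sup>2 + er\<^sup>2)" unfolding G_def by (rule power2_sum3_le)
  have 3: "er\<^sup>2 \<le> 2 * W\<^sup>2 * \<delta>\<^sup>2 * T + 2 * W\<^sup>2 / \<delta> * (1 / R)"
  proof -
    define x y where "x = \<delta> * sqrt R" and "y = 1 / (sqrt \<delta> * sqrt R)"
    have x2: "x\<^sup>2 = \<delta>\<^sup>2 * R" using R by (simp add: x_def power_mult_distrib)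
    have y2: "y\<^sup>2 = 1 / \<delta> * (1 / R)" using R d by (simp add: y_def power_divide power_mult_distrib)
    have "(x + y)\<^sup>2 \<le> 2 * (x\<^sup>2 + y\<^sup>2)" using sum_squares_bound[of x y] by (simp add: power2_sum)
    also have "\<dots> \<le> 2 * (\<delta>\<^sup>2 * T + 1 / \<delta> * (1 / R))" unfolding x2 y2 using R d by (intro mult_left_mono add_right_mono) auto
    finally have "W\<^sup>2 * (x + y)\<^sup>2 \<le> W\<^sup>2 * (2 * (\<delta>\<^sup>2 * T + 1 / \<delta> * (1 / R)))" by (intro mult_left_mono) auto
    moreover have "er\<^sup>2 = W\<^sup>2 * (x + y)\<^sup>2" by (simp only: er_def x_def y_def power_mult_distrib)
    moreover have "W\<^sup>2 * (2 * (\<delta>\<^sup>2 * T + 1 / \<delta> * (1 / R))) = 2 * W\<^sup>2 * \<delta>\<^sup>2 * T + 2 * W\<^sup>2 / \<delta> * (1 / R)"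
      by (simp add: distrib_left)
    ultimately show ?thesis by linarith
  qed
  have 4: "9 * (2 * W\<^sup>2 / \<delta> * (1 / R)) = 18 * W\<^sup>2 / \<delta> * (1 / R)" by simp
  have gen: "z \<le> p + q + 9 * (u + v + w) + j'"
    if "z \<le> p + q + 3 * g" "g \<le> 3 * (u + v + r)" "r \<le> w + j" "9 * j = j'" for z p q g u v r w j j' :: real
    using that by argo
  have "(F R - trig_poly M R)\<^sup>2 \<le> 3 * k\<^sup>2 * (V (2 * \<delta>))\<^sup>2 + 3 * k\<^sup>2 * (V (- (2 * \<delta>)))\<^sup>2
    + 9 * ((2 * k * low_const M * \<delta>)\<^sup>2 + (12 * k / T)\<^sup>2 + 2 * W\<^sup>2 * \<delta>\<^sup>2 * T) + 18 * W\<^sup>2 / \<delta> * (1 / R)"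
    by (rule gen[OF 1 2 3 4])
  then show ?thesis by (simp add: k_def mult.assoc)
qed

lemma mean_square_approximation:
  obtains K where "K \<ge> 0" "\<And>M. M \<ge> 0 \<Longrightarrow> \<exists>h. (h \<longlongrightarrow> 0) at_top \<and>
     (\<forall>T\<ge>1. 1 / T * (LBINT t:{1..T}. (F t - trig_poly M t)\<^sup>2) \<le> K * ztail (9/4) M + h T)"
proof -
  obtain K1 K2 where K1: "K1 \<ge> 0" and K2: "K2 \<ge> 0" and tail: "\<And>M K \<delta> \<sigma> T. T \<ge> 1 \<Longrightarrow> \<delta> > 0 \<Longrightarrow>
       (LBINT t:{1..T}. (\<Sum>n\<in>freq_ball K - freq_ball M. wave_term (t + \<sigma>) \<delta> n)\<^sup>2)
        \<le> T * (K1 * ztail (9/4) M + K2 * (T powr (-7/8) * \<delta> powr (-1/2) + exp (- (T powr (1/4)) / 2) * \<delta> powr (-2)))"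
    using tail_mean_square by blast
  define k where "k = A * kap"
  \<comment> \<open>With \<delta> = T^(-p) / 8 the terms \<delta>^2 T and ln T / (\<delta> T) both
    vanish in the limit for 1/2 < p < 1; here p = 3/4. The close pairs then contribute T^(-7/8)
    \<delta>^(-1/2), which is of order T^(-1/2).\<close>
  define d where "d = (\<lambda>T::real. T powr (-3/4) / 8)"
  define h where "h = (\<lambda>M T. 6 * k\<^sup>2 * K2 * (T powr (-7/8) * d T powr (-1/2) + exp (- (T powr (1/4)) / 2) * d T powr (-2))
     + 9 * ((2 * A * kap * low_const M)\<^sup>2 * (d T)\<^sup>2 + (12 * A * kap)\<^sup>2 * (1 / T\<^sup>2) + 2 * W\<^sup>2 * ((d T)\<^sup>2 * T)) + 18 * W\<^sup>2 * (ln T / (d T * T)))"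
  have lim: "(h M \<longlongrightarrow> 0) at_top" for M
  proof -
    have p1: "((\<lambda>T. T powr (-7/8) * d T powr (-1/2) + exp (- (T powr (1/4)) / 2) * d T powr (-2)) \<longlongrightarrow> 0) at_top"
      unfolding d_def by real_asymp
    have p2: "((\<lambda>T. (d T)\<^sup>2) \<longlongrightarrow> 0) at_top" unfolding d_def by real_asymp
    have p3: "((\<lambda>T::real. 1 / T\<^sup>2) \<longlongrightarrow> 0) at_top" by real_asymp
    have p4: "((\<lambda>T. (d T)\<^sup>2 * T) \<longlongrightarrow> 0) at_top" unfolding d_def by real_asymp
    have p5: "((\<lambda>T. ln T / (d T * T)) \<longlongrightarrow> 0) at_top" unfolding d_def by real_asymp
    have "(h M \<longlongrightarrow> 6 * k\<^sup>2 * K2 * 0 + 9 * ((2 * A * kap * low_const M)\<^sup>2 * 0 + (12 * A * kap)\<^sup>2 * 0 + 2 * W\<^sup>2 * 0) + 18 * W\<^sup>2 * 0) at_top"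
      unfolding h_def by (intro tendsto_add tendsto_mult_left p1 p2 p3 p4 p5)
    then show ?thesis by simp
  qed
  have main: "1 / T * (LBINT t:{1..T}. (F t - trig_poly M t)\<^sup>2) \<le> 6 * k\<^sup>2 * K1 * ztail (9/4) M + h M T" if M: "M \<ge> 0" and T: "T \<ge> 1" for M T
  proof -
    define \<delta> where "\<delta> = d T"
    have \<delta>0: "\<delta> > 0" using T by (simp add: \<delta>_def d_def)
    have "T powr (-3/4) \<le> T powr 0" using T by (intro powr_mono) auto
    then have \<delta>8: "\<delta> \<le> 1/8" using T by (simp add: \<delta>_def d_def)
    have "\<delta> / T > 0" using \<delta>0 T by simp
    \<comment> \<open>K depends on T and is so large that the truncation loss, 6 / \<delta> times
      the tail, is at most 6 / T.\<close>
    have "\<forall>\<^sub>F K in at_top. ztail (5/2) K < \<delta> / T" 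
      by (rule order_tendstoD(2)[OF ztail_tendsto_0 \<open>\<delta> / T > 0\<close>]) simp
    then have "\<forall>\<^sub>F K in at_top. ztail (5/2) K < \<delta> / T \<and> M \<le> K" using eventually_ge_at_top[of M] by (rule eventually_conj)
    then obtain K where K: "ztail (5/2) K < \<delta> / T" "M \<le> K" using eventually_happens'[of "at_top :: real filter"] by auto
    define V where "V = (\<lambda>\<sigma> t. \<Sum>n\<in>freq_ball K - freq_ball M. wave_term (t + \<sigma>) \<delta> n)"
    define H where "H = 9 * ((2 * A * kap * low_const M * \<delta>)\<^sup>2 + (12 * A * kap / T)\<^sup>2 + 2 * W\<^sup>2 * \<delta>\<^sup>2 * T)"
    define J where "J = 18 * W\<^sup>2 / \<delta>"
    define Y where "Y = K1 * ztail (9/4) M + K2 * (T powr (-7/8) * \<delta> powr (-1/2) + exp (- (T powr (1/4)) / 2) * \<delta> powr (-2))"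
    have Vi: "set_integrable lborel {1..T} (\<lambda>t. 3 * k\<^sup>2 * (V \<sigma> t)\<^sup>2)" for \<sigma>
      unfolding V_def wave_term_def by (intro borel_integrable_atLeastAtMost' continuous_intros)
    have Hi: "set_integrable lborel {1..T} (\<lambda>t. H)" by (intro borel_integrable_atLeastAtMost' continuous_intros)
    have Ji: "set_integrable lborel {1..T} (\<lambda>t. J * (1 / t))" by (intro borel_integrable_atLeastAtMost' continuous_intros) auto
    have Fi: "set_integrable lborel {1..T} (\<lambda>t. (F t - trig_poly M t)\<^sup>2)"
      by (intro bdd_meas_on_integrable bdd_meas_on_power2 bdd_meas_on_diff bdd_meas_on_F bdd_meas_on_continuous continuous_trig_poly)
    have "(LBINT t:{1..T}. (F t - trig_poly M t)\<^sup>2) \<le> (LBINT t:{1..T}. 3 * k\<^sup>2 * (V (2 * \<delta>) t)\<^sup>2 + 3 * k\<^sup>2 * (V (- (2 * \<delta>)) t)\<^sup>2 + H + J * (1 / t))"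
    proof (rule set_integral_mono)
      show "set_integrable lborel {1..T} (\<lambda>t. 3 * k\<^sup>2 * (V (2 * \<delta>) t)\<^sup>2 + 3 * k\<^sup>2 * (V (- (2 * \<delta>)) t)\<^sup>2 + H + J * (1 / t))"
        by (intro set_integral_add(1) Vi Hi Ji)
      fix t assume t: "t \<in> {1..T}"
      then show "(F t - trig_poly M t)\<^sup>2 \<le> 3 * k\<^sup>2 * (V (2 * \<delta>) t)\<^sup>2 + 3 * k\<^sup>2 * (V (- (2 * \<delta>)) t)\<^sup>2 + H + J * (1 / t)"
        using F_trig_poly_pointwise[of t T \<delta> M K] \<delta>0 \<delta>8 M K unfolding k_def V_def H_def J_def by simp
    qed (rule Fi)
    also have "\<dots> = 3 * k\<^sup>2 * (LBINT t:{1..T}. (V (2 * \<delta>) t)\<^sup>2) + 3 * k\<^sup>2 * (LBINT t:{1..T}. (V (- (2 * \<delta>)) t)\<^sup>2) + H * (T - 1) + J * ln T"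
      by (simp only: set_integral_add(2)[OF set_integral_add(1)[OF set_integral_add(1)[OF Vi Vi] Hi] Ji]
        set_integral_add(2)[OF set_integral_add(1)[OF Vi Vi] Hi] set_integral_add(2)[OF Vi Vi]
        set_integral_mult_right set_integral_inverse[OF T] set_integral_const[OF T])
    also have "\<dots> \<le> 3 * k\<^sup>2 * (T * Y) + 3 * k\<^sup>2 * (T * Y) + H * T + J * ln T"
    proof -
      have "(LBINT t:{1..T}. (V \<sigma> t)\<^sup>2) \<le> T * Y" for \<sigma> unfolding V_def Y_def by (rule tail[OF T \<delta>0])
      moreover have "H \<ge> 0" unfolding H_def using T by (intro mult_nonneg_nonneg add_nonneg_nonneg) auto
      ultimately show ?thesis by (intro add_mono mult_left_mono order_refl) auto
    qed
    also have "\<dots> = T * (6 * k\<^sup>2 * Y + H + J * (ln T / T))" using T by (simp add: field_simps)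
    finally have "1 / T * (LBINT t:{1..T}. (F t - trig_poly M t)\<^sup>2) \<le> 6 * k\<^sup>2 * Y + H + J * (ln T / T)"
      using T by (simp add: pos_divide_le_eq mult.commute)
    also have "6 * k\<^sup>2 * Y + H + J * (ln T / T) = 6 * k\<^sup>2 * K1 * ztail (9/4) M + h M T"
      by (simp add: Y_def H_def J_def h_def \<delta>_def[symmetric] power_mult_distrib power_divide distrib_left mult.assoc)
    finally show ?thesis .
  qed
  show thesis
  proof (rule that[of "6 * k\<^sup>2 * K1"])
    show "6 * k\<^sup>2 * K1 \<ge> 0" using K1 by simp
    show "\<exists>h. (h \<longlongrightarrow> 0) at_top \<and> (\<forall>T\<ge>1. 1 / T * (LBINT t:{1..T}. (F t - trig_poly M t)\<^sup>2) \<le> 6 * k\<^sup>2 * K1 * ztail (9/4) M + h T)"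
      if "M \<ge> 0" for M using lim[of M] main[OF that] by blast
  qed
qed

lemma mean_square_approximation_eventually:
  assumes "\<epsilon> > 0"
  shows "\<forall>\<^sub>F M in sequentially. \<forall>\<^sub>F T in at_top. 1 / T * (LBINT t:{1..T}. (F t - trig_poly (real M) t)\<^sup>2) \<le> \<epsilon>"
proof -
  obtain K where K: "K \<ge> 0" "\<And>M. M \<ge> 0 \<Longrightarrow> \<exists>h. (h \<longlongrightarrow> 0) at_top \<and>
     (\<forall>T\<ge>1. 1 / T * (LBINT t:{1..T}. (F t - trig_poly M t)\<^sup>2) \<le> K * ztail (9/4) M + h T)"
    using mean_square_approximation by blast
  have "((\<lambda>M. K * ztail (9/4) (real M)) \<longlongrightarrow> K * 0) sequentially"
    by (intro tendsto_intros filterlim_compose[OF ztail_tendsto_0 filterlim_real_sequentially]) simp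
  then have "\<forall>\<^sub>F M in sequentially. K * ztail (9/4) (real M) < \<epsilon> / 2"
    using assms by (intro order_tendstoD(2)) auto
  then show ?thesis
  proof eventually_elim
    case (elim M)
    obtain h where h: "(h \<longlongrightarrow> 0) at_top" "\<And>T. T \<ge> 1 \<Longrightarrow> 1 / T * (LBINT t:{1..T}. (F t - trig_poly (real M) t)\<^sup>2) \<le> K * ztail (9/4) (real M) + h T"
      using K(2)[of "real M"] by auto
    have "\<forall>\<^sub>F T in at_top. h T < \<epsilon> / 2" using h(1) assms by (intro order_tendstoD(2)) auto
    moreover have "\<forall>\<^sub>F T in at_top. (1::real) \<le> T" by (rule eventually_ge_at_top)
    ultimately show ?case
    proof eventually_elim
      case (elim T)
      then show ?case using h(2)[of T] \<open>K * ztail (9/4) (real M) < \<epsilon> / 2\<close> by linarith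
    qed
  qed
qed

end

section \<open>Covariances\<close>

abbreviation mean :: "real \<Rightarrow> (real \<Rightarrow> real) \<Rightarrow> real" where
  "mean T f \<equiv> 1 / T * (LBINT t:{1..T}. f t)"

lemma mean_mono:
  assumes "T \<ge> 1" "bdd_meas_on {1..T} f" "bdd_meas_on {1..T} g" "\<And>t. t \<in> {1..T} \<Longrightarrow> f t \<le> g t"
  shows "mean T f \<le> mean T g"
  using assms by (intro mult_left_mono set_integral_mono bdd_meas_on_integrable) auto

lemma mean_add:
  assumes "bdd_meas_on {1..T} f" "bdd_meas_on {1..T} g"
  shows "mean T (\<lambda>t. f t + g t) = mean T f + mean T g"
  using set_integral_add(2)[OF bdd_meas_on_integrable[OF assms(1)] bdd_meas_on_integrable[OF assms(2)]]
  by (simp add: distrib_left add_divide_distrib)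

lemma mean_diff:
  assumes "bdd_meas_on {1..T} f" "bdd_meas_on {1..T} g"
  shows "mean T (\<lambda>t. f t - g t) = mean T f - mean T g"
  using set_integral_diff(2)[OF bdd_meas_on_integrable[OF assms(1)] bdd_meas_on_integrable[OF assms(2)]]
  by (simp add: right_diff_distrib diff_divide_distrib)

lemma mean_cmult: "mean T (\<lambda>t. c * f t) = c * mean T f"
  by simp

lemma bdd_meas_on_cmult: "bdd_meas_on {x..y} f \<Longrightarrow> bdd_meas_on {x..y} (\<lambda>t. c * f t)"
  by (rule bdd_meas_on_mult[OF bdd_meas_on_continuous[OF continuous_on_const]])

lemma abs_mean_diff_le:
  assumes T: "T \<ge> 1" and f: "bdd_meas_on {1..T} f" and g: "bdd_meas_on {1..T} g" and h: "bdd_meas_on {1..T} h"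
    and le: "\<And>t. t \<in> {1..T} \<Longrightarrow> \<bar>f t - g t\<bar> \<le> h t"
  shows "\<bar>mean T f - mean T g\<bar> \<le> mean T h"
proof -
  have "mean T (\<lambda>t. f t - g t) \<le> mean T h" "mean T (\<lambda>t. g t - f t) \<le> mean T h"
    using le by (intro mean_mono T bdd_meas_on_diff f g h; fastforce simp: abs_le_iff)+
  then show ?thesis unfolding mean_diff[OF f g] mean_diff[OF g f] by linarith
qed

text \<open>With the approximation errors u and v, F1 F2 - P1 P2 = u P2 + v P1 + u v, and each
  product is split by a weighted AM-GM. The bound K has to be independent of M, because the weight
  is fixed in terms of K before M is chosen.\<close>

lemma has_covariance_approximation:
  fixes F1 F2 :: "real \<Rightarrow> real" and P1 P2 :: "nat \<Rightarrow> real \<Rightarrow> real"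
  assumes F: "\<And>T. bdd_meas_on {1..T} F1" "\<And>T. bdd_meas_on {1..T} F2"
    and P: "\<And>T M. bdd_meas_on {1..T} (P1 M)" "\<And>T M. bdd_meas_on {1..T} (P2 M)"
    and m1: "\<And>\<epsilon>. \<epsilon> > 0 \<Longrightarrow> \<forall>\<^sub>F M in sequentially. \<forall>\<^sub>F T in at_top. mean T (\<lambda>t. (F1 t - P1 M t)\<^sup>2) \<le> \<epsilon>"
    and m2: "\<And>\<epsilon>. \<epsilon> > 0 \<Longrightarrow> \<forall>\<^sub>F M in sequentially. \<forall>\<^sub>F T in at_top. mean T (\<lambda>t. (F2 t - P2 M t)\<^sup>2) \<le> \<epsilon>"
    and q1: "\<And>M. \<forall>\<^sub>F T in at_top. mean T (\<lambda>t. (P1 M t)\<^sup>2) \<le> K"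
    and q2: "\<And>M. \<forall>\<^sub>F T in at_top. mean T (\<lambda>t. (P2 M t)\<^sup>2) \<le> K"
    and c: "\<And>M. ((\<lambda>T. mean T (\<lambda>t. P1 M t * P2 M t)) \<longlongrightarrow> c M) at_top" and C: "c \<longlonglongrightarrow> C"
  shows "has_covariance F1 F2 C"
proof -
  have "((\<lambda>T. mean T (\<lambda>t. F1 t * F2 t)) \<longlongrightarrow> C) at_top"
  proof (rule tendstoI)
    fix \<epsilon> :: real assume \<epsilon>: "\<epsilon> > 0"
    \<comment> \<open>The weight \<kappa> keeps the contribution of the polynomials at most
      \<epsilon> / 8; then \<epsilon>1 does the same for that of the errors, which is amplified by 1
      / \<kappa>.\<close>
    define \<kappa> where "\<kappa> = \<epsilon> / (8 * (\<bar>K\<bar> + 1))"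
    have \<kappa>: "\<kappa> > 0" using \<epsilon> by (simp add: \<kappa>_def add_nonneg_pos)
    have \<kappa>K: "\<kappa> * K \<le> \<epsilon> / 8"
    proof -
      have "\<kappa> * K \<le> \<kappa> * (\<bar>K\<bar> + 1)" using \<kappa> by (intro mult_left_mono) auto
      also have "\<dots> = \<epsilon> / 8" unfolding \<kappa>_def by (simp add: field_simps)
      finally show ?thesis .
    qed
    define \<epsilon>1 where "\<epsilon>1 = \<epsilon> / 8 / (1 / \<kappa> + 1)"
    have \<epsilon>1: "\<epsilon>1 > 0" using \<epsilon> \<kappa> by (simp add: \<epsilon>1_def add_pos_pos)
    have \<epsilon>1\<kappa>: "(1 / \<kappa> + 1) * \<epsilon>1 = \<epsilon> / 8"
    proof -
      have "1 / \<kappa> + 1 \<noteq> 0" using \<kappa> by (metis add_pos_pos divide_pos_pos less_irrefl zero_less_one)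
      moreover have "y * (z / y) = z" if "y \<noteq> 0" for y z :: real using that by simp
      ultimately show ?thesis unfolding \<epsilon>1_def by blast
    qed
    have "\<forall>\<^sub>F M in sequentially. dist (c M) C < \<epsilon> / 4" using \<epsilon> by (intro tendstoD[OF C]) auto
    with m1[OF \<epsilon>1] m2[OF \<epsilon>1]
    have "\<forall>\<^sub>F M in sequentially. (\<forall>\<^sub>F T in at_top. mean T (\<lambda>t. (F1 t - P1 M t)\<^sup>2) \<le> \<epsilon>1) \<and>
       (\<forall>\<^sub>F T in at_top. mean T (\<lambda>t. (F2 t - P2 M t)\<^sup>2) \<le> \<epsilon>1) \<and> dist (c M) C < \<epsilon> / 4"
      by (intro eventually_conj)
    then obtain M where M: "\<forall>\<^sub>F T in at_top. mean T (\<lambda>t. (F1 t - P1 M t)\<^sup>2) \<le> \<epsilon>1"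
       "\<forall>\<^sub>F T in at_top. mean T (\<lambda>t. (F2 t - P2 M t)\<^sup>2) \<le> \<epsilon>1" "dist (c M) C < \<epsilon> / 4"
      using eventually_happens'[OF sequentially_bot] by blast
    have cM: "\<forall>\<^sub>F T in at_top. dist (mean T (\<lambda>t. P1 M t * P2 M t)) (c M) < \<epsilon> / 4" using \<epsilon> by (intro tendstoD[OF c]) auto
    show "\<forall>\<^sub>F T in at_top. dist (mean T (\<lambda>t. F1 t * F2 t)) C < \<epsilon>"
      using M(1,2) q1[of M] q2[of M] cM eventually_ge_at_top[of "1::real"]
    proof eventually_elim
      case (elim T)
      define x y p q where "x = (\<lambda>t. (F1 t - P1 M t)\<^sup>2)" and "y = (\<lambda>t. (F2 t - P2 M t)\<^sup>2)"
        and "p = (\<lambda>t. (P1 M t)\<^sup>2)" and "q = (\<lambda>t. (P2 M t)\<^sup>2)"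
      have b: "bdd_meas_on {1..T} x" "bdd_meas_on {1..T} y" "bdd_meas_on {1..T} p" "bdd_meas_on {1..T} q"
        unfolding x_def y_def p_def q_def by (intro bdd_meas_on_power2 bdd_meas_on_diff F P)+
      define r where "r = (1 / \<kappa> + 1) / 2"
      have pw: "\<bar>F1 t * F2 t - P1 M t * P2 M t\<bar> \<le> r * (x t + y t) + \<kappa> / 2 * (p t + q t)" for t
      proof -
        define u v where "u = F1 t - P1 M t" and "v = F2 t - P2 M t"
        have ag: "\<bar>z * w\<bar> \<le> (z\<^sup>2 / \<kappa> + \<kappa> * w\<^sup>2) / 2" for z w :: real
        proof -
          have "0 \<le> (\<bar>z\<bar> - \<kappa> * \<bar>w\<bar>)\<^sup>2" by simp
          then have "2 * \<kappa> * \<bar>z * w\<bar> \<le> z\<^sup>2 + \<kappa>\<^sup>2 * w\<^sup>2" by (simp add: power2_diff power_mult_distrib abs_mult mult_ac)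
          then have le: "2 * \<kappa> * \<bar>z * w\<bar> / \<kappa> \<le> (z\<^sup>2 + \<kappa>\<^sup>2 * w\<^sup>2) / \<kappa>" using \<kappa> by (intro divide_right_mono) auto
          have e1: "2 * \<kappa> * \<bar>z * w\<bar> / \<kappa> = 2 * \<bar>z * w\<bar>" using \<kappa> by simp
          have e2: "(z\<^sup>2 + \<kappa>\<^sup>2 * w\<^sup>2) / \<kappa> = z\<^sup>2 / \<kappa> + \<kappa> * w\<^sup>2" using \<kappa> by (simp add: add_divide_distrib power2_eq_square)
          have "2 * \<bar>z * w\<bar> \<le> z\<^sup>2 / \<kappa> + \<kappa> * w\<^sup>2" using le unfolding e1 e2 .
          then show ?thesis by simp
        qed
        have uv: "\<bar>u * v\<bar> \<le> (u\<^sup>2 + v\<^sup>2) / 2"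
          using sum_squares_bound[of "\<bar>u\<bar>" "\<bar>v\<bar>"] by (simp add: abs_mult)
        have "F1 t * F2 t - P1 M t * P2 M t = u * P2 M t + v * P1 M t + u * v"
          by (simp add: u_def v_def algebra_simps)
        then have "\<bar>F1 t * F2 t - P1 M t * P2 M t\<bar> \<le> \<bar>u * P2 M t\<bar> + \<bar>v * P1 M t\<bar> + \<bar>u * v\<bar>" by linarith
        also have "\<dots> \<le> (u\<^sup>2 / \<kappa> + \<kappa> * (P2 M t)\<^sup>2) / 2 + (v\<^sup>2 / \<kappa> + \<kappa> * (P1 M t)\<^sup>2) / 2 + (u\<^sup>2 + v\<^sup>2) / 2"
          by (intro add_mono ag uv)
        also have "\<dots> = r * (x t + y t) + \<kappa> / 2 * (p t + q t)"
          by (simp add: r_def x_def y_def p_def q_def u_def[symmetric] v_def[symmetric] field_simps)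
        finally show ?thesis .
      qed
      have h: "bdd_meas_on {1..T} (\<lambda>t. r * (x t + y t))" "bdd_meas_on {1..T} (\<lambda>t. \<kappa> / 2 * (p t + q t))"
        by (intro bdd_meas_on_cmult bdd_meas_on_add b)+
      have "\<bar>mean T (\<lambda>t. F1 t * F2 t) - mean T (\<lambda>t. P1 M t * P2 M t)\<bar> \<le> mean T (\<lambda>t. r * (x t + y t) + \<kappa> / 2 * (p t + q t))"
        using elim by (intro abs_mean_diff_le bdd_meas_on_mult bdd_meas_on_add h F P pw) auto
      also have "\<dots> = r * (mean T x + mean T y) + \<kappa> / 2 * (mean T p + mean T q)"
        unfolding mean_add[OF h] mean_cmult mean_add[OF b(1,2)] mean_add[OF b(3,4)] ..
      also have "\<dots> \<le> r * (\<epsilon>1 + \<epsilon>1) + \<kappa> / 2 * (K + K)"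
        using elim \<kappa> unfolding x_def y_def p_def q_def by (intro add_mono mult_left_mono) (auto simp: r_def)
      also have "\<dots> = (1 / \<kappa> + 1) * \<epsilon>1 + \<kappa> * K" by (simp add: r_def)
      also have "\<dots> \<le> \<epsilon> / 8 + \<epsilon> / 8" unfolding \<epsilon>1\<kappa> using \<kappa>K by simp
      finally have "\<bar>mean T (\<lambda>t. F1 t * F2 t) - mean T (\<lambda>t. P1 M t * P2 M t)\<bar> \<le> \<epsilon> / 4" by simp
      moreover have "\<bar>mean T (\<lambda>t. P1 M t * P2 M t) - c M\<bar> < \<epsilon> / 4" using elim by (simp only: dist_real_def)
      moreover have "\<bar>c M - C\<bar> < \<epsilon> / 4" using M(3) by (simp only: dist_real_def)
      ultimately have "\<bar>mean T (\<lambda>t. F1 t * F2 t) - C\<bar> < \<epsilon>" using \<epsilon> by linarith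
      then show ?case by (simp only: dist_real_def)
    qed
  qed
  then show ?thesis unfolding has_covariance_def
    by (auto intro!: bdd_meas_on_integrable bdd_meas_on_mult F)
qed

lemma mean_sum:
  assumes "\<And>i. i \<in> I \<Longrightarrow> bdd_meas_on {1..T} (f i)"
  shows "mean T (\<lambda>t. \<Sum>i\<in>I. f i t) = (\<Sum>i\<in>I. mean T (f i))"
proof -
  have "(LBINT t:{1..T}. \<Sum>i\<in>I. f i t) = (\<Sum>i\<in>I. LBINT t:{1..T}. f i t)"
    unfolding set_lebesgue_integral_def scaleR_sum_right
    by (rule Bochner_Integration.integral_sum) (use assms bdd_meas_on_integrable in \<open>auto simp: set_integrable_def\<close>)
  then show ?thesis by (simp only: sum_distrib_left)
qed

section \<open>Distinct frequencies and their multiplicities\<close>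

context pos_form begin

definition mult_of :: "real \<Rightarrow> nat" where
  "mult_of \<nu> = card {n. freq (emb n) = \<nu>}"

definition spec :: "real set" where
  "spec = {\<nu>. \<nu> > 0 \<and> mult_of \<nu> \<noteq> 0}"

lemma finite_freq_eq: "finite {n. freq (emb n) = \<nu>}"
  by (rule finite_subset[OF _ finite_freq_le[of \<nu>]]) auto

lemma mult_of_eq_0_iff: "mult_of \<nu> = 0 \<longleftrightarrow> (\<forall>n. freq (emb n) \<noteq> \<nu>)"
  using finite_freq_eq[of \<nu>] by (auto simp: mult_of_def card_eq_0_iff)

lemma freq_ball_image: "(\<lambda>n. freq (emb n)) ` freq_ball M = {\<nu> \<in> spec. \<nu> \<le> M}"
proof (intro set_eqI iffI)
  fix \<nu> assume "\<nu> \<in> (\<lambda>n. freq (emb n)) ` freq_ball M"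
  then obtain n where n: "n \<in> freq_ball M" "\<nu> = freq (emb n)" by blast
  then show "\<nu> \<in> {\<nu> \<in> spec. \<nu> \<le> M}"
  proof -
    have "mult_of \<nu> \<noteq> 0" using n(2) mult_of_eq_0_iff by blast
    with n freq_ball_pos[OF n(1)] show ?thesis by (simp add: spec_def freq_ball_def)
  qed
next
  fix \<nu> assume \<nu>: "\<nu> \<in> {\<nu> \<in> spec. \<nu> \<le> M}"
  then obtain n where n: "freq (emb n) = \<nu>" using mult_of_eq_0_iff[of \<nu>] by (auto simp: spec_def)
  then have "n \<noteq> 0" using \<nu> by (auto simp: spec_def)
  with n \<nu> have "n \<in> freq_ball M" by (simp add: freq_ball_def)
  with n show "\<nu> \<in> (\<lambda>n. freq (emb n)) ` freq_ball M" by blast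
qed

lemma finite_spec_le: "finite {\<nu> \<in> spec. \<nu> \<le> M}"
  unfolding freq_ball_image[symmetric] by (intro finite_imageI finite_freq_ball)

lemma freq_ball_fibre:
  assumes "0 < \<nu>" "\<nu> \<le> M" shows "{n \<in> freq_ball M. freq (emb n) = \<nu>} = {n. freq (emb n) = \<nu>}"
  using assms by (auto simp: freq_ball_def)

lemma sum_freq_ball_group:
  "(\<Sum>n\<in>freq_ball M. H (freq (emb n))) = (\<Sum>\<nu>\<in>{\<nu> \<in> spec. \<nu> \<le> M}. real (mult_of \<nu>) * H \<nu>)"
proof -
  have "(\<Sum>n\<in>freq_ball M. H (freq (emb n))) = (\<Sum>\<nu>\<in>{\<nu> \<in> spec. \<nu> \<le> M}. \<Sum>n\<in>{n \<in> freq_ball M. freq (emb n) = \<nu>}. H (freq (emb n)))"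
    by (rule sum.group[symmetric]) (auto simp: finite_freq_ball finite_spec_le freq_ball_image)
  also have "\<dots> = (\<Sum>\<nu>\<in>{\<nu> \<in> spec. \<nu> \<le> M}. real (mult_of \<nu>) * H \<nu>)"
    by (intro sum.cong refl) (auto simp: freq_ball_fibre mult_of_def spec_def)
  finally show ?thesis .
qed

text \<open>Lattice points with the same frequency lie in one thin annulus; the width 1 / (1 +
  \<nu>) makes its area term O(1), so that the counting error decides.\<close>

lemma mult_of_bound:
  obtains C where "C > 0" "\<And>n. n \<noteq> 0 \<Longrightarrow> real (mult_of (freq (emb n))) \<le> C * freq (emb n) powr (3/4)"
proof -
  obtain C0 where C0: "C0 > 0" 
    "\<And>\<nu> \<eta>. \<nu> \<ge> 0 \<Longrightarrow> 0 < \<eta> \<Longrightarrow> \<eta> \<le> 1 \<Longrightarrow> real (card {m. \<bar>freq (emb m) - \<nu>\<bar> \<le> \<eta>}) \<le> C0 * (\<nu> * \<eta> + (1 + \<nu>) powr (3/4))"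
    using freq_annulus_count by blast
  define q where "q = (1 + 1 / fmin) powr (3/4)"
  have "1 + 1 / fmin > 0" using fmin_pos by (intro add_pos_pos) auto
  then have q: "q > 0" unfolding q_def powr_gt_zero by linarith
  have "real (mult_of (freq (emb n))) \<le> (C0 * 2 * q) * freq (emb n) powr (3/4)" if n: "n \<noteq> 0" for n
  proof -
    define \<nu> where "\<nu> = freq (emb n)"
    define \<eta> where "\<eta> = 1 / (1 + \<nu>)"
    have \<nu>: "\<nu> > 0" using freq_pos[OF n] by (simp add: \<nu>_def)
    have \<eta>: "0 < \<eta>" "\<eta> \<le> 1" "\<nu> * \<eta> \<le> 1" using \<nu> by (auto simp: \<eta>_def field_simps)
    have one: "1 \<le> (1 + \<nu>) powr (3/4)" using \<nu> by (intro ge_one_powr_ge_zero) auto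
    have "{m. \<bar>freq (emb m) - \<nu>\<bar> \<le> \<eta>} \<subseteq> {m. freq (emb m) \<le> \<nu> + \<eta>}" by auto
    then have "finite {m. \<bar>freq (emb m) - \<nu>\<bar> \<le> \<eta>}" using finite_freq_le by (rule finite_subset)
    moreover have "{m. freq (emb m) = \<nu>} \<subseteq> {m. \<bar>freq (emb m) - \<nu>\<bar> \<le> \<eta>}" using \<eta> by auto
    ultimately have "real (mult_of \<nu>) \<le> real (card {m. \<bar>freq (emb m) - \<nu>\<bar> \<le> \<eta>})"
      by (simp add: mult_of_def card_mono)
    also have "\<dots> \<le> C0 * (\<nu> * \<eta> + (1 + \<nu>) powr (3/4))" using \<nu> \<eta> by (intro C0(2)) auto
    also have "\<dots> \<le> C0 * (2 * (q * \<nu> powr (3/4)))"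
    proof (rule mult_left_mono)
      show "\<nu> * \<eta> + (1 + \<nu>) powr (3/4) \<le> 2 * (q * \<nu> powr (3/4))"
        using \<eta>(3) one one_plus_freq_powr_le[OF n] unfolding \<nu>_def[symmetric] q_def[symmetric] by linarith
    qed (use C0(1) in simp)
    finally show ?thesis by (simp add: \<nu>_def)
  qed
  moreover have "C0 * 2 * q > 0" using C0(1) q by simp
  ultimately show thesis using that by blast
qed

text \<open>Ungrouping one factor of the square gives a sum over lattice points of multiplicity /
  \<nu>^3, which \<open>mult_of_bound\<close> bounds by a multiple of the sum of
  \<nu>^(-9/4).\<close>

lemma mult_of_square_sum_bound:
  obtains C where "\<And>M. (\<Sum>\<nu>\<in>{\<nu> \<in> spec. \<nu> \<le> M}. (real (mult_of \<nu>))\<^sup>2 / \<nu> ^ 3) \<le> C"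
proof -
  obtain C0 where C0: "C0 > 0" "\<And>n. n \<noteq> 0 \<Longrightarrow> real (mult_of (freq (emb n))) \<le> C0 * freq (emb n) powr (3/4)"
    using mult_of_bound by blast
  have "(\<Sum>\<nu>\<in>{\<nu> \<in> spec. \<nu> \<le> M}. (real (mult_of \<nu>))\<^sup>2 / \<nu> ^ 3) \<le> C0 * zsum (9/4)" for M
  proof -
    have "(\<Sum>\<nu>\<in>{\<nu> \<in> spec. \<nu> \<le> M}. (real (mult_of \<nu>))\<^sup>2 / \<nu> ^ 3) = (\<Sum>n\<in>freq_ball M. real (mult_of (freq (emb n))) / freq (emb n) ^ 3)"
      unfolding sum_freq_ball_group[where H = "\<lambda>\<nu>. real (mult_of \<nu>) / \<nu> ^ 3"] by (simp add: power2_eq_square)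
    also have "\<dots> \<le> (\<Sum>n\<in>freq_ball M. C0 * freq (emb n) powr (- (9/4)))"
    proof (rule sum_mono)
      fix n assume n: "n \<in> freq_ball M"
      define \<nu> where "\<nu> = freq (emb n)"
      have \<nu>: "\<nu> > 0" using freq_ball_pos[OF n] by (simp add: \<nu>_def)
      have "real (mult_of \<nu>) / \<nu> ^ 3 \<le> (C0 * \<nu> powr (3/4)) / \<nu> ^ 3"
        using n C0(2)[of n] \<nu> by (intro divide_right_mono) (auto simp: \<nu>_def freq_ball_def)
      also have "\<dots> = C0 * (\<nu> powr (3/4) * \<nu> powr (-3))" using \<nu> by (simp add: powr_minus_divide powr_numeral)
      also have "\<nu> powr (3/4) * \<nu> powr (-3) = \<nu> powr (- (9/4))" by (subst powr_add[symmetric]) simp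
      finally show "real (mult_of (freq (emb n))) / freq (emb n) ^ 3 \<le> C0 * freq (emb n) powr (- (9/4))" by (simp add: \<nu>_def)
    qed
    also have "\<dots> \<le> C0 * zsum (9/4)"
      unfolding sum_distrib_left[symmetric] using C0(1) by (intro mult_left_mono sum_freq_powr_le_zsum finite_freq_ball) auto
    finally show ?thesis .
  qed
  then show thesis using that by blast
qed

lemma mult_of_square_summable: "(\<lambda>\<nu>. (real (mult_of \<nu>))\<^sup>2 / \<nu> ^ 3) summable_on spec"
proof -
  obtain C where C: "\<And>M. (\<Sum>\<nu>\<in>{\<nu> \<in> spec. \<nu> \<le> M}. (real (mult_of \<nu>))\<^sup>2 / \<nu> ^ 3) \<le> C"
    using mult_of_square_sum_bound by blast
  have pos: "\<nu> \<in> spec \<Longrightarrow> 0 \<le> (real (mult_of \<nu>))\<^sup>2 / \<nu> ^ 3" for \<nu> by (simp add: spec_def)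
  show ?thesis
  proof (rule nonneg_bdd_above_summable_on)
    show "bdd_above (sum (\<lambda>\<nu>. (real (mult_of \<nu>))\<^sup>2 / \<nu> ^ 3) ` {F. F \<subseteq> spec \<and> finite F})"
    proof (rule bdd_aboveI2)
      fix X assume "X \<in> {F. F \<subseteq> spec \<and> finite F}"
      then have X: "X \<subseteq> spec" "finite X" by auto
      have "X \<subseteq> {\<nu> \<in> spec. \<nu> \<le> Max (insert 0 X)}" using X by auto
      then have "(\<Sum>\<nu>\<in>X. (real (mult_of \<nu>))\<^sup>2 / \<nu> ^ 3) \<le> (\<Sum>\<nu>\<in>{\<nu> \<in> spec. \<nu> \<le> Max (insert 0 X)}. (real (mult_of \<nu>))\<^sup>2 / \<nu> ^ 3)"
        using pos by (intro sum_mono2 finite_spec_le) auto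
      also have "\<dots> \<le> C" by (rule C)
      finally show "(\<Sum>\<nu>\<in>X. (real (mult_of \<nu>))\<^sup>2 / \<nu> ^ 3) \<le> C" .
    qed
  qed (use pos in auto)
qed

end

text \<open>In the double sum only pairs with equal frequencies have a nonzero mean, namely
  \<nu>^(-3) / 2, and a common frequency arises from as many pairs as the product of its
  multiplicities. The phase 3 pi / 4 is the same for both forms and drops out.\<close>

lemma trig_poly_covariance:
  assumes X: "pos_form a b c" and Y: "pos_form d e f"
  shows "((\<lambda>T. mean T (\<lambda>t. pos_form.trig_poly a b c M t * pos_form.trig_poly d e f M t)) \<longlongrightarrow>
     pos_form.A a b c * pos_form.A d e f * pos_form.kap\<^sup>2 / 2 *
     (\<Sum>\<nu>\<in>{\<nu> \<in> pos_form.spec a b c \<inter> pos_form.spec d e f. \<nu> \<le> M}.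
        real (pos_form.mult_of a b c \<nu>) * real (pos_form.mult_of d e f \<nu>) / \<nu> ^ 3)) at_top"
proof -
  interpret X: pos_form a b c by (rule X)
  interpret Y: pos_form d e f by (rule Y)
  define k where "k = X.A * Y.A * X.kap\<^sup>2"
  define u where "u = (\<lambda>n t. X.freq (emb n) powr (-3/2) * cos (X.freq (emb n) * t - 3 * pi / 4))"
  define v where "v = (\<lambda>n t. Y.freq (emb n) powr (-3/2) * cos (Y.freq (emb n) * t - 3 * pi / 4))"
  have bu: "bdd_meas_on {1..T} (\<lambda>t. u n t * v m t)" for T n m
    unfolding u_def v_def by (intro bdd_meas_on_continuous continuous_intros)
  have bs: "bdd_meas_on {1..T} (\<lambda>t. \<Sum>m\<in>Y.freq_ball M. u n t * v m t)" for T n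
    unfolding u_def v_def by (intro bdd_meas_on_continuous continuous_intros)
  have e: "mean T (\<lambda>t. X.trig_poly M t * Y.trig_poly M t) = k * (\<Sum>n\<in>X.freq_ball M. \<Sum>m\<in>Y.freq_ball M. mean T (\<lambda>t. u n t * v m t))" for T
  proof -
    have "X.trig_poly M t * Y.trig_poly M t = k * (\<Sum>n\<in>X.freq_ball M. \<Sum>m\<in>Y.freq_ball M. u n t * v m t)" for t
    proof -
      have "X.trig_poly M t * Y.trig_poly M t = k * ((\<Sum>n\<in>X.freq_ball M. u n t) * (\<Sum>m\<in>Y.freq_ball M. v m t))"
        by (simp add: X.trig_poly_def Y.trig_poly_def k_def u_def v_def power2_eq_square)
      then show ?thesis by (simp only: sum_product)
    qed
    then have "mean T (\<lambda>t. X.trig_poly M t * Y.trig_poly M t) = k * mean T (\<lambda>t. \<Sum>n\<in>X.freq_ball M. \<Sum>m\<in>Y.freq_ball M. u n t * v m t)"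
      by (simp only: mean_cmult)
    also have "\<dots> = k * (\<Sum>n\<in>X.freq_ball M. \<Sum>m\<in>Y.freq_ball M. mean T (\<lambda>t. u n t * v m t))"
      by (subst mean_sum[OF bs], subst mean_sum[OF bu]) (rule refl)
    finally show ?thesis .
  qed
  have lim: "((\<lambda>T. mean T (\<lambda>t. u n t * v m t)) \<longlongrightarrow> (if X.freq (emb n) = Y.freq (emb m) then 1 / X.freq (emb n) ^ 3 / 2 else 0)) at_top"
    if n: "n \<in> X.freq_ball M" and m: "m \<in> Y.freq_ball M" for n m
  proof -
    define x y where "x = X.freq (emb n)" and "y = Y.freq (emb m)"
    have xy: "x > 0" "y > 0" using X.freq_ball_pos[OF n] Y.freq_ball_pos[OF m] by (auto simp: x_def y_def)
    have e1: "mean T (\<lambda>t. u n t * v m t) = x powr (-3/2) * y powr (-3/2) * mean T (\<lambda>t. cos (x * t + (- (3 * pi / 4))) * cos (y * t + (- (3 * pi / 4))))" for T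
      unfolding mean_cmult[symmetric] by (simp add: u_def v_def x_def[symmetric] y_def[symmetric] mult_ac)
    have l: "((\<lambda>T. x powr (-3/2) * y powr (-3/2) * mean T (\<lambda>t. cos (x * t + (- (3 * pi / 4))) * cos (y * t + (- (3 * pi / 4)))))
       \<longlongrightarrow> x powr (-3/2) * y powr (-3/2) * (if x = y then 1/2 else 0)) at_top"
      by (intro tendsto_mult_left mean_cos_product xy)
    have e2: "x powr (-3/2) * y powr (-3/2) * (if x = y then 1/2 else 0) = (if x = y then 1 / x ^ 3 / 2 else 0)"
    proof (cases "x = y")
      case True
      have "x powr (-3/2) * x powr (-3/2) = x powr (-3)" by (subst powr_add[symmetric]) simp
      then show ?thesis using True xy by (simp add: powr_minus_divide powr_numeral)
    qed simp
    have "((\<lambda>T. mean T (\<lambda>t. u n t * v m t)) \<longlongrightarrow> (if x = y then 1 / x ^ 3 / 2 else 0)) at_top"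
      unfolding e1 e2[symmetric] by (rule l)
    then show ?thesis by (simp only: x_def y_def)
  qed
  have "((\<lambda>T. mean T (\<lambda>t. X.trig_poly M t * Y.trig_poly M t)) \<longlongrightarrow>
     k * (\<Sum>n\<in>X.freq_ball M. \<Sum>m\<in>Y.freq_ball M. if X.freq (emb n) = Y.freq (emb m) then 1 / X.freq (emb n) ^ 3 / 2 else 0)) at_top"
    unfolding e by (intro tendsto_mult_left tendsto_sum lim)
  also have "(\<Sum>n\<in>X.freq_ball M. \<Sum>m\<in>Y.freq_ball M. if X.freq (emb n) = Y.freq (emb m) then 1 / X.freq (emb n) ^ 3 / 2 else 0)
     = (\<Sum>n\<in>X.freq_ball M. real (Y.mult_of (X.freq (emb n))) / X.freq (emb n) ^ 3 / 2)"
  proof (intro sum.cong refl)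
    fix n assume n: "n \<in> X.freq_ball M"
    define x where "x = X.freq (emb n)"
    have x: "0 < x" "x \<le> M" using X.freq_ball_pos[OF n] n by (auto simp: x_def X.freq_ball_def)
    have "(\<Sum>m\<in>Y.freq_ball M. if x = Y.freq (emb m) then 1 / x ^ 3 / 2 else 0) = (\<Sum>m\<in>{m \<in> Y.freq_ball M. Y.freq (emb m) = x}. 1 / x ^ 3 / 2)"
      unfolding sum.inter_filter[OF Y.finite_freq_ball] by (rule sum.cong[OF refl]) (simp only: eq_commute[of x])
    also have "\<dots> = real (Y.mult_of x) / x ^ 3 / 2" unfolding Y.freq_ball_fibre[OF x] by (simp add: Y.mult_of_def)
    finally show "(\<Sum>m\<in>Y.freq_ball M. if X.freq (emb n) = Y.freq (emb m) then 1 / X.freq (emb n) ^ 3 / 2 else 0)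
      = real (Y.mult_of (X.freq (emb n))) / X.freq (emb n) ^ 3 / 2" by (simp only: x_def)
  qed
  also have "\<dots> = (\<Sum>\<nu>\<in>{\<nu> \<in> X.spec. \<nu> \<le> M}. real (X.mult_of \<nu>) * (real (Y.mult_of \<nu>) / \<nu> ^ 3 / 2))"
    by (rule X.sum_freq_ball_group)
  also have "\<dots> = (\<Sum>\<nu>\<in>{\<nu> \<in> X.spec \<inter> Y.spec. \<nu> \<le> M}. real (X.mult_of \<nu>) * (real (Y.mult_of \<nu>) / \<nu> ^ 3 / 2))"
    by (rule sum.mono_neutral_right[OF X.finite_spec_le]) (auto simp: X.spec_def Y.spec_def)
  also have "k * \<dots> = k / 2 * (\<Sum>\<nu>\<in>{\<nu> \<in> X.spec \<inter> Y.spec. \<nu> \<le> M}. real (X.mult_of \<nu>) * real (Y.mult_of \<nu>) / \<nu> ^ 3)"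
    by (simp add: sum_distrib_left mult_ac)
  finally show ?thesis by (simp only: k_def)
qed

context pos_form begin

text \<open>The covariance of the form with itself. The sums in the limit are bounded in M, so one K
  serves all M, although the T from which the bound holds depends on M.\<close>

lemma trig_poly_square_bound:
  obtains K where "\<And>M. \<forall>\<^sub>F T in at_top. mean T (\<lambda>t. (trig_poly M t)\<^sup>2) \<le> K"
proof -
  obtain C where C: "\<And>M. (\<Sum>\<nu>\<in>{\<nu> \<in> spec. \<nu> \<le> M}. (real (mult_of \<nu>))\<^sup>2 / \<nu> ^ 3) \<le> C"
    using mult_of_square_sum_bound by blast
  define k where "k = A * A * kap\<^sup>2 / 2"
  have k: "k \<ge> 0" by (simp add: k_def)
  have "\<forall>\<^sub>F T in at_top. mean T (\<lambda>t. (trig_poly M t)\<^sup>2) \<le> k * C + 1" for M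
  proof -
    have "((\<lambda>T. mean T (\<lambda>t. trig_poly M t * trig_poly M t)) \<longlongrightarrow> k * (\<Sum>\<nu>\<in>{\<nu> \<in> spec. \<nu> \<le> M}. real (mult_of \<nu>) * real (mult_of \<nu>) / \<nu> ^ 3)) at_top"
      using trig_poly_covariance[OF pos_form_axioms pos_form_axioms, of M] by (simp add: k_def)
    moreover have "k * (\<Sum>\<nu>\<in>{\<nu> \<in> spec. \<nu> \<le> M}. real (mult_of \<nu>) * real (mult_of \<nu>) / \<nu> ^ 3) < k * C + 1"
      using mult_left_mono[OF C[of M] k] by (simp add: power2_eq_square)
    ultimately have "\<forall>\<^sub>F T in at_top. mean T (\<lambda>t. trig_poly M t * trig_poly M t) < k * C + 1" by (rule order_tendstoD(2))
    then show ?thesis by eventually_elim (simp add: power2_eq_square)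
  qed
  then show thesis by (rule that)
qed

section \<open>Translation to the given definitions, and the covariance formula\<close>

lemma ellipse_eq_E: "ellipse a b c = E 1"
  by (auto simp: ellipse_def E_def Q_def)

lemma normalized_error_eq_F:
  assumes R: "R > 0" shows "normalized_error (ellipse a b c) R = F R"
proof -
  have "p \<in> (\<lambda>p. R *\<^sub>R p) ` E 1 \<longleftrightarrow> p \<in> E R" for p
  proof -
    have Qs: "Q (r *\<^sub>R p) = r\<^sup>2 * Q p" for r p by (simp add: Q_def power2_eq_square algebra_simps)
    have "p \<in> (\<lambda>p. R *\<^sub>R p) ` E 1 \<longleftrightarrow> (1 / R) *\<^sub>R p \<in> E 1"
      using R by (auto simp: image_iff intro!: bexI[of _ "(1 / R) *\<^sub>R p"])
    also have "\<dots> \<longleftrightarrow> p \<in> E R" using R by (simp add: E_def Qs power_divide field_simps)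
    finally show ?thesis .
  qed
  then have "{(m :: int, n :: int). (of_int m, of_int n) \<in> (\<lambda>p. R *\<^sub>R p) ` ellipse a b c} = L R"
    by (auto simp: ellipse_eq_E L_def emb_def)
  moreover have "measure lebesgue (ellipse a b c) = A"
    using measure_E[of 1] by (simp add: ellipse_eq_E)
  ultimately show ?thesis by (simp add: normalized_error_def lattice_error_def lattice_count_def F_def)
qed

lemma freq_mult_eq_mult_of: "freq_mult a b c \<nu> = mult_of \<nu>"
proof -
  have "{(n1 :: int, n2 :: int). 4 * pi * (sqrt (c * (of_int n1)\<^sup>2 - b * of_int n1 * of_int n2 + a * (of_int n2)\<^sup>2)
         / sqrt (4 * a * c - b\<^sup>2)) = \<nu>} = {n. freq (emb n) = \<nu>}"
    by (auto simp: freq_def Qadj_def D_def emb_def)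
  then show ?thesis by (simp add: freq_mult_def mult_of_def)
qed

end

lemma has_covariance_cong:
  assumes "\<And>t. t \<ge> 1 \<Longrightarrow> F t = F' t" "\<And>t. t \<ge> 1 \<Longrightarrow> G t = G' t"
  shows "has_covariance F G C \<longleftrightarrow> has_covariance F' G' C"
proof -
  have "set_integrable lborel {1..T} (\<lambda>t. F t * G t) = set_integrable lborel {1..T} (\<lambda>t. F' t * G' t)"
    "(LBINT t:{1..T}. F t * G t) = (LBINT t:{1..T}. F' t * G' t)" for T
    using assms by (intro set_integrable_cong set_lebesgue_integral_cong; auto)+
  then show ?thesis by (simp add: has_covariance_def)
qed

text \<open>Links the unordered infinite sum with truncation by size, the form in which the
  covariances of the polynomials arrive; finiteness of the truncations makes them a cofinal family
  of finite subsets of V.\<close>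

lemma sum_le_tendsto_infsum:
  fixes f :: "real \<Rightarrow> real"
  assumes f: "f summable_on V" and fin: "\<And>M. finite {\<nu> \<in> V. \<nu> \<le> M}"
  shows "(\<lambda>M::nat. \<Sum>\<nu>\<in>{\<nu> \<in> V. \<nu> \<le> real M}. f \<nu>) \<longlonglongrightarrow> infsum f V"
proof -
  have "filterlim (\<lambda>M::nat. {\<nu> \<in> V. \<nu> \<le> real M}) (finite_subsets_at_top V) sequentially"
    unfolding filterlim_finite_subsets_at_top
  proof (intro allI impI)
    fix X assume X: "finite X \<and> X \<subseteq> V"
    have "\<forall>\<^sub>F M in sequentially. \<forall>\<nu>\<in>X. \<nu> \<le> real M"
    proof (rule eventually_ball_finite)
      show "\<forall>\<nu>\<in>X. \<forall>\<^sub>F M in sequentially. \<nu> \<le> real M"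
        using filterlim_real_sequentially by (auto simp: filterlim_at_top)
    qed (use X in simp)
    then show "\<forall>\<^sub>F M in sequentially. finite {\<nu> \<in> V. \<nu> \<le> real M} \<and> X \<subseteq> {\<nu> \<in> V. \<nu> \<le> real M} \<and> {\<nu> \<in> V. \<nu> \<le> real M} \<subseteq> V"
      by eventually_elim (use X fin in auto)
  qed
  from filterlim_compose[OF infsum_tendsto[OF f] this] show ?thesis .
qed

theorem corollary1p3:
  fixes a b c d e f :: real
  assumes "a > 0" and "d > 0"
    and "4 * a * c - b\<^sup>2 > 0" and "4 * d * f - e\<^sup>2 > 0"
  shows "(\<lambda>\<nu>. real (freq_mult a b c \<nu>) * real (freq_mult d e f \<nu>) / \<nu> ^ 3) summable_on
      {\<nu>. \<nu> > 0 \<and> freq_mult a b c \<nu> \<noteq> 0 \<and> freq_mult d e f \<nu> \<noteq> 0} \<and>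
    has_covariance (normalized_error (ellipse a b c)) (normalized_error (ellipse d e f))
      (16 * pi / (sqrt (4 * a * c - b\<^sup>2) * sqrt (4 * d * f - e\<^sup>2)) *
       (\<Sum>\<^sub>\<infinity>\<nu>\<in>{\<nu>. \<nu> > 0 \<and> freq_mult a b c \<nu> \<noteq> 0 \<and> freq_mult d e f \<nu> \<noteq> 0}.
          real (freq_mult a b c \<nu>) * real (freq_mult d e f \<nu>) / \<nu> ^ 3))"
proof -
  interpret X: pos_form a b c using assms by unfold_locales
  interpret Y: pos_form d e f using assms by unfold_locales
  define V where "V = X.spec \<inter> Y.spec"
  define g where "g = (\<lambda>\<nu>. real (X.mult_of \<nu>) * real (Y.mult_of \<nu>) / \<nu> ^ 3)"
  have V: "{\<nu>. \<nu> > 0 \<and> X.mult_of \<nu> \<noteq> 0 \<and> Y.mult_of \<nu> \<noteq> 0} = V"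
    by (auto simp: V_def X.spec_def Y.spec_def)
  have finV: "finite {\<nu> \<in> V. \<nu> \<le> M}" for M
    by (rule finite_subset[OF _ X.finite_spec_le[of M]]) (auto simp: V_def)
  \<comment> \<open>The product of the multiplicities is at most the sum of their squares, which
    reduces the mixed series to the two diagonal ones.\<close>
  have gs: "g summable_on V"
  proof (rule summable_on_comparison_test)
    show "(\<lambda>\<nu>. (real (X.mult_of \<nu>))\<^sup>2 / \<nu> ^ 3 + (real (Y.mult_of \<nu>))\<^sup>2 / \<nu> ^ 3) summable_on V"
      unfolding V_def
      by (intro summable_on_add summable_on_subset[OF X.mult_of_square_summable] summable_on_subset[OF Y.mult_of_square_summable]) auto
    fix \<nu> assume \<nu>: "\<nu> \<in> V"
    then have \<nu>0: "\<nu> > 0" by (simp add: V_def X.spec_def)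
    show "0 \<le> g \<nu>" using \<nu>0 by (simp add: g_def)
    have "2 * (real (X.mult_of \<nu>) * real (Y.mult_of \<nu>)) \<le> (real (X.mult_of \<nu>))\<^sup>2 + (real (Y.mult_of \<nu>))\<^sup>2"
      using sum_squares_bound[of "real (X.mult_of \<nu>)" "real (Y.mult_of \<nu>)"] by simp
    moreover have "0 \<le> real (X.mult_of \<nu>) * real (Y.mult_of \<nu>)" by simp
    ultimately have "real (X.mult_of \<nu>) * real (Y.mult_of \<nu>) \<le> (real (X.mult_of \<nu>))\<^sup>2 + (real (Y.mult_of \<nu>))\<^sup>2" by linarith
    then show "g \<nu> \<le> (real (X.mult_of \<nu>))\<^sup>2 / \<nu> ^ 3 + (real (Y.mult_of \<nu>))\<^sup>2 / \<nu> ^ 3"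
      unfolding g_def add_divide_distrib[symmetric] using \<nu>0 by (intro divide_right_mono) auto
  qed
  define k where "k = X.A * Y.A * X.kap\<^sup>2 / 2"
  \<comment> \<open>The factors are (2 pi)^2 from the two areas, 8 / pi from \<open>kap\<close>
    squared, and 1/2 from the mean of a squared cosine.\<close>
  have k: "k = 16 * pi / (sqrt (4 * a * c - b\<^sup>2) * sqrt (4 * d * f - e\<^sup>2))"
  proof -
    have "X.kap\<^sup>2 = 8 / pi" by (simp add: X.kap_def power_mult_distrib)
    then show ?thesis by (simp add: k_def X.A_def Y.A_def X.D_def Y.D_def)
  qed
  obtain K1 where K1: "\<And>M. \<forall>\<^sub>F T in at_top. mean T (\<lambda>t. (X.trig_poly M t)\<^sup>2) \<le> K1"
    using X.trig_poly_square_bound by blast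
  obtain K2 where K2: "\<And>M. \<forall>\<^sub>F T in at_top. mean T (\<lambda>t. (Y.trig_poly M t)\<^sup>2) \<le> K2"
    using Y.trig_poly_square_bound by blast
  have "has_covariance X.F Y.F (k * infsum g V)"
  proof (rule has_covariance_approximation[where K = "max K1 K2" and c = "\<lambda>M. k * (\<Sum>\<nu>\<in>{\<nu> \<in> V. \<nu> \<le> real M}. g \<nu>)"])
    show "bdd_meas_on {1..T} (X.trig_poly (real M))" "bdd_meas_on {1..T} (Y.trig_poly (real M))" for T M
      by (intro bdd_meas_on_continuous X.continuous_trig_poly Y.continuous_trig_poly)+
    show "\<forall>\<^sub>F T in at_top. mean T (\<lambda>t. (X.trig_poly (real M) t)\<^sup>2) \<le> max K1 K2" for M
      by (rule eventually_mono[OF K1[of "real M"]]) linarith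
    show "\<forall>\<^sub>F T in at_top. mean T (\<lambda>t. (Y.trig_poly (real M) t)\<^sup>2) \<le> max K1 K2" for M
      by (rule eventually_mono[OF K2[of "real M"]]) linarith
    show "((\<lambda>T. mean T (\<lambda>t. X.trig_poly (real M) t * Y.trig_poly (real M) t)) \<longlongrightarrow> k * (\<Sum>\<nu>\<in>{\<nu> \<in> V. \<nu> \<le> real M}. g \<nu>)) at_top" for M
      unfolding k_def g_def V_def by (rule trig_poly_covariance[OF X.pos_form_axioms Y.pos_form_axioms])
    show "(\<lambda>M. k * (\<Sum>\<nu>\<in>{\<nu> \<in> V. \<nu> \<le> real M}. g \<nu>)) \<longlonglongrightarrow> k * infsum g V"
      by (intro tendsto_mult_left sum_le_tendsto_infsum gs finV)
  qed (fact X.bdd_meas_on_F Y.bdd_meas_on_F X.mean_square_approximation_eventually Y.mean_square_approximation_eventually)+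
  \<comment> \<open>The two normalised errors are identified for t > 0, and all means start at
    1.\<close>
  moreover have "has_covariance X.F Y.F C \<longleftrightarrow> has_covariance (normalized_error (ellipse a b c)) (normalized_error (ellipse d e f)) C" for C
    by (rule has_covariance_cong) (auto simp: X.normalized_error_eq_F Y.normalized_error_eq_F)
  ultimately show ?thesis
    using gs unfolding X.freq_mult_eq_mult_of Y.freq_mult_eq_mult_of V k[symmetric] g_def by blast
qed

end
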